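(* (a) Let $x^*$ be a strict local minimizer of the cardinality constrained problem (P) (or let $(x^*,y^* )$ be a strict local minimum of the reformulation (R) with respect to $x$ and $\|x^*\|_0=\kappa$) such that CC-MFCQ holds in $x^*$. Then there exist $T>0$ and $r>0$ such that for all $t\in(0,T]$ the program $\mathrm{NLP}(t)$ has a local minimum $(x^t,y^t)$ that is also a KKT point of $\mathrm{NLP}(t)$, with $x^t\in B_r(x^* )$. (b) Let $(x^*,y^* )\in Z$ satisfy CC-MFCQ and choose $r>0$ sufficiently small. Consider a sequence $(t_k)_k\downarrow0$ and KKT points $(x^k,y^k)$ of $\mathrm{NLP}(t_k)$ such that $x^k\in B_r(x^* )$ for all $k\in\mathbb{N}$. Then the sequence $(x^k,y^k)_k$ has accumulation points and every accumulation point $(\bar x,\bar y)$ is an S-stationary point of (R). (c) Let $f,g,h$ be twice continuously differentiable. Let $(x^*,y^* )$ be a strict local minimum of (R) with respect to $x$ and $\|x^*\|_0=\kappa$ such that CC-MFCQ holds and $$d_x^T\left(\nabla^2f(x^* )+\sum_{i=1}^m\lambda_i\nabla^2g_i(x^* )+\sum_{i=1}^p\mu_i\nabla^2h_i(x^* )\right)d_x>0$$ holds for all $(d_x,d_y)\in\mathcal{C}^{CC}_Z(x^*,y^* )$ with $d_x\neq0$ and all S-stationary multipliers $(\lambda,\mu,\gamma)$ of $(x^*,y^* )$. Then there exists $r>0$ such that for all sequences $(t_k)_k\downarrow0$, for all $k$ sufficiently large $\mathrm{NLP}(t_k)$ has a KKT point $(x^k,y^k)$ with $x^k\in B_r(x^*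 )$, and $(x^k,y^k)\to(x^*,y^* )$. (d) Let $f,g,h$ be twice continuously differentiable. Let $x^*$ be a strict local minimum of (P) such that CC-MFCQ holds and $$d_x^T\left(\nabla^2f(x^* )+\sum_{i=1}^m\lambda_i\nabla^2g_i(x^* )+\sum_{i=1}^p\mu_i\nabla^2h_i(x^* )\right)d_x>0$$ holds for all $d_x\in\mathcal{C}_{\mathcal{X}}(x^* )$ with $d_x\neq0$ and all M-stationary multipliers $(\lambda,\mu,\gamma)$ of $x^*$. Then there exists $r>0$ such that for all sequences $(t_k)_k\downarrow0$, for all $k$ sufficiently large $\mathrm{NLP}(t_k)$ has a KKT point $(x^k,y^k)$ with $x^k\in B_r(x^* )$, and $x^k\to x^*$.
   Context: Setting. $f:\mathbb{R}^n\to\mathbb{R}$, $g:\mathbb{R}^n\to\mathbb{R}^m$, $h:\mathbb{R}^n\to\mathbb{R}^p$ are continuously differentiable, $\kappa<n$ is an integer, $X=\{x\in\mathbb{R}^n\mid g(x)\le 0,\ h(x)=0\}$, $\|x\|_0$ is the number of nonzero components of $x$, and $\mathcal{X}:=\{x\in X\mid \|x\|_0\le\kappa\}\neq\emptyset$. The cardinality constrained problem (P) is: minimize $f(x)$ subject to $x\in X$, $\|x\|_0\le\kappa$. The reformulation (R) is: minimize $f(x)$ over $(x,y)\in\mathbb{R}^n\times\mathbb{R}^n$ subject to $g(x)\le0$, $h(x)=0$, $0\le y\le e$, $e^Ty\ge n-\kappa$, $x\circ y=0$, where $e$ is the all-ones vector and $\circ$ is the componentwise product. $Z$ denotes the feasible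 set of (R). $e_i$ denotes the $i$-th unit vector and $B_r(\cdot)$ an open ball of radius $r$ with respect to an arbitrary norm. For $t\ge0$ the (Scholtes-)regularized program $\mathrm{NLP}(t)$ is: minimize $f(x)$ over $(x,y)\in\mathbb{R}^n\times\mathbb{R}^n$ subject to $g(x)\le0$, $h(x)=0$, $0\le y\le e$, $e^Ty\ge n-\kappa$, $-te\le x\circ y\le te$. KKT points of $\mathrm{NLP}(t)$ are understood in the standard sense of nonlinear programming in the variables $(x,y)$. $(t_k)_k\downarrow0$ denotes a sequence of positive numbers decreasing to $0$. $x^*$ is a strict local minimum (minimizer) of (P) if it is feasible for (P) and there is $\rho>0$ with $f(x)>f(x^* )$ for all feasible $x\in B_\rho(x^* )\setminus\{x^*\}$. A point $(x^*,y^* )\in Z$ is a strict local minimum with respect to $x$ of (R) if there is $\rho>0$ such that $f(x^* )<f(x)$ for all $(x,y)\in B_\rho(x^*,y^* )\cap Z$ with $x\ne x^*$. Index sets for $(x^*,y^* )\in Z$: $I_g=I_g(x^* )=\{i\mid g_i(x^* )=0\}$, $I_0=I_0(x^* )=\{i\mid x_i^*=0\}$, $I_{\pm0}=\{i\mid x_i^*\ne0,\ y_i^*=0\}$, $I_{00}=\{i\mid x_i^*=0,\ y_i^*=0\}$, $I_{0+}=\{i\mid x_i^*=0,\ y_i^*\in(0,1)\}$, $I_{01}=\{i\mid x_i^*=0,\ y_i^*=1\}$. Stationarity: $(x^*,y^* )\in Z$ is M-stationary if there is an M-stationary multiplier $(\lambda,\mu,\gamma)\in\mathbb{R}^m\times\mathbb{R}^p\times\mathbb{R}^n$,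 i.e. one with $\nabla f(x^* )+\sum_{i=1}^m\lambda_i\nabla g_i(x^* )+\sum_{i=1}^p\mu_i\nabla h_i(x^* )+\sum_{i=1}^n\gamma_ie_i=0$, $\lambda_i\ge0$ and $\lambda_ig_i(x^* )=0$ for all $i=1,\dots,m$, and $\gamma_i=0$ for all $i\in I_{\pm0}$. It is S-stationary if there is an S-stationary multiplier, i.e. an M-stationary multiplier that additionally satisfies $\gamma_i=0$ for all $i\in I_{00}$. Since M-stationarity and M-stationary multipliers do not depend on $y^*$, one also speaks of M-stationarity and M-stationary multipliers of a point $x^*$ feasible for (P). Vectors $a_i$ ($i\in A$) and $b_j$ ($j\in B$) are positively linearly dependent if there are $\lambda_i\ge0$ ($i\in A$) and $\mu_j\in\mathbb{R}$ ($j\in B$), not all zero, with $\sum_{i\in A}\lambda_ia_i+\sum_{j\in B}\mu_jb_j=0$; otherwise positively linearly independent. CC-MFCQ holds at $(x^*,y^* )$ (equivalently, at $x^*$) if the vectors $\nabla g_i(x^* )$ ($i\in I_g(x^* )$), in the role of the $a_i$, and $\nabla h_i(x^* )$ ($i=1,\dots,p$), $e_i$ ($i\in I_0(x^* )$), in the role of the $b_j$, are positively linearly independent. CC-linearisation cone: $\mathcal{L}^{CC}_Z(x^*,y^* )$ is the set of all $(d_x,d_y)\in\mathbb{R}^n\times\mathbb{R}^n$ with $\nabla g_i(x^* )^Td_x\le0$ for $i\in I_g$; $\nabla h_i(x^* )^Td_x=0$ for $i=1,\dots,p$; $e^Td_y\ge0$ if $e^Ty^*=n-\kappa$; $e_i^Td_y=0$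 for $i\in I_{\pm0}$; $e_i^Td_y\ge0$ for $i\in I_{00}$; $e_i^Td_y\le0$ for $i\in I_{01}$; $e_i^Td_x=0$ for $i\in I_{01}\cup I_{0+}$; $(e_i^Td_x)(e_i^Td_y)=0$ for $i\in I_{00}$. CC-critical cone: $\mathcal{C}^{CC}_Z(x^*,y^* )=\{(d_x,d_y)\in\mathcal{L}^{CC}_Z(x^*,y^* )\mid\nabla f(x^* )^Td_x\le0\}$. For $x^*\in\mathcal{X}$: $\mathcal{L}_{\mathcal{X}}(x^* )$ is the set of all $d_x\in\mathbb{R}^n$ for which there exist $y\in\mathbb{R}^n$ with $(x^*,y)\in Z$ and $d_y\in\mathbb{R}^n$ with $(d_x,d_y)\in\mathcal{L}^{CC}_Z(x^*,y)$; equivalently, the set of $d_x$ with $\nabla g_i(x^* )^Td_x\le0$ for $i\in I_g(x^* )$, $\nabla h_i(x^* )^Td_x=0$ for $i=1,\dots,p$, and $|\{i\in I_0(x^* )\mid(d_x)_i=0\}|\ge n-\kappa$. Further, $\mathcal{C}_{\mathcal{X}}(x^* )=\{d_x\in\mathcal{L}_{\mathcal{X}}(x^* )\mid\nabla f(x^* )^Td_x\le0\}$. *)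

theory Defs
  imports "HOL-Analysis.Analysis"
begin

text \<open>Balls are taken with respect to an arbitrary norm, which need not be the norm
  of the type class.\<close>

definition is_norm :: "('a::real_vector \<Rightarrow> real) \<Rightarrow> bool" where
  "is_norm N \<longleftrightarrow>
     (\<forall>v. 0 \<le> N v) \<and> (\<forall>v. N v = 0 \<longrightarrow> v = 0) \<and>
     (\<forall>c v. N (c *\<^sub>R v) = \<bar>c\<bar> * N v) \<and> (\<forall>v w. N (v + w) \<le> N v + N w)"

definition nball :: "('a::real_vector \<Rightarrow> real) \<Rightarrow> 'a \<Rightarrow> real \<Rightarrow> 'a set" where
  "nball N c r = {v. N (v - c) < r}"

definition grad :: "('a::euclidean_space \<Rightarrow> real) \<Rightarrow> 'a \<Rightarrow> 'a" where
  "grad F z = (THE D. GDERIV F z :> D)"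

lemma GDERIV_grad:
  assumes "F differentiable (at z)"
  shows "GDERIV F z :> grad F z"
proof -
  obtain F' where F': "(F has_derivative F') (at z)"
    using assms unfolding differentiable_def by blast
  then have lin: "linear F'"
    by (rule has_derivative_linear)
  define D where "D = (\<Sum>b\<in>Basis. F' b *\<^sub>R b)"
  have "F' v = v \<bullet> D" for v
  proof -
    have "F' v = F' (\<Sum>b\<in>Basis. (v \<bullet> b) *\<^sub>R b)"
      by (simp add: euclidean_representation)
    also have "\<dots> = (\<Sum>b\<in>Basis. (v \<bullet> b) * F' b)"
      by (simp add: linear_sum[OF lin] linear_cmul[OF lin])
    also have "\<dots> = v \<bullet> D"
      unfolding D_def by (simp add: inner_sum_right mult.commute)
    finally show ?thesis .
  qed
  then have "F' = (\<lambda>v. v \<bullet> D)"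
    by blast
  with F' have D: "GDERIV F z :> D"
    unfolding gderiv_def by simp
  moreover have "D' = D" if D': "GDERIV F z :> D'" for D'
  proof -
    have "(\<lambda>v. v \<bullet> D') = (\<lambda>v. v \<bullet> D)"
      using D' D unfolding gderiv_def by (rule has_derivative_unique)
    then have "(D' - D) \<bullet> D' = (D' - D) \<bullet> D"
      by (rule fun_cong)
    then have "(D' - D) \<bullet> (D' - D) = 0"
      by (simp add: inner_diff_right)
    then show ?thesis
      by simp
  qed
  ultimately show ?thesis
    unfolding grad_def by (rule theI)
qed

definition hessian :: "(real^'n \<Rightarrow> real) \<Rightarrow> real^'n \<Rightarrow> real^'n^'n" where
  "hessian F x = jacobian (grad F) (at x)"

definition cont_diff :: "(real^'n \<Rightarrow> real) \<Rightarrow> bool" where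
  "cont_diff F \<longleftrightarrow> (\<forall>x. F differentiable (at x)) \<and> continuous_on UNIV (grad F)"

definition twice_cont_diff :: "(real^'n \<Rightarrow> real) \<Rightarrow> bool" where
  "twice_cont_diff F \<longleftrightarrow>
     cont_diff F \<and> (\<forall>x. grad F differentiable (at x)) \<and> continuous_on UNIV (hessian F)"

text \<open>The maps \<open>g\<close> and \<open>h\<close> are given by their component functions \<open>g i\<close>, \<open>i < m\<close>, and
  \<open>h i\<close>, \<open>i < p\<close>, so that \<open>m = 0\<close> and \<open>p = 0\<close> are allowed. The same holds for the
  multiplier vectors \<open>lam\<close> and \<open>\<mu>\<close>; their values at indices \<open>\<ge> m\<close> and \<open>\<ge> p\<close> are never used.\<close>

definition norm0 :: "real^'n \<Rightarrow> nat" where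
  "norm0 x = card {i. x $ i \<noteq> 0}"

definition feas_P ::
  "(nat \<Rightarrow> real^'n \<Rightarrow> real) \<Rightarrow> nat \<Rightarrow> (nat \<Rightarrow> real^'n \<Rightarrow> real) \<Rightarrow> nat \<Rightarrow> nat \<Rightarrow> (real^'n) set" where
  "feas_P g m h p \<kappa> = {x. (\<forall>i<m. g i x \<le> 0) \<and> (\<forall>i<p. h i x = 0) \<and> norm0 x \<le> \<kappa>}"

definition feas_R ::
  "(nat \<Rightarrow> real^'n \<Rightarrow> real) \<Rightarrow> nat \<Rightarrow> (nat \<Rightarrow> real^'n \<Rightarrow> real) \<Rightarrow> nat \<Rightarrow> nat \<Rightarrow>
    ((real^'n) \<times> (real^'n)) set" where
  "feas_R g m h p \<kappa> =
     {(x, y). (\<forall>i<m. g i x \<le> 0) \<and> (\<forall>i<p. h i x = 0) \<and>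
       (\<forall>i. 0 \<le> y $ i \<and> y $ i \<le> 1) \<and>
       (\<Sum>i\<in>UNIV. y $ i) \<ge> real CARD('n) - real \<kappa> \<and>
       (\<forall>i. x $ i * y $ i = 0)}"

definition strict_local_min_P ::
  "(real^'n \<Rightarrow> real) \<Rightarrow> (real^'n \<Rightarrow> real) \<Rightarrow> (nat \<Rightarrow> real^'n \<Rightarrow> real) \<Rightarrow> nat \<Rightarrow>
    (nat \<Rightarrow> real^'n \<Rightarrow> real) \<Rightarrow> nat \<Rightarrow> nat \<Rightarrow> real^'n \<Rightarrow> bool" where
  "strict_local_min_P N f g m h p \<kappa> xs \<longleftrightarrow>
     xs \<in> feas_P g m h p \<kappa> \<and>
     (\<exists>\<rho>>0. \<forall>x \<in> feas_P g m h p \<kappa> \<inter> (nball N xs \<rho> - {xs}). f x > f xs)"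

definition strict_local_min_R ::
  "((real^'n) \<times> (real^'n) \<Rightarrow> real) \<Rightarrow> (real^'n \<Rightarrow> real) \<Rightarrow> (nat \<Rightarrow> real^'n \<Rightarrow> real) \<Rightarrow> nat \<Rightarrow>
    (nat \<Rightarrow> real^'n \<Rightarrow> real) \<Rightarrow> nat \<Rightarrow> nat \<Rightarrow> real^'n \<Rightarrow> real^'n \<Rightarrow> bool" where
  "strict_local_min_R N f g m h p \<kappa> xs ys \<longleftrightarrow>
     (xs, ys) \<in> feas_R g m h p \<kappa> \<and>
     (\<exists>\<rho>>0. \<forall>(x, y) \<in> nball N (xs, ys) \<rho> \<inter> feas_R g m h p \<kappa>. x \<noteq> xs \<longrightarrow> f xs < f x)"

text \<open>A nonlinear program: minimize \<open>F z\<close> subject to \<open>G i z \<le> 0\<close> for \<open>i \<in> I\<close> and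
  \<open>H j z = 0\<close> for \<open>j \<in> J\<close>, where \<open>I\<close> and \<open>J\<close> are finite.\<close>

definition nlp_feas :: "'i set \<Rightarrow> ('i \<Rightarrow> 'a \<Rightarrow> real) \<Rightarrow> 'j set \<Rightarrow> ('j \<Rightarrow> 'a \<Rightarrow> real) \<Rightarrow> 'a set" where
  "nlp_feas I G J H = {z. (\<forall>i\<in>I. G i z \<le> 0) \<and> (\<forall>j\<in>J. H j z = 0)}"

definition kkt_point ::
  "('a::euclidean_space \<Rightarrow> real) \<Rightarrow> 'i set \<Rightarrow> ('i \<Rightarrow> 'a \<Rightarrow> real) \<Rightarrow> 'j set \<Rightarrow> ('j \<Rightarrow> 'a \<Rightarrow> real) \<Rightarrow>
    'a \<Rightarrow> bool" where
  "kkt_point F I G J H z \<longleftrightarrow>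
     z \<in> nlp_feas I G J H \<and>
     (\<exists>lam \<mu>. grad F z + (\<Sum>i\<in>I. lam i *\<^sub>R grad (G i) z) + (\<Sum>j\<in>J. \<mu> j *\<^sub>R grad (H j) z) = 0 \<and>
            (\<forall>i\<in>I. lam i \<ge> 0 \<and> lam i * G i z = 0))"

definition local_min_on :: "('a::real_vector \<Rightarrow> real) \<Rightarrow> ('a \<Rightarrow> real) \<Rightarrow> 'a set \<Rightarrow> 'a \<Rightarrow> bool" where
  "local_min_on N F S z \<longleftrightarrow> z \<in> S \<and> (\<exists>\<rho>>0. \<forall>w \<in> S \<inter> nball N z \<rho>. F z \<le> F w)"

text \<open>Indices of the inequality constraints of \<open>NLP(t)\<close>: \<open>g\<^sub>i(x) \<le> 0\<close>,
  \<open>n - \<kappa> - e\<^sup>Ty \<le> 0\<close>, \<open>-y\<^sub>i \<le> 0\<close>, \<open>y\<^sub>i - 1 \<le> 0\<close>, \<open>x\<^sub>iy\<^sub>i - t \<le> 0\<close> and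
  \<open>-t - x\<^sub>iy\<^sub>i \<le> 0\<close>.\<close>

datatype 'n nlp_idx = CG nat | CSum | CLow 'n | CUp 'n | CProdUp 'n | CProdLow 'n

definition nlp_I :: "nat \<Rightarrow> 'n nlp_idx set" where
  "nlp_I m = CG ` {..<m} \<union> {CSum} \<union> range CLow \<union> range CUp \<union> range CProdUp \<union> range CProdLow"

fun nlp_G ::
  "(nat \<Rightarrow> real^'n \<Rightarrow> real) \<Rightarrow> nat \<Rightarrow> real \<Rightarrow> 'n nlp_idx \<Rightarrow> (real^'n) \<times> (real^'n) \<Rightarrow> real" where
  "nlp_G g \<kappa> t (CG i) (x, y) = g i x"
| "nlp_G g \<kappa> t CSum (x, y) = (real CARD('n) - real \<kappa>) - (\<Sum>i\<in>UNIV. y $ i)"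
| "nlp_G g \<kappa> t (CLow i) (x, y) = - (y $ i)"
| "nlp_G g \<kappa> t (CUp i) (x, y) = y $ i - 1"
| "nlp_G g \<kappa> t (CProdUp i) (x, y) = x $ i * y $ i - t"
| "nlp_G g \<kappa> t (CProdLow i) (x, y) = - t - x $ i * y $ i"

definition NLP_local_min ::
  "((real^'n) \<times> (real^'n) \<Rightarrow> real) \<Rightarrow> (real^'n \<Rightarrow> real) \<Rightarrow> (nat \<Rightarrow> real^'n \<Rightarrow> real) \<Rightarrow> nat \<Rightarrow>
    (nat \<Rightarrow> real^'n \<Rightarrow> real) \<Rightarrow> nat \<Rightarrow> nat \<Rightarrow> real \<Rightarrow> (real^'n) \<times> (real^'n) \<Rightarrow> bool" where
  "NLP_local_min N f g m h p \<kappa> t z \<longleftrightarrow>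
     local_min_on N (\<lambda>w. f (fst w))
       (nlp_feas (nlp_I m) (nlp_G g \<kappa> t) {..<p} (\<lambda>j w. h j (fst w))) z"

definition NLP_KKT ::
  "(real^'n \<Rightarrow> real) \<Rightarrow> (nat \<Rightarrow> real^'n \<Rightarrow> real) \<Rightarrow> nat \<Rightarrow>
    (nat \<Rightarrow> real^'n \<Rightarrow> real) \<Rightarrow> nat \<Rightarrow> nat \<Rightarrow> real \<Rightarrow> (real^'n) \<times> (real^'n) \<Rightarrow> bool" where
  "NLP_KKT f g m h p \<kappa> t z \<longleftrightarrow>
     kkt_point (\<lambda>w. f (fst w)) (nlp_I m) (nlp_G g \<kappa> t) {..<p} (\<lambda>j w. h j (fst w)) z"

definition I_g :: "(nat \<Rightarrow> real^'n \<Rightarrow> real) \<Rightarrow> nat \<Rightarrow> real^'n \<Rightarrow> nat set" where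
  "I_g g m x = {i. i < m \<and> g i x = 0}"

definition I_0 :: "real^'n \<Rightarrow> 'n set" where
  "I_0 x = {i. x $ i = 0}"

definition I_pm0 :: "real^'n \<Rightarrow> real^'n \<Rightarrow> 'n set" where
  "I_pm0 x y = {i. x $ i \<noteq> 0 \<and> y $ i = 0}"

definition I_00 :: "real^'n \<Rightarrow> real^'n \<Rightarrow> 'n set" where
  "I_00 x y = {i. x $ i = 0 \<and> y $ i = 0}"

definition I_0p :: "real^'n \<Rightarrow> real^'n \<Rightarrow> 'n set" where
  "I_0p x y = {i. x $ i = 0 \<and> 0 < y $ i \<and> y $ i < 1}"

definition I_01 :: "real^'n \<Rightarrow> real^'n \<Rightarrow> 'n set" where
  "I_01 x y = {i. x $ i = 0 \<and> y $ i = 1}"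

definition M_multiplier ::
  "(real^'n \<Rightarrow> real) \<Rightarrow> (nat \<Rightarrow> real^'n \<Rightarrow> real) \<Rightarrow> nat \<Rightarrow> (nat \<Rightarrow> real^'n \<Rightarrow> real) \<Rightarrow> nat \<Rightarrow>
    real^'n \<Rightarrow> real^'n \<Rightarrow> (nat \<Rightarrow> real) \<Rightarrow> (nat \<Rightarrow> real) \<Rightarrow> real^'n \<Rightarrow> bool" where
  "M_multiplier f g m h p x y lam \<mu> \<gamma> \<longleftrightarrow>
     grad f x + (\<Sum>i<m. lam i *\<^sub>R grad (g i) x) + (\<Sum>i<p. \<mu> i *\<^sub>R grad (h i) x)
       + (\<Sum>i\<in>UNIV. \<gamma> $ i *\<^sub>R axis i 1) = 0 \<and>
     (\<forall>i<m. lam i \<ge> 0 \<and> lam i * g i x = 0) \<and>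
     (\<forall>i \<in> I_pm0 x y. \<gamma> $ i = 0)"

definition S_multiplier ::
  "(real^'n \<Rightarrow> real) \<Rightarrow> (nat \<Rightarrow> real^'n \<Rightarrow> real) \<Rightarrow> nat \<Rightarrow> (nat \<Rightarrow> real^'n \<Rightarrow> real) \<Rightarrow> nat \<Rightarrow>
    real^'n \<Rightarrow> real^'n \<Rightarrow> (nat \<Rightarrow> real) \<Rightarrow> (nat \<Rightarrow> real) \<Rightarrow> real^'n \<Rightarrow> bool" where
  "S_multiplier f g m h p x y lam \<mu> \<gamma> \<longleftrightarrow>
     M_multiplier f g m h p x y lam \<mu> \<gamma> \<and> (\<forall>i \<in> I_00 x y. \<gamma> $ i = 0)"

definition S_stationary ::
  "(real^'n \<Rightarrow> real) \<Rightarrow> (nat \<Rightarrow> real^'n \<Rightarrow> real) \<Rightarrow> nat \<Rightarrow> (nat \<Rightarrow> real^'n \<Rightarrow> real) \<Rightarrow> nat \<Rightarrow> nat \<Rightarrow>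
    real^'n \<Rightarrow> real^'n \<Rightarrow> bool" where
  "S_stationary f g m h p \<kappa> x y \<longleftrightarrow>
     (x, y) \<in> feas_R g m h p \<kappa> \<and> (\<exists>lam \<mu> \<gamma>. S_multiplier f g m h p x y lam \<mu> \<gamma>)"

text \<open>Multipliers of a point \<open>x\<close> feasible for the cardinality constrained problem. The choice
  of \<open>y\<close> does not matter: for every feasible \<open>(x, y)\<close>, \<open>I_pm0 x y\<close> is the support of \<open>x\<close>.\<close>

definition M_multiplier_at ::
  "(real^'n \<Rightarrow> real) \<Rightarrow> (nat \<Rightarrow> real^'n \<Rightarrow> real) \<Rightarrow> nat \<Rightarrow> (nat \<Rightarrow> real^'n \<Rightarrow> real) \<Rightarrow> nat \<Rightarrow> nat \<Rightarrow>
    real^'n \<Rightarrow> (nat \<Rightarrow> real) \<Rightarrow> (nat \<Rightarrow> real) \<Rightarrow> real^'n \<Rightarrow> bool" where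
  "M_multiplier_at f g m h p \<kappa> x lam \<mu> \<gamma> \<longleftrightarrow>
     (\<exists>y. (x, y) \<in> feas_R g m h p \<kappa> \<and> M_multiplier f g m h p x y lam \<mu> \<gamma>)"

definition pos_lin_dependent ::
  "'i set \<Rightarrow> ('i \<Rightarrow> 'v::real_vector) \<Rightarrow> 'j set \<Rightarrow> ('j \<Rightarrow> 'v) \<Rightarrow> bool" where
  "pos_lin_dependent A a B b \<longleftrightarrow>
     (\<exists>lam \<mu>. (\<forall>i\<in>A. lam i \<ge> 0) \<and> ((\<exists>i\<in>A. lam i \<noteq> 0) \<or> (\<exists>j\<in>B. \<mu> j \<noteq> 0)) \<and>
            (\<Sum>i\<in>A. lam i *\<^sub>R a i) + (\<Sum>j\<in>B. \<mu> j *\<^sub>R b j) = 0)"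

definition CC_MFCQ ::
  "(nat \<Rightarrow> real^'n \<Rightarrow> real) \<Rightarrow> nat \<Rightarrow> (nat \<Rightarrow> real^'n \<Rightarrow> real) \<Rightarrow> nat \<Rightarrow> real^'n \<Rightarrow> bool" where
  "CC_MFCQ g m h p x \<longleftrightarrow>
     \<not> pos_lin_dependent (I_g g m x) (\<lambda>i. grad (g i) x)
         ({..<p} <+> I_0 x) (case_sum (\<lambda>i. grad (h i) x) (\<lambda>i. axis i 1))"

definition lin_cone_CC ::
  "(nat \<Rightarrow> real^'n \<Rightarrow> real) \<Rightarrow> nat \<Rightarrow> (nat \<Rightarrow> real^'n \<Rightarrow> real) \<Rightarrow> nat \<Rightarrow> nat \<Rightarrow>
    real^'n \<Rightarrow> real^'n \<Rightarrow> ((real^'n) \<times> (real^'n)) set" where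
  "lin_cone_CC g m h p \<kappa> x y =
     {(dx, dy).
       (\<forall>i \<in> I_g g m x. grad (g i) x \<bullet> dx \<le> 0) \<and>
       (\<forall>i<p. grad (h i) x \<bullet> dx = 0) \<and>
       ((\<Sum>i\<in>UNIV. y $ i) = real CARD('n) - real \<kappa> \<longrightarrow> (\<Sum>i\<in>UNIV. dy $ i) \<ge> 0) \<and>
       (\<forall>i \<in> I_pm0 x y. dy $ i = 0) \<and>
       (\<forall>i \<in> I_00 x y. dy $ i \<ge> 0) \<and>
       (\<forall>i \<in> I_01 x y. dy $ i \<le> 0) \<and>
       (\<forall>i \<in> I_01 x y \<union> I_0p x y. dx $ i = 0) \<and>
       (\<forall>i \<in> I_00 x y. dx $ i * dy $ i = 0)}"

definition crit_cone_CC ::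
  "(real^'n \<Rightarrow> real) \<Rightarrow> (nat \<Rightarrow> real^'n \<Rightarrow> real) \<Rightarrow> nat \<Rightarrow> (nat \<Rightarrow> real^'n \<Rightarrow> real) \<Rightarrow> nat \<Rightarrow> nat \<Rightarrow>
    real^'n \<Rightarrow> real^'n \<Rightarrow> ((real^'n) \<times> (real^'n)) set" where
  "crit_cone_CC f g m h p \<kappa> x y =
     {(dx, dy). (dx, dy) \<in> lin_cone_CC g m h p \<kappa> x y \<and> grad f x \<bullet> dx \<le> 0}"

definition lin_cone_X ::
  "(nat \<Rightarrow> real^'n \<Rightarrow> real) \<Rightarrow> nat \<Rightarrow> (nat \<Rightarrow> real^'n \<Rightarrow> real) \<Rightarrow> nat \<Rightarrow> nat \<Rightarrow>
    real^'n \<Rightarrow> (real^'n) set" where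
  "lin_cone_X g m h p \<kappa> x =
     {dx. \<exists>y dy. (x, y) \<in> feas_R g m h p \<kappa> \<and> (dx, dy) \<in> lin_cone_CC g m h p \<kappa> x y}"

definition crit_cone_X ::
  "(real^'n \<Rightarrow> real) \<Rightarrow> (nat \<Rightarrow> real^'n \<Rightarrow> real) \<Rightarrow> nat \<Rightarrow> (nat \<Rightarrow> real^'n \<Rightarrow> real) \<Rightarrow> nat \<Rightarrow> nat \<Rightarrow>
    real^'n \<Rightarrow> (real^'n) set" where
  "crit_cone_X f g m h p \<kappa> x = {dx \<in> lin_cone_X g m h p \<kappa> x. grad f x \<bullet> dx \<le> 0}"

definition lagr_hessian ::
  "(real^'n \<Rightarrow> real) \<Rightarrow> (nat \<Rightarrow> real^'n \<Rightarrow> real) \<Rightarrow> nat \<Rightarrow> (nat \<Rightarrow> real^'n \<Rightarrow> real) \<Rightarrow> nat \<Rightarrow>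
    real^'n \<Rightarrow> (nat \<Rightarrow> real) \<Rightarrow> (nat \<Rightarrow> real) \<Rightarrow> real^'n^'n" where
  "lagr_hessian f g m h p x lam \<mu> =
     hessian f x + (\<Sum>i<m. lam i *\<^sub>R hessian (g i) x) + (\<Sum>i<p. \<mu> i *\<^sub>R hessian (h i) x)"

definition pos_decreasing_to_0 :: "(nat \<Rightarrow> real) \<Rightarrow> bool" where
  "pos_decreasing_to_0 t \<longleftrightarrow> (\<forall>k. t k > 0) \<and> decseq t \<and> t \<longlonglongrightarrow> 0"

definition accumulation_point :: "(nat \<Rightarrow> 'a::topological_space) \<Rightarrow> 'a \<Rightarrow> bool" where
  "accumulation_point z l \<longleftrightarrow> (\<exists>s::nat \<Rightarrow> nat. strict_mono s \<and> (z \<circ> s) \<longlonglongrightarrow> l)"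

end

theory Submission
  imports Defs
begin

text \<open>The regularized programs change only the coupling between \<open>x\<close> and \<open>y\<close>, so everything rests on
  understanding the multipliers of the \<open>y\<close>-constraints. Eliminating the multipliers of \<open>0 \<le> y \<le> e\<close>
  from the \<open>y\<close>-part of the KKT conditions leaves one number \<open>\<sigma> \<ge> 0\<close>, the multiplier of
  \<open>e\<^sup>Ty \<ge> n - \<kappa>\<close>, and the vector \<open>\<gamma>\<close> with which the product constraints enter the \<open>x\<close>-part; they are tied
  together by \<open>\<bar>\<gamma>\<^sub>i\<bar> t \<le> \<sigma> y\<^sub>i\<^sup>2\<close>, with equality wherever \<open>y\<^sub>i < 1\<close> (\<open>y_stationary\<close>). Hence the sizes of the
  \<open>\<gamma>\<^sub>i\<close> compare like the \<open>y\<^sub>i\<^sup>2\<close>, and where the product constraint is active \<open>y\<^sub>i = t / \<bar>x\<^sub>i\<bar>\<close>.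

  Near \<open>x\<^sup>*\<close> the components \<open>\<gamma>\<^sub>i\<close> with \<open>x\<^sup>*\<^sub>i \<noteq> 0\<close> belong to small \<open>y\<^sub>i\<close>. If one of them is nonzero, then
  \<open>\<kappa> > 0\<close> and \<open>\<sigma> > 0\<close>, which forces \<open>e\<^sup>Ty = n - \<kappa>\<close> and thereby some \<open>y\<^sub>j < 1\<close> with \<open>x\<^sup>*\<^sub>j = 0\<close>, and this
  \<open>y\<^sub>j = t / \<bar>x\<^sub>j\<bar>\<close> is much larger. So the components that CC-MFCQ does not control are dominated by one
  that it does control, and CC-MFCQ bounds all the multipliers \<open>(\<lambda>, \<mu>, \<gamma>)\<close>,
  uniformly in \<open>t\<close> (\<open>regularized_multiplier_estimate\<close>).

  Part (a): minimizing \<open>f\<close> over the feasible set of \<open>NLP(t)\<close> with \<open>x\<close> in a small closed ball gives points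
  whose limits are feasible for the cardinality constrained problem with value at most \<open>f(x\<^sup>*)\<close>, so
  for small \<open>t\<close> the minimizers lie inside the ball and are local minima. For \<open>\<kappa> > 0\<close> the estimate says
  that MFCQ holds for \<open>NLP(t)\<close> there, and a penalty argument (\<open>KKT_of_local_min\<close>) yields KKT multipliers.
  For \<open>\<kappa> = 0\<close> the constraints force \<open>y = e\<close>, MFCQ fails, and the problem in \<open>x\<close> alone is used instead.

  Part (b): the estimate makes the multipliers of a KKT sequence bounded, so they have limit points. If
  \<open>y\<^sub>i\<close> tends to \<open>0\<close>, then \<open>\<gamma>\<^sub>i\<close> is negligible against some \<open>\<gamma>\<^sub>j\<close> whose \<open>y\<^sub>j\<close> stays away from \<open>0\<close>; therefore the
  limit of \<open>\<gamma>\<^sub>i\<close> vanishes, which is S-stationarity (\<open>y_stationary_limit_zero\<close>).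

  Parts (c) and (d): by (a) KKT points exist in every ball, and by (b) their accumulation points are
  S-stationary, hence equal to \<open>x\<^sup>*\<close> once \<open>x\<^sup>*\<close> is an isolated stationary point. Isolation is Robinson's
  argument: if other stationary points \<open>x\<^sup>k\<close> converge to \<open>x\<^sup>*\<close>, a limit \<open>d\<close> of the normalized differences is
  a critical direction, and subtracting the two stationarity conditions shows
  \<open>d\<^sup>T \<nabla>\<^sup>2L d \<le> 0\<close> for the limit multipliers (\<open>limit_critical_direction\<close>). Part (c) is an instance of (d):
  \<open>\<parallel>x\<^sup>*\<parallel>\<^sub>0 = \<kappa>\<close> determines \<open>y\<^sup>*\<close> from \<open>x\<^sup>*\<close>.\<close>

section \<open>Norms and convergent subsequences\<close>

lemma is_norm_equiv:
  fixes N :: "'a::euclidean_space \<Rightarrow> real"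
  assumes "is_norm N"
  obtains a b where "a > 0" "b > 0" "\<And>v. a * norm v \<le> N v" "\<And>v. N v \<le> b * norm v"
proof -
  have nonneg: "0 \<le> N v" and zero: "N v = 0 \<Longrightarrow> v = 0" and
    scale: "N (c *\<^sub>R v) = \<bar>c\<bar> * N v" and tri: "N (v + w) \<le> N v + N w" for c v w
    using assms unfolding is_norm_def by blast+
  have N0: "N 0 = 0"
    using scale[of 0 0] by simp
  have Nsum: "N (\<Sum>i\<in>A. u i) \<le> (\<Sum>i\<in>A. N (u i))" if "finite A" for A and u :: "'a \<Rightarrow> 'a"
    using that
  proof (induction A rule: finite_induct)
    case (insert x F)
    then show ?case using tri[of "u x" "sum u F"] by simp
  qed (simp add: N0)
  define b where "b = (\<Sum>i\<in>Basis. N i) + 1"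
  have "b > 0"
    unfolding b_def by (simp add: add_nonneg_pos sum_nonneg nonneg)
  have upper: "N v \<le> b * norm v" for v
  proof -
    have "N v = N (\<Sum>i\<in>Basis. (v \<bullet> i) *\<^sub>R i)"
      by (simp add: euclidean_representation)
    also have "\<dots> \<le> (\<Sum>i\<in>Basis. \<bar>v \<bullet> i\<bar> * N i)"
      using Nsum[of Basis "\<lambda>i. (v \<bullet> i) *\<^sub>R i"] by (simp add: scale)
    also have "\<dots> \<le> (\<Sum>i\<in>Basis. norm v * N i)"
      by (intro sum_mono mult_right_mono nonneg Basis_le_norm)
    also have "\<dots> \<le> b * norm v"
      unfolding b_def sum_distrib_left[symmetric] by (simp add: algebra_simps)
    finally show ?thesis .
  qed
  have lip: "N v - N w \<le> b * dist v w" for v w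
    using tri[of "v - w" w] upper[of "v - w"] by (simp add: dist_norm)
  have "\<bar>N v - N w\<bar> \<le> b * dist v w" for v w
    using lip[of v w] lip[of w v] by (simp add: dist_commute abs_le_iff)
  then have "b-lipschitz_on UNIV N"
    using \<open>b > 0\<close> by (intro lipschitz_onI) (auto simp: dist_real_def)
  then have "continuous_on UNIV N"
    by (rule lipschitz_on_continuous_on)
  then have cont: "continuous_on (sphere 0 1) N"
    by (rule continuous_on_subset) simp
  have "sphere (0::'a) 1 \<noteq> {}"
    by simp
  then obtain u where u: "u \<in> sphere 0 1" "\<And>v. v \<in> sphere 0 1 \<Longrightarrow> N u \<le> N v"
    using continuous_attains_inf[OF compact_sphere _ cont] by blast
  have "N u > 0"
    using u(1) zero[of u] nonneg[of u] by force
  have lower: "N u * norm v \<le> N v" for v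
  proof (cases "v = 0")
    case False
    then have "N u \<le> N ((1 / norm v) *\<^sub>R v)"
      by (intro u(2)) simp
    with False show ?thesis
      by (simp add: scale field_simps)
  qed (simp add: N0)
  show thesis
    by (rule that[OF \<open>N u > 0\<close> \<open>b > 0\<close> lower upper])
qed

lemma nball_sub_ball:
  fixes N :: "'a::euclidean_space \<Rightarrow> real"
  assumes "is_norm N" "e > 0"
  obtains r where "r > 0" "\<And>s. s \<le> r \<Longrightarrow> nball N c s \<subseteq> ball c e"
proof -
  obtain a b where ab: "a > 0" "\<And>v. a * norm v \<le> N v"
    using is_norm_equiv[OF assms(1)] by metis
  have "nball N c s \<subseteq> ball c e" if "s \<le> a * e" for s
  proof
    fix v assume "v \<in> nball N c s"
    then have "a * norm (v - c) < a * e"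
      using ab(2)[of "v - c"] that by (simp add: nball_def)
    then show "v \<in> ball c e"
      using \<open>a > 0\<close> by (simp add: dist_norm norm_minus_commute)
  qed
  then show thesis
    using that[of "a * e"] ab(1) assms(2) by simp
qed

lemma ball_sub_nball:
  fixes N :: "'a::euclidean_space \<Rightarrow> real"
  assumes "is_norm N" "r > 0"
  obtains e where "e > 0" "ball c e \<subseteq> nball N c r"
proof -
  obtain b where b: "b > 0" "\<And>v. N v \<le> b * norm v"
    using is_norm_equiv[OF assms(1)] by metis
  have "ball c (r / b) \<subseteq> nball N c r"
  proof
    fix v assume "v \<in> ball c (r / b)"
    then have "b * norm (v - c) < r"
      using \<open>b > 0\<close> by (simp add: dist_norm norm_minus_commute field_simps)
    then show "v \<in> nball N c r"
      using b(2)[of "v - c"] by (simp add: nball_def)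
  qed
  then show thesis
    using that[of "r / b"] b(1) assms(2) by simp
qed

text \<open>Multipliers are handled as functions restricted to a finite index set, so Bolzano-Weierstrass is
  stated for bounded sequences of such functions.\<close>

lemma finite_family_convergent_subseq:
  fixes u :: "nat \<Rightarrow> 'i \<Rightarrow> real"
  assumes "finite A" "\<And>k i. i \<in> A \<Longrightarrow> \<bar>u k i\<bar> \<le> M"
  shows "\<exists>l s. strict_mono (s :: nat \<Rightarrow> nat) \<and> (\<forall>i\<in>A. (\<lambda>k. u (s k) i) \<longlonglongrightarrow> l i)"
  using assms
proof (induction A rule: finite_induct)
  case empty
  have "strict_mono (\<lambda>k::nat. k)" by (simp add: strict_mono_def)
  then show ?case by blast
next
  case (insert a A)
  then obtain l s where s: "strict_mono s" "\<forall>i\<in>A. (\<lambda>k. u (s k) i) \<longlonglongrightarrow> l i"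
    by force
  have "bounded (range (\<lambda>k. u (s k) a))"
    using insert.prems[of a] by (auto simp: bounded_iff)
  then obtain la r where r: "strict_mono r" "((\<lambda>k. u (s k) a) \<circ> r) \<longlonglongrightarrow> la"
    using bounded_imp_convergent_subsequence by blast
  have "(\<lambda>k. u ((s \<circ> r) k) i) \<longlonglongrightarrow> (l(a := la)) i" if "i \<in> insert a A" for i
  proof (cases "i = a")
    case True
    with r show ?thesis by (simp add: o_def)
  next
    case False
    with that have "(\<lambda>k. u (s k) i) \<longlonglongrightarrow> l i" using s by simp
    from LIMSEQ_subseq_LIMSEQ[OF this r(1)] False show ?thesis
      by (simp add: o_def)
  qed
  with strict_mono_o[OF s(1) r(1)] show ?case
    by (intro exI[of _ "l(a := la)"] exI[of _ "s \<circ> r"]) blast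
qed

lemma compact_unique_subseq_limit_tendsto:
  fixes X :: "nat \<Rightarrow> 'a::metric_space"
  assumes "compact K" "\<forall>\<^sub>F k in sequentially. X k \<in> K"
    and uniq: "\<And>s l'. strict_mono s \<Longrightarrow> (X \<circ> s) \<longlonglongrightarrow> l' \<Longrightarrow> l' = l"
  shows "X \<longlonglongrightarrow> l"
proof (rule ccontr)
  assume "\<not> X \<longlonglongrightarrow> l"
  then obtain e where e: "e > 0" "\<not> (\<forall>\<^sub>F k in sequentially. dist (X k) l < e)"
    unfolding tendsto_iff by blast
  with assms(2) have "\<not> (\<forall>\<^sub>F k in sequentially. X k \<in> K \<longrightarrow> dist (X k) l < e)"
    using eventually_mp[OF _ assms(2), of "\<lambda>k. dist (X k) l < e"] by blast
  then obtain r :: "nat \<Rightarrow> nat" where r: "strict_mono r" "\<And>k. X (r k) \<in> K" "\<And>k. \<not> dist (X (r k)) l < e"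
    using not_eventually_sequentiallyD by blast
  have "seq_compact K" "\<forall>n. (X \<circ> r) n \<in> K"
    using assms(1) r(2) by (simp_all add: compact_eq_seq_compact_metric)
  then obtain l' q where q: "strict_mono q" "((X \<circ> r) \<circ> q) \<longlonglongrightarrow> l'"
    by (rule seq_compactE)
  then have "l' = l"
    using uniq[of "r \<circ> q" l'] strict_mono_o[OF r(1) q(1)] by (simp add: o_assoc)
  with q(2) e(1) have "\<forall>\<^sub>F k in sequentially. dist ((X \<circ> r \<circ> q) k) l < e"
    unfolding tendsto_iff by blast
  with r(3) show False
    by (simp add: eventually_sequentially)
qed

text \<open>Positive linear independence is an open condition with a quantitative form: on the compact set of
  coefficients with absolute sum \<open>1\<close> the combination stays away from \<open>0\<close>, also for vectors close to the
  given ones. Otherwise normalized coefficients of ever smaller combinations would converge to the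
  coefficients of a forbidden relation.\<close>

lemma pos_lin_independent_estimate:
  fixes a :: "'i \<Rightarrow> 'z::metric_space \<Rightarrow> 'v::real_normed_vector" and b :: "'j \<Rightarrow> 'z \<Rightarrow> 'v"
  assumes fin: "finite A" "finite B"
    and cont: "\<And>i. i \<in> A \<Longrightarrow> isCont (a i) w" "\<And>j. j \<in> B \<Longrightarrow> isCont (b j) w"
    and indep: "\<not> pos_lin_dependent A (\<lambda>i. a i w) B (\<lambda>j. b j w)"
  obtains c e where "c > 0" "e > 0"
    "\<And>z lam \<mu>. dist z w < e \<Longrightarrow> (\<And>i. i \<in> A \<Longrightarrow> lam i \<ge> 0) \<Longrightarrow>
       c * ((\<Sum>i\<in>A. lam i) + (\<Sum>j\<in>B. \<bar>\<mu> j\<bar>)) \<le> norm ((\<Sum>i\<in>A. lam i *\<^sub>R a i z) + (\<Sum>j\<in>B. \<mu> j *\<^sub>R b j z))"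
proof -
  have "\<exists>k::nat. \<forall>z lam \<mu>. dist z w < inverse (Suc k) \<longrightarrow> (\<forall>i\<in>A. lam i \<ge> 0) \<longrightarrow>
       inverse (Suc k) * ((\<Sum>i\<in>A. lam i) + (\<Sum>j\<in>B. \<bar>\<mu> j\<bar>))
         \<le> norm ((\<Sum>i\<in>A. lam i *\<^sub>R a i z) + (\<Sum>j\<in>B. \<mu> j *\<^sub>R b j z))"
  proof (rule ccontr)
    assume neg: "\<not> ?thesis"
    define bad where "bad k z lam \<mu> \<longleftrightarrow> dist z w < inverse (real (Suc k)) \<and> (\<forall>i\<in>A. lam i \<ge> 0) \<and>
       norm ((\<Sum>i\<in>A. lam i *\<^sub>R a i z) + (\<Sum>j\<in>B. \<mu> j *\<^sub>R b j z))
         < inverse (real (Suc k)) * ((\<Sum>i\<in>A. lam i) + (\<Sum>j\<in>B. \<bar>\<mu> j\<bar>))" for k z lam \<mu>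
    have "\<forall>k. \<exists>z lam \<mu>. bad k z lam \<mu>"
      using neg unfolding bad_def by (simp only: not_all not_ex not_imp not_le) blast
    then obtain z lam \<mu> where "\<And>k. bad k (z k) (lam k) (\<mu> k)"
      by metis
    then have z: "\<And>k. dist (z k) w < inverse (Suc k)"
      and lam: "\<And>k i. i \<in> A \<Longrightarrow> lam k i \<ge> 0"
      and small: "\<And>k. norm ((\<Sum>i\<in>A. lam k i *\<^sub>R a i (z k)) + (\<Sum>j\<in>B. \<mu> k j *\<^sub>R b j (z k)))
         < inverse (Suc k) * ((\<Sum>i\<in>A. lam k i) + (\<Sum>j\<in>B. \<bar>\<mu> k j\<bar>))"
      unfolding bad_def by blast+
    define S where "S k = (\<Sum>i\<in>A. lam k i) + (\<Sum>j\<in>B. \<bar>\<mu> k j\<bar>)" for k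
    have S: "S k > 0" for k
    proof -
      have "0 < inverse (real (Suc k)) * S k"
        unfolding S_def by (rule le_less_trans[OF norm_ge_zero small])
      then show ?thesis by (simp add: zero_less_mult_iff)
    qed
    define v where "v k = case_sum (\<lambda>i. lam k i / S k) (\<lambda>j. \<mu> k j / S k)" for k
    have finAB: "finite (A <+> B)" using fin by simp
    have vsum: "(\<Sum>i\<in>A. \<bar>v k (Inl i)\<bar>) + (\<Sum>j\<in>B. \<bar>v k (Inr j)\<bar>) = 1" for k
    proof -
      have "(\<Sum>i\<in>A. \<bar>v k (Inl i)\<bar>) = (\<Sum>i\<in>A. lam k i) / S k"
        using S[of k] lam by (simp add: v_def sum_divide_distrib)
      moreover have "(\<Sum>j\<in>B. \<bar>v k (Inr j)\<bar>) = (\<Sum>j\<in>B. \<bar>\<mu> k j\<bar>) / S k"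
        using S[of k] by (simp add: v_def sum_divide_distrib)
      ultimately show ?thesis
        using S[of k] by (simp add: add_divide_distrib[symmetric] S_def)
    qed
    have vsum': "(\<Sum>q\<in>A <+> B. \<bar>v k q\<bar>) = 1" for k
      using vsum[of k] fin by (simp add: sum.Plus)
    have "\<bar>v k q\<bar> \<le> 1" if "q \<in> A <+> B" for k q
      using member_le_sum[of q "A <+> B" "\<lambda>q. \<bar>v k q\<bar>"] that finAB vsum'[of k] by simp
    then obtain l s where s: "strict_mono (s :: nat \<Rightarrow> nat)"
      and l: "\<forall>q\<in>A <+> B. (\<lambda>k. v (s k) q) \<longlonglongrightarrow> l q"
      using finite_family_convergent_subseq[OF finAB, of v 1] by blast
    have lA: "(\<lambda>k. v (s k) (Inl i)) \<longlonglongrightarrow> l (Inl i)" if "i \<in> A" for i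
      using l that by auto
    have lB: "(\<lambda>k. v (s k) (Inr j)) \<longlonglongrightarrow> l (Inr j)" if "j \<in> B" for j
      using l that by auto
    have inv0: "(\<lambda>k. inverse (real (Suc (s k)))) \<longlonglongrightarrow> 0"
      using LIMSEQ_subseq_LIMSEQ[OF LIMSEQ_inverse_real_of_nat s] by (simp add: o_def)
    have "(\<lambda>k. dist (z (s k)) w) \<longlonglongrightarrow> 0"
      by (rule tendsto_sandwich[OF _ _ tendsto_const inv0])
         (auto intro!: always_eventually less_imp_le z simp del: of_nat_Suc)
    then have zl: "(\<lambda>k. z (s k)) \<longlonglongrightarrow> w"
      using tendsto_dist_iff by blast
    have comb: "(\<lambda>k. (\<Sum>i\<in>A. v (s k) (Inl i) *\<^sub>R a i (z (s k))) + (\<Sum>j\<in>B. v (s k) (Inr j) *\<^sub>R b j (z (s k))))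
        \<longlonglongrightarrow> (\<Sum>i\<in>A. l (Inl i) *\<^sub>R a i w) + (\<Sum>j\<in>B. l (Inr j) *\<^sub>R b j w)"
      by (intro tendsto_intros lA lB isCont_tendsto_compose[OF cont(1) zl]
            isCont_tendsto_compose[OF cont(2) zl])
    have "norm ((\<Sum>i\<in>A. v k (Inl i) *\<^sub>R a i (z k)) + (\<Sum>j\<in>B. v k (Inr j) *\<^sub>R b j (z k)))
        \<le> inverse (Suc k)" for k
    proof -
      have "(\<Sum>i\<in>A. v k (Inl i) *\<^sub>R a i (z k)) + (\<Sum>j\<in>B. v k (Inr j) *\<^sub>R b j (z k))
        = inverse (S k) *\<^sub>R ((\<Sum>i\<in>A. lam k i *\<^sub>R a i (z k)) + (\<Sum>j\<in>B. \<mu> k j *\<^sub>R b j (z k)))"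
        by (simp add: v_def scaleR_add_right scaleR_sum_right divide_inverse mult.commute)
      also have "norm \<dots> \<le> inverse (S k) * (inverse (Suc k) * S k)"
        using small[of k] S[of k] by (simp add: S_def[symmetric] del: of_nat_Suc)
      finally show ?thesis using S[of k] by (simp add: field_simps del: of_nat_Suc)
    qed
    then have "(\<lambda>k. (\<Sum>i\<in>A. v (s k) (Inl i) *\<^sub>R a i (z (s k))) + (\<Sum>j\<in>B. v (s k) (Inr j) *\<^sub>R b j (z (s k))))
        \<longlonglongrightarrow> 0"
      by (intro Lim_null_comparison[OF _ inv0] always_eventually allI)
    from LIMSEQ_unique[OF comb this]
    have eq: "(\<Sum>i\<in>A. l (Inl i) *\<^sub>R a i w) + (\<Sum>j\<in>B. l (Inr j) *\<^sub>R b j w) = 0" .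
    have nonneg: "l (Inl i) \<ge> 0" if "i \<in> A" for i
      using lA[OF that]
      by (rule LIMSEQ_le_const) (use lam[OF that] S in \<open>auto simp: v_def less_imp_le\<close>)
    have "(\<lambda>k. (\<Sum>i\<in>A. \<bar>v (s k) (Inl i)\<bar>) + (\<Sum>j\<in>B. \<bar>v (s k) (Inr j)\<bar>))
        \<longlonglongrightarrow> (\<Sum>i\<in>A. \<bar>l (Inl i)\<bar>) + (\<Sum>j\<in>B. \<bar>l (Inr j)\<bar>)"
      by (intro tendsto_intros lA lB)
    then have one: "(\<Sum>i\<in>A. \<bar>l (Inl i)\<bar>) + (\<Sum>j\<in>B. \<bar>l (Inr j)\<bar>) = 1"
      unfolding vsum by (simp add: LIMSEQ_const_iff)
    have "(\<exists>i\<in>A. l (Inl i) \<noteq> 0) \<or> (\<exists>j\<in>B. l (Inr j) \<noteq> 0)"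
    proof (rule ccontr)
      assume "\<not> ?thesis"
      with one show False by simp
    qed
    with eq nonneg have "pos_lin_dependent A (\<lambda>i. a i w) B (\<lambda>j. b j w)"
      unfolding pos_lin_dependent_def by (intro exI[of _ "\<lambda>i. l (Inl i)"] exI[of _ "\<lambda>j. l (Inr j)"]) auto
    with indep show False by contradiction
  qed
  then obtain k :: nat where k: "\<And>z lam \<mu>. dist z w < inverse (Suc k) \<Longrightarrow> (\<forall>i\<in>A. lam i \<ge> 0) \<Longrightarrow>
       inverse (Suc k) * ((\<Sum>i\<in>A. lam i) + (\<Sum>j\<in>B. \<bar>\<mu> j\<bar>))
         \<le> norm ((\<Sum>i\<in>A. lam i *\<^sub>R a i z) + (\<Sum>j\<in>B. \<mu> j *\<^sub>R b j z))"
    by blast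
  show thesis
    by (rule that[of "inverse (Suc k)" "inverse (Suc k)"]) (use k in auto)
qed

section \<open>A KKT theorem under the Mangasarian-Fromovitz condition\<close>

lemma grad_eqI: "GDERIV F z :> D \<Longrightarrow> grad F z = D"
proof -
  assume D: "GDERIV F z :> D"
  then have "F differentiable (at z)"
    unfolding gderiv_def differentiable_def by blast
  then have "GDERIV F z :> grad F z"
    by (rule GDERIV_grad)
  with D have "(\<lambda>h. h \<bullet> D) = (\<lambda>h. h \<bullet> grad F z)"
    unfolding gderiv_def by (rule has_derivative_unique)
  then show ?thesis
    by (metis vector_eq_ldot)
qed

lemma DERIV_max_zero_square:
  "((\<lambda>u::real. (max 0 u)\<^sup>2) has_real_derivative 2 * max 0 u) (at u)"
proof (cases u "0::real" rule: linorder_cases)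
  case less
  have "((\<lambda>u::real. 0) has_real_derivative 0) (at u)" by simp
  moreover have "\<forall>\<^sub>F v in nhds u. (0::real) = (max 0 v)\<^sup>2"
    using eventually_nhds_in_open[of "{..<0}" u] less by (auto elim!: eventually_mono)
  ultimately have "((\<lambda>u::real. (max 0 u)\<^sup>2) has_real_derivative 0) (at u)"
    by (subst DERIV_cong_ev[OF refl _ refl, symmetric])
  with less show ?thesis by simp
next
  case equal
  have "isCont (\<lambda>v::real. max 0 v) u"
    by (intro continuous_intros)
  moreover have "(max 0 v)\<^sup>2 - (max 0 u)\<^sup>2 = max 0 v * (v - u)" for v :: real
    using equal by (auto simp: max_def power2_eq_square)
  ultimately show ?thesis
    unfolding CARAT_DERIV using equal by (intro exI[of _ "\<lambda>v. max 0 v"]) auto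
next
  case greater
  have "((\<lambda>u::real. u\<^sup>2) has_real_derivative 2 * u) (at u)"
    by (auto intro!: derivative_eq_intros)
  moreover have "\<forall>\<^sub>F v in nhds u. v\<^sup>2 = (max 0 v)\<^sup>2"
    using eventually_nhds_in_open[of "{0<..}" u] greater by (auto elim!: eventually_mono)
  ultimately have "((\<lambda>u::real. (max 0 u)\<^sup>2) has_real_derivative 2 * u) (at u)"
    by (subst DERIV_cong_ev[OF refl _ refl, symmetric])
  with greater show ?thesis by simp
qed

text \<open>Quadratic penalty proof of the KKT theorem. The terms \<open>max 0 (G\<^sub>i z)\<^sup>2\<close> and \<open>(H\<^sub>j z)\<^sup>2\<close> are
  differentiable, so minimizers of the penalized function over a small ball satisfy an exact
  stationarity condition, in which the scaled constraint violations act as multipliers. The term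
  \<open>(z - z0) \<bullet> (z - z0)\<close> makes these minimizers converge to \<open>z0\<close>, and positive linear independence of
  the active gradients keeps the multipliers bounded.\<close>

lemma KKT_of_local_min:
  fixes F :: "'a::euclidean_space \<Rightarrow> real"
  assumes fin: "finite I" "finite J"
    and dF: "\<And>z. GDERIV F z :> DF z" and cF: "continuous_on UNIV DF"
    and dG: "\<And>i z. i \<in> I \<Longrightarrow> GDERIV (G i) z :> DG i z" and cG: "\<And>i. i \<in> I \<Longrightarrow> continuous_on UNIV (DG i)"
    and dH: "\<And>j z. j \<in> J \<Longrightarrow> GDERIV (H j) z :> DH j z" and cH: "\<And>j. j \<in> J \<Longrightarrow> continuous_on UNIV (DH j)"
    and feas: "z0 \<in> nlp_feas I G J H" and "\<rho> > 0"
    and min: "\<And>z. z \<in> nlp_feas I G J H \<Longrightarrow> dist z z0 < \<rho> \<Longrightarrow> F z0 \<le> F z"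
    and indep: "\<not> pos_lin_dependent {i\<in>I. G i z0 = 0} (\<lambda>i. DG i z0) J (\<lambda>j. DH j z0)"
  shows "\<exists>lam \<mu>. DF z0 + (\<Sum>i\<in>I. lam i *\<^sub>R DG i z0) + (\<Sum>j\<in>J. \<mu> j *\<^sub>R DH j z0) = 0 \<and>
      (\<forall>i\<in>I. lam i \<ge> 0 \<and> lam i * G i z0 = 0)"
proof -
  define A where "A = {i\<in>I. G i z0 = 0}"
  have finA: "finite A" and AI: "A \<subseteq> I" using fin by (auto simp: A_def)
  have contF: "isCont F z" for z
    using dF[of z] unfolding gderiv_def by (rule has_derivative_continuous)
  have contG: "isCont (G i) z" if "i \<in> I" for i z
    using dG[OF that, of z] unfolding gderiv_def by (rule has_derivative_continuous)
  have contH: "isCont (H j) z" if "j \<in> J" for j z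
    using dH[OF that, of z] unfolding gderiv_def by (rule has_derivative_continuous)
  have contDF: "isCont DF z0" and contDG: "\<And>i. i \<in> I \<Longrightarrow> isCont (DG i) z0"
    and contDH: "\<And>j. j \<in> J \<Longrightarrow> isCont (DH j) z0"
    using cF cG cH by (simp_all add: continuous_on_eq_continuous_at)
  define R where "R = \<rho> / 2"
  have R: "R > 0" "R < \<rho>" using \<open>\<rho> > 0\<close> by (auto simp: R_def)
  define pen where "pen z = (\<Sum>i\<in>I. (max 0 (G i z))\<^sup>2) + (\<Sum>j\<in>J. (H j z)\<^sup>2)" for z
  define \<Phi> where "\<Phi> k z = F z + (z - z0) \<bullet> (z - z0) + real (Suc k) * pen z" for k z
  have pen0: "pen z0 = 0"
    using feas unfolding pen_def nlp_feas_def by (auto intro!: sum.neutral)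
  have pen_nonneg: "pen z \<ge> 0" for z
    unfolding pen_def by (intro add_nonneg_nonneg sum_nonneg) auto
  have cont_pen: "isCont pen z" for z
    unfolding pen_def by (intro continuous_intros contG contH)
  have contK: "continuous_on (cball z0 R) (\<Phi> k)" for k
    unfolding \<Phi>_def by (intro continuous_at_imp_continuous_on ballI continuous_intros contF cont_pen)
  have "\<exists>z\<in>cball z0 R. \<forall>w\<in>cball z0 R. \<Phi> k z \<le> \<Phi> k w" for k
    using R by (intro continuous_attains_inf[OF compact_cball _ contK]) auto
  then obtain Z where Z: "\<And>k. Z k \<in> cball z0 R" "\<And>k w. w \<in> cball z0 R \<Longrightarrow> \<Phi> k (Z k) \<le> \<Phi> k w"
    by metis
  have Zle: "F (Z k) + (Z k - z0) \<bullet> (Z k - z0) + real (Suc k) * pen (Z k) \<le> F z0" for k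
    using Z(2)[of z0 k] R pen0 by (simp add: \<Phi>_def)
  obtain zm where zm: "\<And>w. w \<in> cball z0 R \<Longrightarrow> F zm \<le> F w"
    using continuous_attains_inf[OF compact_cball, of z0 R F] R
      continuous_at_imp_continuous_on[of "cball z0 R" F] contF by fastforce
  have Zlim: "Z \<longlonglongrightarrow> z0"
  proof (rule compact_unique_subseq_limit_tendsto[OF compact_cball[of z0 R]])
    show "\<forall>\<^sub>F k in sequentially. Z k \<in> cball z0 R" using Z by simp
  next
    fix s l assume s: "strict_mono s" and l: "(Z \<circ> s) \<longlonglongrightarrow> l"
    have pl: "(\<lambda>k. pen (Z (s k))) \<longlonglongrightarrow> pen l"
      using isCont_tendsto_compose[OF cont_pen l] by (simp add: o_def)
    have "pen (Z (s k)) \<le> (F z0 - F zm) * inverse (real (Suc (s k)))" for k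
    proof -
      have "real (Suc (s k)) * pen (Z (s k)) \<le> F z0 - F zm"
        using Zle[of "s k"] zm[OF Z(1)[of "s k"]] inner_ge_zero[of "Z (s k) - z0"] by linarith
      then show ?thesis
        by (simp add: field_simps del: of_nat_Suc)
    qed
    moreover have "(\<lambda>k. (F z0 - F zm) * inverse (real (Suc (s k)))) \<longlonglongrightarrow> (F z0 - F zm) * 0"
      using LIMSEQ_subseq_LIMSEQ[OF LIMSEQ_inverse_real_of_nat s]
      by (intro tendsto_intros) (simp add: o_def)
    ultimately have "pen l \<le> 0"
      using LIMSEQ_le[OF pl, of _ 0] by fastforce
    then have "(\<Sum>i\<in>I. (max 0 (G i l))\<^sup>2) = 0 \<and> (\<Sum>j\<in>J. (H j l)\<^sup>2) = 0"
      using sum_nonneg[of I "\<lambda>i. (max 0 (G i l))\<^sup>2"] sum_nonneg[of J "\<lambda>j. (H j l)\<^sup>2"]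
      unfolding pen_def by (smt (verit) zero_le_power2)
    then have "(\<forall>i\<in>I. (max 0 (G i l))\<^sup>2 = 0) \<and> (\<forall>j\<in>J. (H j l)\<^sup>2 = 0)"
      using fin by (simp add: sum_nonneg_eq_0_iff)
    then have lf: "l \<in> nlp_feas I G J H"
      by (force simp: nlp_feas_def max_def split: if_splits)
    have "l \<in> cball z0 R"
      by (rule closed_sequentially[OF closed_cball _ l]) (simp add: Z del: mem_cball)
    then have "dist l z0 \<le> R" by (simp add: dist_commute)
    then have "F z0 \<le> F l" using min[OF lf] R by simp
    moreover have "F l + (l - z0) \<bullet> (l - z0) \<le> F z0"
    proof (rule LIMSEQ_le_const2)
      show "(\<lambda>k. F (Z (s k)) + (Z (s k) - z0) \<bullet> (Z (s k) - z0)) \<longlonglongrightarrow> F l + (l - z0) \<bullet> (l - z0)"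
        using l by (intro tendsto_intros isCont_tendsto_compose[OF contF]) (auto simp: o_def)
    next
      have "F (Z (s k)) + (Z (s k) - z0) \<bullet> (Z (s k) - z0) \<le> F z0" for k
        using Zle[of "s k"] mult_nonneg_nonneg[OF of_nat_0_le_iff pen_nonneg, of "Suc (s k)" "Z (s k)"] by linarith
      then show "\<exists>N. \<forall>n\<ge>N. F (Z (s n)) + (Z (s n) - z0) \<bullet> (Z (s n) - z0) \<le> F z0" by blast
    qed
    ultimately have "(l - z0) \<bullet> (l - z0) \<le> 0" by linarith
    then have "(l - z0) \<bullet> (l - z0) = 0" using inner_ge_zero[of "l - z0"] by linarith
    then show "l = z0" by simp
  qed
  define lam where "lam k i = 2 * real (Suc k) * max 0 (G i (Z k))" for k i
  define \<mu> where "\<mu> k j = 2 * real (Suc k) * H j (Z k)" for k j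
  have ev: "\<forall>\<^sub>F k in sequentially. dist (Z k) z0 < R"
    using Zlim R(1) unfolding tendsto_iff by blast
  have stat: "\<forall>\<^sub>F k in sequentially. DF (Z k) + 2 *\<^sub>R (Z k - z0) + (\<Sum>i\<in>I. lam k i *\<^sub>R DG i (Z k))
      + (\<Sum>j\<in>J. \<mu> k j *\<^sub>R DH j (Z k)) = 0"
    using ev
  proof eventually_elim
    case (elim k)
    define V where "V = DF (Z k) + 2 *\<^sub>R (Z k - z0) + (\<Sum>i\<in>I. lam k i *\<^sub>R DG i (Z k))
      + (\<Sum>j\<in>J. \<mu> k j *\<^sub>R DH j (Z k))"
    have dG2: "((\<lambda>z. (max 0 (G i z))\<^sup>2) has_derivative (\<lambda>h. (h \<bullet> DG i (Z k)) * (2 * max 0 (G i (Z k))))) (at (Z k))"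
      if "i \<in> I" for i
      using DERIV_compose_FDERIV[OF DERIV_max_zero_square dG[OF that, unfolded gderiv_def]] .
    have dH2: "((\<lambda>z. (H j z)\<^sup>2) has_derivative (\<lambda>h. 2 * H j (Z k) * (h \<bullet> DH j (Z k)))) (at (Z k))"
      if "j \<in> J" for j
      using dH[OF that, of "Z k"] unfolding gderiv_def
      by (auto intro!: derivative_eq_intros simp: algebra_simps)
    have square: "((\<lambda>z. (z - z0) \<bullet> (z - z0)) has_derivative (\<lambda>h. (Z k - z0) \<bullet> h + h \<bullet> (Z k - z0))) (at (Z k))"
      by (auto intro!: derivative_eq_intros)
    have "((\<lambda>z. \<Phi> k z) has_derivative
       (\<lambda>h. h \<bullet> DF (Z k) + ((Z k - z0) \<bullet> h + h \<bullet> (Z k - z0)) +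
         real (Suc k) * ((\<Sum>i\<in>I. (h \<bullet> DG i (Z k)) * (2 * max 0 (G i (Z k)))) +
          (\<Sum>j\<in>J. 2 * H j (Z k) * (h \<bullet> DH j (Z k)))))) (at (Z k))"
      unfolding \<Phi>_def pen_def
      by (intro has_derivative_add has_derivative_mult_right has_derivative_sum dG2 dH2
          dF[unfolded gderiv_def] square)
    moreover have "(\<lambda>h. h \<bullet> DF (Z k) + ((Z k - z0) \<bullet> h + h \<bullet> (Z k - z0)) +
         real (Suc k) * ((\<Sum>i\<in>I. (h \<bullet> DG i (Z k)) * (2 * max 0 (G i (Z k)))) +
          (\<Sum>j\<in>J. 2 * H j (Z k) * (h \<bullet> DH j (Z k))))) = (\<lambda>h. h \<bullet> V)"
      by (rule ext) (simp add: V_def lam_def \<mu>_def inner_add_right inner_sum_right inner_commute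
          sum_distrib_left distrib_left mult.assoc mult.commute mult.left_commute del: of_nat_Suc)
    ultimately have "(\<Phi> k has_derivative (\<lambda>h. h \<bullet> V)) (at (Z k))" by simp
    moreover have "\<forall>\<^sub>F w in at (Z k). \<Phi> k (Z k) \<le> \<Phi> k w"
    proof -
      have "\<forall>\<^sub>F w in at (Z k). w \<in> ball z0 R"
        using elim by (intro eventually_at_in_open') (auto simp: dist_commute)
      then show ?thesis
        by (rule eventually_mono) (auto intro: Z(2))
    qed
    ultimately have "(\<lambda>h. h \<bullet> V) = (\<lambda>h. 0)"
      by (rule has_derivative_local_min)
    then have "V \<bullet> V = 0" by (rule fun_cong)
    then show ?case by (simp add: V_def)
  qed
  \<comment> \<open>Constraints inactive at \<open>z0\<close> are satisfied strictly near \<open>z0\<close>, so their penalty multipliers vanish.\<close>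
  have inact: "\<forall>\<^sub>F k in sequentially. \<forall>i\<in>I - A. lam k i = 0"
  proof (rule eventually_ball_finite)
    show "finite (I - A)" using fin by simp
    show "\<forall>i\<in>I - A. \<forall>\<^sub>F k in sequentially. lam k i = 0"
    proof
      fix i assume "i \<in> I - A"
      then have i: "i \<in> I" "G i z0 < 0"
        using feas by (auto simp: A_def nlp_feas_def order_less_le)
      have "(\<lambda>k. G i (Z k)) \<longlonglongrightarrow> G i z0"
        by (rule isCont_tendsto_compose[OF contG[OF i(1)] Zlim])
      then have "\<forall>\<^sub>F k in sequentially. G i (Z k) < 0"
        using i(2) by (rule order_tendstoD)
      then show "\<forall>\<^sub>F k in sequentially. lam k i = 0"
        by eventually_elim (simp add: lam_def)
    qed
  qed
  obtain c e where ce: "c > 0" "e > 0"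
    and est: "\<And>z lam \<mu>. dist z z0 < e \<Longrightarrow> (\<And>i. i \<in> A \<Longrightarrow> lam i \<ge> 0) \<Longrightarrow>
       c * ((\<Sum>i\<in>A. lam i) + (\<Sum>j\<in>J. \<bar>\<mu> j\<bar>))
         \<le> norm ((\<Sum>i\<in>A. lam i *\<^sub>R DG i z) + (\<Sum>j\<in>J. \<mu> j *\<^sub>R DH j z))"
    using pos_lin_independent_estimate[OF finA fin(2), where a = DG and w = z0 and b = DH] indep contDG contDH AI
    unfolding A_def by blast
  define D where "D k = DF (Z k) + 2 *\<^sub>R (Z k - z0)" for k
  have Dlim: "D \<longlonglongrightarrow> DF z0"
  proof -
    have "(\<lambda>k. DF (Z k) + 2 *\<^sub>R (Z k - z0)) \<longlonglongrightarrow> DF z0 + 2 *\<^sub>R (z0 - z0)"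
      by (intro tendsto_intros Zlim isCont_tendsto_compose[OF contDF])
    then show ?thesis unfolding D_def by simp
  qed
  then obtain M where M: "\<And>k. norm (D k) \<le> M"
    using convergent_imp_Bseq[of D] unfolding convergent_def Bseq_def by blast
  have ev2: "\<forall>\<^sub>F k in sequentially. dist (Z k) z0 < e"
    using Zlim ce(2) unfolding tendsto_iff by blast
  have "\<forall>\<^sub>F k in sequentially. D k + (\<Sum>i\<in>A. lam k i *\<^sub>R DG i (Z k)) + (\<Sum>j\<in>J. \<mu> k j *\<^sub>R DH j (Z k)) = 0
      \<and> dist (Z k) z0 < e \<and> (\<forall>i\<in>I - A. lam k i = 0)"
    using stat inact ev2
  proof eventually_elim
    case (elim k)
    have "(\<Sum>i\<in>I. lam k i *\<^sub>R DG i (Z k)) = (\<Sum>i\<in>A. lam k i *\<^sub>R DG i (Z k))"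
      by (rule sum.mono_neutral_right) (use fin AI elim in auto)
    with elim show ?case by (simp add: D_def)
  qed
  then obtain K where K: "\<And>k. k \<ge> K \<Longrightarrow> D k + (\<Sum>i\<in>A. lam k i *\<^sub>R DG i (Z k)) + (\<Sum>j\<in>J. \<mu> k j *\<^sub>R DH j (Z k)) = 0"
    "\<And>k. k \<ge> K \<Longrightarrow> dist (Z k) z0 < e"
    unfolding eventually_sequentially by blast
  \<comment> \<open>The shift by \<open>K\<close> starts the sequence where stationarity and the multiplier bound are available.\<close>
  define v where "v k = case_sum (lam (k + K)) (\<mu> (k + K))" for k
  have bound: "(\<Sum>i\<in>A. lam (k + K) i) + (\<Sum>j\<in>J. \<bar>\<mu> (k + K) j\<bar>) \<le> M / c" for k
  proof -
    have "c * ((\<Sum>i\<in>A. lam (k + K) i) + (\<Sum>j\<in>J. \<bar>\<mu> (k + K) j\<bar>))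
      \<le> norm ((\<Sum>i\<in>A. lam (k + K) i *\<^sub>R DG i (Z (k + K))) + (\<Sum>j\<in>J. \<mu> (k + K) j *\<^sub>R DH j (Z (k + K))))"
      by (rule est) (auto simp: K lam_def)
    also have "(\<Sum>i\<in>A. lam (k + K) i *\<^sub>R DG i (Z (k + K))) + (\<Sum>j\<in>J. \<mu> (k + K) j *\<^sub>R DH j (Z (k + K))) = - D (k + K)"
      using K(1)[of "k + K"] by (simp add: add_eq_0_iff add.assoc)
    also have "norm \<dots> \<le> M" using M by simp
    finally show ?thesis using ce(1) by (simp add: field_simps)
  qed
  have finAJ: "finite (A <+> J)" using finA fin by simp
  have "(\<Sum>q\<in>A <+> J. \<bar>v k q\<bar>) \<le> M / c" for k
    using bound[of k] finA fin by (simp add: sum.Plus v_def lam_def)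
  then have "\<bar>v k q\<bar> \<le> M / c" if "q \<in> A <+> J" for k q
    using member_le_sum[of q "A <+> J" "\<lambda>q. \<bar>v k q\<bar>"] that finAJ by (meson abs_ge_zero order_trans DiffD1)
  then obtain l s where s: "strict_mono (s :: nat \<Rightarrow> nat)" and l: "\<forall>q\<in>A <+> J. (\<lambda>k. v (s k) q) \<longlonglongrightarrow> l q"
    using finite_family_convergent_subseq[OF finAJ, of v "M / c"] by blast
  have lA: "(\<lambda>k. lam (s k + K) i) \<longlonglongrightarrow> l (Inl i)" if "i \<in> A" for i
    using bspec[OF l InlI[OF that]] by (simp add: v_def)
  have lJ: "(\<lambda>k. \<mu> (s k + K) j) \<longlonglongrightarrow> l (Inr j)" if "j \<in> J" for j
    using bspec[OF l InrI[OF that]] by (simp add: v_def)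
  have sK: "strict_mono (\<lambda>k. s k + K)" using s by (simp add: strict_mono_def)
  have Zs: "(\<lambda>k. Z (s k + K)) \<longlonglongrightarrow> z0" and Ds: "(\<lambda>k. D (s k + K)) \<longlonglongrightarrow> DF z0"
    using LIMSEQ_subseq_LIMSEQ[OF Zlim sK] LIMSEQ_subseq_LIMSEQ[OF Dlim sK] by (simp_all add: o_def)
  have "(\<lambda>k. D (s k + K) + (\<Sum>i\<in>A. lam (s k + K) i *\<^sub>R DG i (Z (s k + K)))
        + (\<Sum>j\<in>J. \<mu> (s k + K) j *\<^sub>R DH j (Z (s k + K))))
      \<longlonglongrightarrow> DF z0 + (\<Sum>i\<in>A. l (Inl i) *\<^sub>R DG i z0) + (\<Sum>j\<in>J. l (Inr j) *\<^sub>R DH j z0)"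
    using AI by (intro tendsto_intros lA lJ Ds isCont_tendsto_compose[OF contDG Zs] isCont_tendsto_compose[OF contDH Zs]) auto
  then have eq: "DF z0 + (\<Sum>i\<in>A. l (Inl i) *\<^sub>R DG i z0) + (\<Sum>j\<in>J. l (Inr j) *\<^sub>R DH j z0) = 0"
    by (simp add: K LIMSEQ_const_iff)
  have nonneg: "l (Inl i) \<ge> 0" if "i \<in> A" for i
    using lA[OF that] by (rule LIMSEQ_le_const) (auto simp: lam_def)
  define lam0 where "lam0 i = (if i \<in> A then l (Inl i) else 0)" for i
  have "(\<Sum>i\<in>I. lam0 i *\<^sub>R DG i z0) = (\<Sum>i\<in>A. l (Inl i) *\<^sub>R DG i z0)"
    unfolding lam0_def by (rule sum.mono_neutral_cong_right) (use fin AI in auto)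
  with eq nonneg show ?thesis
    by (intro exI[of _ lam0] exI[of _ "\<lambda>j. l (Inr j)"]) (auto simp: lam0_def A_def)
qed

section \<open>The regularized program\<close>

abbreviation nlp_set ::
  "(nat \<Rightarrow> real^'n \<Rightarrow> real) \<Rightarrow> nat \<Rightarrow> (nat \<Rightarrow> real^'n \<Rightarrow> real) \<Rightarrow> nat \<Rightarrow> nat \<Rightarrow> real \<Rightarrow>
    ((real^'n) \<times> (real^'n)) set" where
  "nlp_set g m h p \<kappa> t \<equiv> nlp_feas (nlp_I m) (nlp_G g \<kappa> t) {..<p} (\<lambda>j w. h j (fst w))"

lemma nlp_set_iff:
  fixes x y :: "real^'n"
  shows "(x, y) \<in> nlp_set g m h p \<kappa> t \<longleftrightarrow>
    (\<forall>i<m. g i x \<le> 0) \<and> (\<forall>i<p. h i x = 0) \<and> (\<forall>i. 0 \<le> y $ i \<and> y $ i \<le> 1) \<and>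
    (\<Sum>i\<in>UNIV. y $ i) \<ge> real CARD('n) - real \<kappa> \<and> (\<forall>i. \<bar>x $ i * y $ i\<bar> \<le> t)"
proof -
  have *: "\<bar>a\<bar> \<le> t \<longleftrightarrow> a \<le> t \<and> - a \<le> t" for a :: real
    by (rule abs_le_iff)
  have **: "- a \<le> t \<longleftrightarrow> - t - a \<le> 0" for a :: real by auto
  show ?thesis
    unfolding nlp_feas_def nlp_I_def * ** by (auto simp: ball_Un)
qed

fun nlp_G_grad ::
  "(nat \<Rightarrow> real^'n \<Rightarrow> real) \<Rightarrow> 'n nlp_idx \<Rightarrow> (real^'n) \<times> (real^'n) \<Rightarrow> (real^'n) \<times> (real^'n)" where
  "nlp_G_grad g (CG i) (x, y) = (grad (g i) x, 0)"
| "nlp_G_grad g CSum (x, y) = (0, - 1)"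
| "nlp_G_grad g (CLow i) (x, y) = (0, - axis i 1)"
| "nlp_G_grad g (CUp i) (x, y) = (0, axis i 1)"
| "nlp_G_grad g (CProdUp i) (x, y) = (y $ i *\<^sub>R axis i 1, x $ i *\<^sub>R axis i 1)"
| "nlp_G_grad g (CProdLow i) (x, y) = (- y $ i *\<^sub>R axis i 1, - x $ i *\<^sub>R axis i 1)"

lemma GDERIV_fst:
  fixes F :: "real^'n \<Rightarrow> real" and w :: "(real^'n) \<times> 'b::real_inner"
  assumes "cont_diff F"
  shows "GDERIV (\<lambda>w. F (fst w)) w :> (grad F (fst w), 0)"
proof -
  have "(F has_derivative (\<lambda>h. h \<bullet> grad F (fst w))) (at (fst w))"
    using assms GDERIV_grad[of F "fst w"] unfolding cont_diff_def gderiv_def by simp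
  then have "((\<lambda>w. F (fst w)) has_derivative (\<lambda>h. fst h \<bullet> grad F (fst w))) (at w)"
    by (rule has_derivative_compose[OF has_derivative_fst[OF has_derivative_ident]])
  then show ?thesis
    unfolding gderiv_def inner_prod_def by simp
qed

lemma GDERIV_nlp_G:
  fixes g :: "nat \<Rightarrow> real^'n \<Rightarrow> real"
  assumes "\<forall>i<m. cont_diff (g i)" "c \<in> nlp_I m"
  shows "GDERIV (nlp_G g \<kappa> t c) w :> nlp_G_grad g c w"
proof -
  have X: "((\<lambda>w. fst w $ i) has_derivative (\<lambda>h. fst h $ i)) (at w)"
    and Y: "((\<lambda>w. snd w $ i) has_derivative (\<lambda>h. snd h $ i)) (at w)"
    for i and w :: "(real^'n) \<times> (real^'n)"
    by (rule bounded_linear_imp_has_derivative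
        [OF bounded_linear_compose[OF bounded_linear_vec_nth bounded_linear_fst]],
      rule bounded_linear_imp_has_derivative
        [OF bounded_linear_compose[OF bounded_linear_vec_nth bounded_linear_snd]])
  obtain x y where w: "w = (x, y)" by (cases w)
  show ?thesis
  proof (cases c)
    case (CG i)
    have "nlp_G g \<kappa> t c = (\<lambda>w. g i (fst w))"
      using CG by (auto simp: fun_eq_iff)
    moreover have "cont_diff (g i)" using assms CG by (auto simp: nlp_I_def)
    ultimately show ?thesis
      using GDERIV_fst[of "g i" w] CG w by simp
  next
    case CSum
    have eq: "nlp_G g \<kappa> t c = (\<lambda>w. real CARD('n) - real \<kappa> - (\<Sum>i\<in>UNIV. snd w $ i))"
      using CSum by (auto simp: fun_eq_iff)
    show ?thesis
      unfolding gderiv_def eq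
      by (rule has_derivative_eq_rhs[OF has_derivative_diff[OF has_derivative_const has_derivative_sum[OF Y]]])
         (simp add: CSum w inner_prod_def inner_vec_def sum_negf)
  next
    case (CLow i)
    have eq: "nlp_G g \<kappa> t c = (\<lambda>w. - (snd w $ i))"
      using CLow by (auto simp: fun_eq_iff)
    show ?thesis
      unfolding gderiv_def eq
      by (rule has_derivative_eq_rhs[OF has_derivative_minus[OF Y]])
         (simp add: CLow w inner_prod_def inner_axis)
  next
    case (CUp i)
    have eq: "nlp_G g \<kappa> t c = (\<lambda>w. snd w $ i - 1)"
      using CUp by (auto simp: fun_eq_iff)
    show ?thesis
      unfolding gderiv_def eq
      by (rule has_derivative_eq_rhs[OF has_derivative_diff[OF Y has_derivative_const]])
         (simp add: CUp w inner_prod_def inner_axis)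
  next
    case (CProdUp i)
    have eq: "nlp_G g \<kappa> t c = (\<lambda>w. fst w $ i * snd w $ i - t)"
      using CProdUp by (auto simp: fun_eq_iff)
    show ?thesis
      unfolding gderiv_def eq
      by (rule has_derivative_eq_rhs[OF has_derivative_diff[OF has_derivative_mult[OF X Y] has_derivative_const]])
         (simp add: CProdUp w inner_prod_def inner_axis add.commute mult.commute)
  next
    case (CProdLow i)
    have eq: "nlp_G g \<kappa> t c = (\<lambda>w. - t - fst w $ i * snd w $ i)"
      using CProdLow by (auto simp: fun_eq_iff)
    show ?thesis
      unfolding gderiv_def eq
      by (rule has_derivative_eq_rhs[OF has_derivative_diff[OF has_derivative_const has_derivative_mult[OF X Y]]])
         (simp add: CProdLow w inner_prod_def inner_axis add.commute mult.commute)
  qed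
qed

lemma continuous_nlp_G_grad:
  fixes g :: "nat \<Rightarrow> real^'n \<Rightarrow> real"
  assumes "\<forall>i<m. cont_diff (g i)" "c \<in> nlp_I m"
  shows "continuous_on UNIV (nlp_G_grad g c)"
proof (cases c)
  case (CG i)
  then have "continuous_on UNIV (grad (g i))"
    using assms unfolding cont_diff_def by (auto simp: nlp_I_def)
  then have "continuous_on UNIV (\<lambda>w :: (real^'n) \<times> (real^'n). grad (g i) (fst w))"
    by (rule continuous_on_compose2) (auto intro: continuous_intros)
  moreover have "nlp_G_grad g c = (\<lambda>w. (grad (g i) (fst w), 0))"
    using CG by (auto simp: fun_eq_iff)
  ultimately show ?thesis
    by (auto intro!: continuous_intros)
next
  case CSum
  have "nlp_G_grad g c = (\<lambda>w. (0, - 1))"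
    using CSum by (auto simp: fun_eq_iff)
  then show ?thesis
    by (auto intro!: continuous_intros)
next
  case (CLow i)
  have "nlp_G_grad g c = (\<lambda>w. (0, - axis i 1))"
    using CLow by (auto simp: fun_eq_iff)
  then show ?thesis
    by (auto intro!: continuous_intros)
next
  case (CUp i)
  have "nlp_G_grad g c = (\<lambda>w. (0, axis i 1))"
    using CUp by (auto simp: fun_eq_iff)
  then show ?thesis
    by (auto intro!: continuous_intros)
next
  case (CProdUp i)
  have "nlp_G_grad g c = (\<lambda>w. (snd w $ i *\<^sub>R axis i 1, fst w $ i *\<^sub>R axis i 1))"
    using CProdUp by (auto simp: fun_eq_iff)
  then show ?thesis
    by (auto intro!: continuous_intros)
next
  case (CProdLow i)
  have "nlp_G_grad g c = (\<lambda>w. (- snd w $ i *\<^sub>R axis i 1, - fst w $ i *\<^sub>R axis i 1))"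
    using CProdLow by (auto simp: fun_eq_iff)
  then show ?thesis
    by (auto intro!: continuous_intros)
qed

lemma finite_nlp_I: "finite (nlp_I m :: 'n::finite nlp_idx set)"
  by (simp add: nlp_I_def)

lemma sum_nlp_I:
  fixes F :: "'n::finite nlp_idx \<Rightarrow> 'a::comm_monoid_add"
  shows "(\<Sum>c\<in>nlp_I m. F c) = (\<Sum>i<m. F (CG i)) + F CSum + (\<Sum>i\<in>UNIV. F (CLow i)) + (\<Sum>i\<in>UNIV. F (CUp i))
     + (\<Sum>i\<in>UNIV. F (CProdUp i)) + (\<Sum>i\<in>UNIV. F (CProdLow i))"
proof -
  have inj: "inj_on CG A" "inj_on CLow B" "inj_on CUp B" "inj_on CProdUp B" "inj_on CProdLow B" for A B
    by (auto simp: inj_on_def)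
  show ?thesis
    unfolding nlp_I_def
    by ((subst sum.union_disjoint, simp, simp, force)+)
      (simp add: sum.reindex[OF inj(1)] sum.reindex[OF inj(2)] sum.reindex[OF inj(3)]
         sum.reindex[OF inj(4)] sum.reindex[OF inj(5)])
qed

lemma sum_axis: "(\<Sum>i\<in>UNIV. c i *\<^sub>R axis i (1::real)) = (\<chi> i. c i)"
  by (simp add: vec_eq_iff axis_def if_distrib cong: if_cong)

lemma sum_nlp_G_grad:
  fixes x y :: "real^'n"
  shows "(\<Sum>c\<in>nlp_I m. \<Lambda> c *\<^sub>R nlp_G_grad g c (x, y)) =
    ((\<Sum>i<m. \<Lambda> (CG i) *\<^sub>R grad (g i) x) + (\<chi> i. (\<Lambda> (CProdUp i) - \<Lambda> (CProdLow i)) * y $ i),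
     (\<chi> i. - \<Lambda> CSum - \<Lambda> (CLow i) + \<Lambda> (CUp i) + (\<Lambda> (CProdUp i) - \<Lambda> (CProdLow i)) * x $ i))"
proof -
  have 1: "(\<Sum>i\<in>UNIV. (\<Lambda> (CProdUp i) * z $ i) *\<^sub>R axis i 1) + (\<Sum>i\<in>UNIV. - ((\<Lambda> (CProdLow i) * z $ i) *\<^sub>R axis i 1))
     = (\<chi> i. (\<Lambda> (CProdUp i) - \<Lambda> (CProdLow i)) * z $ i)" for z :: "real^'n"
    unfolding sum_negf sum_axis by (simp add: vec_eq_iff algebra_simps)
  have 2: "- (\<Lambda> CSum *\<^sub>R 1) + (\<Sum>i\<in>UNIV. - (\<Lambda> (CLow i) *\<^sub>R axis i 1)) + (\<Sum>i\<in>UNIV. \<Lambda> (CUp i) *\<^sub>R axis i 1)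
     = (\<chi> i. - \<Lambda> CSum - \<Lambda> (CLow i) + \<Lambda> (CUp i))"
    unfolding sum_negf sum_axis by (simp add: vec_eq_iff)
  have "fst (\<Sum>c\<in>nlp_I m. \<Lambda> c *\<^sub>R nlp_G_grad g c (x, y)) =
     (\<Sum>i<m. \<Lambda> (CG i) *\<^sub>R grad (g i) x) + (\<chi> i. (\<Lambda> (CProdUp i) - \<Lambda> (CProdLow i)) * y $ i)"
    unfolding sum_nlp_I 1[of y, symmetric] by (simp add: fst_sum)
  moreover have "snd (\<Sum>c\<in>nlp_I m. \<Lambda> c *\<^sub>R nlp_G_grad g c (x, y)) =
     (\<chi> i. - \<Lambda> CSum - \<Lambda> (CLow i) + \<Lambda> (CUp i)) + (\<chi> i. (\<Lambda> (CProdUp i) - \<Lambda> (CProdLow i)) * x $ i)"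
    unfolding sum_nlp_I 1[of x, symmetric] 2[symmetric] by (simp add: snd_sum)
  moreover have "\<dots> = (\<chi> i. - \<Lambda> CSum - \<Lambda> (CLow i) + \<Lambda> (CUp i) + (\<Lambda> (CProdUp i) - \<Lambda> (CProdLow i)) * x $ i)"
    by (simp add: vec_eq_iff)
  ultimately show ?thesis
    by (simp add: prod_eq_iff)
qed

text \<open>What the \<open>y\<close>-part of the KKT conditions of \<open>NLP(t)\<close> says about the pair \<open>(\<sigma>, \<gamma>)\<close>, where \<open>\<sigma>\<close> is the
  multiplier of \<open>e\<^sup>Ty \<ge> n - \<kappa>\<close> and \<open>\<gamma>\<^sub>i = (\<nu>\<^sub>i\<^sup>+ - \<nu>\<^sub>i\<^sup>-) y\<^sub>i\<close> is the contribution of the product constraints to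
  the \<open>x\<close>-part. The multipliers of the bounds on \<open>y\<close> have been eliminated; the remaining relations
  compare the sizes of different \<open>\<gamma>\<^sub>i\<close>.\<close>

definition y_stationary :: "nat \<Rightarrow> real \<Rightarrow> real^'n \<Rightarrow> real^'n \<Rightarrow> real \<Rightarrow> real^'n \<Rightarrow> bool" where
  "y_stationary \<kappa> t x y \<sigma> \<gamma> \<longleftrightarrow>
     0 \<le> \<sigma> \<and>
     (0 < \<sigma> \<longrightarrow> (\<Sum>i\<in>UNIV. y $ i) = real CARD('n) - real \<kappa> \<and> (\<forall>i. 0 < y $ i)) \<and>
     (\<forall>i. \<bar>\<gamma> $ i\<bar> * t \<le> \<sigma> * (y $ i)\<^sup>2) \<and>
     (\<forall>i. y $ i < 1 \<longrightarrow> \<bar>\<gamma> $ i\<bar> * t = \<sigma> * (y $ i)\<^sup>2) \<and>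
     (\<forall>i. \<gamma> $ i \<noteq> 0 \<longrightarrow> \<bar>x $ i\<bar> * y $ i = t)"

text \<open>The computation behind the elimination, for one index: \<open>a\<close>, \<open>b\<close> are the multipliers of \<open>0 \<le> y\<close> and
  \<open>y \<le> 1\<close>, and \<open>u\<close>, \<open>v\<close> those of \<open>x y \<le> t\<close> and \<open>- t \<le> x y\<close>. As \<open>t > 0\<close>, at most one of \<open>u\<close>, \<open>v\<close> is
  nonzero, and complementarity turns \<open>(u - v) x y\<close> into \<open>\<bar>u - v\<bar> t\<close>.\<close>

lemma y_stationary_component:
  fixes t y x \<sigma> a b u v :: real
  assumes "t > 0" "0 \<le> y" "y \<le> 1" "0 \<le> \<sigma>" "0 \<le> a" "0 \<le> b" "0 \<le> u" "0 \<le> v"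
    and a: "a * y = 0" and b: "b * (y - 1) = 0" and u: "u * (x * y - t) = 0" and v: "v * (- t - x * y) = 0"
    and eq: "- \<sigma> - a + b + (u - v) * x = 0"
  shows "\<bar>(u - v) * y\<bar> * t = (\<sigma> - b) * y\<^sup>2"
    and "(u - v) * y \<noteq> 0 \<Longrightarrow> \<bar>x\<bar> * y = t"
    and "0 < \<sigma> \<Longrightarrow> 0 < y"
proof -
  have uv: "u = 0 \<or> v = 0" using u v assms(1) by auto
  then have "\<bar>u - v\<bar> = u + v" using assms by auto
  moreover have "(u + v) * t = (u - v) * x * y"
  proof -
    have "u * (x * y) - u * t = 0" "- (v * t) - v * (x * y) = 0"
      using u v unfolding right_diff_distrib mult_minus_right .
    then show ?thesis
      unfolding distrib_right left_diff_distrib mult.assoc by linarith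
  qed
  ultimately have "\<bar>u - v\<bar> * t = (u - v) * x * y" by simp
  have "\<bar>(u - v) * y\<bar> * t = (\<bar>u - v\<bar> * t) * y"
    using assms(2) by (simp add: abs_mult)
  also have "\<dots> = ((u - v) * x) * y * y"
    unfolding \<open>\<bar>u - v\<bar> * t = (u - v) * x * y\<close> by simp
  also have "(u - v) * x = \<sigma> + a - b"
    using eq by simp
  also have "(\<sigma> + a - b) * y * y = (\<sigma> - b) * y\<^sup>2 + (a * y) * y"
    by (simp add: algebra_simps power2_eq_square)
  finally show "\<bar>(u - v) * y\<bar> * t = (\<sigma> - b) * y\<^sup>2" using a by simp
  show "\<bar>x\<bar> * y = t" if "(u - v) * y \<noteq> 0"
  proof -
    have "u \<noteq> 0 \<or> v \<noteq> 0" using that by auto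
    then have "x * y = t \<or> x * y = - t" using u v by auto
    then have "\<bar>x * y\<bar> = t" using assms(1) by auto
    then show ?thesis using assms(2) by (simp add: abs_mult)
  qed
  show "0 < y" if "0 < \<sigma>"
  proof (rule ccontr)
    assume "\<not> 0 < y"
    then have "y = 0" using assms(2) by simp
    then have "u = 0" "v = 0" "b = 0" using u v b assms(1) by auto
    then show False using eq that assms(5) by simp
  qed
qed

lemma y_stationaryI:
  fixes x y :: "real^'n"
  assumes "t > 0" "(x, y) \<in> nlp_set g m h p \<kappa> t"
    and compl: "\<forall>c\<in>nlp_I m. \<Lambda> c \<ge> 0 \<and> \<Lambda> c * nlp_G g \<kappa> t c (x, y) = 0"
    and eq: "\<And>i. - \<Lambda> CSum - \<Lambda> (CLow i) + \<Lambda> (CUp i) + (\<Lambda> (CProdUp i) - \<Lambda> (CProdLow i)) * x $ i = 0"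
  shows "y_stationary \<kappa> t x y (\<Lambda> CSum) (\<chi> i. (\<Lambda> (CProdUp i) - \<Lambda> (CProdLow i)) * y $ i)"
proof -
  have mem: "CSum \<in> nlp_I m" "CLow i \<in> nlp_I m" "CUp i \<in> nlp_I m" "CProdUp i \<in> nlp_I m" "CProdLow i \<in> nlp_I m"
    for i :: 'n by (auto simp: nlp_I_def)
  have y: "0 \<le> y $ i" "y $ i \<le> 1" for i using assms(2) by (auto simp: nlp_set_iff)
  have \<sigma>: "0 \<le> \<Lambda> CSum" "\<Lambda> CSum * ((real CARD('n) - real \<kappa>) - (\<Sum>i\<in>UNIV. y $ i)) = 0"
    using compl mem(1) by auto
  have nn: "0 \<le> \<Lambda> (CLow i)" "0 \<le> \<Lambda> (CUp i)" "0 \<le> \<Lambda> (CProdUp i)" "0 \<le> \<Lambda> (CProdLow i)"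
    "\<Lambda> (CLow i) * y $ i = 0" "\<Lambda> (CUp i) * (y $ i - 1) = 0"
    "\<Lambda> (CProdUp i) * (x $ i * y $ i - t) = 0" "\<Lambda> (CProdLow i) * (- t - x $ i * y $ i) = 0" for i
    using compl mem(2-5)[of i] by auto
  note C = y_stationary_component[OF assms(1) y \<sigma>(1) nn eq]
  have le: "\<bar>(\<Lambda> (CProdUp i) - \<Lambda> (CProdLow i)) * y $ i\<bar> * t \<le> \<Lambda> CSum * (y $ i)\<^sup>2" for i
    unfolding C(1) using nn(2)[of i] by (intro mult_right_mono) auto
  have equ: "\<bar>(\<Lambda> (CProdUp i) - \<Lambda> (CProdLow i)) * y $ i\<bar> * t = \<Lambda> CSum * (y $ i)\<^sup>2" if "y $ i < 1" for i
    unfolding C(1) using nn(6)[of i] that by simp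
  show ?thesis
    unfolding y_stationary_def using \<sigma> le equ C(2,3) by auto
qed

section \<open>Feasible points and the CC-MFCQ multiplier bound\<close>

lemma card_I_0: "card (I_0 (x::real^'n)) + norm0 x = CARD('n)"
proof -
  have "card ({i. x $ i = 0} \<union> {i. x $ i \<noteq> 0}) = card {i. x $ i = 0} + card {i. x $ i \<noteq> 0}"
    by (rule card_Un_disjoint) auto
  moreover have "{i. x $ i = 0} \<union> {i. x $ i \<noteq> 0} = UNIV" by auto
  ultimately show ?thesis by (simp add: I_0_def norm0_def)
qed

lemma sum_split_I_0:
  fixes x :: "real^'n" and F :: "'n \<Rightarrow> real"
  shows "(\<Sum>i\<in>UNIV. F i) = (\<Sum>i\<in>I_0 x. F i) + (\<Sum>i\<in>- I_0 x. F i)"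
  by (subst sum.union_disjoint[symmetric]) auto

lemma feas_R_imp_feas_P:
  fixes x y :: "real^'n"
  assumes "(x, y) \<in> feas_R g m h p \<kappa>"
  shows "x \<in> feas_P g m h p \<kappa>"
proof -
  have y: "0 \<le> y $ i" "y $ i \<le> 1" "x $ i * y $ i = 0" for i
    using assms by (auto simp: feas_R_def)
  have "(\<Sum>i\<in>UNIV. y $ i) = (\<Sum>i\<in>I_0 x. y $ i) + (\<Sum>i\<in>- I_0 x. y $ i)"
    by (rule sum_split_I_0)
  also have "(\<Sum>i\<in>- I_0 x. y $ i) = 0"
    using y(3) by (intro sum.neutral) (auto simp: I_0_def)
  also have "(\<Sum>i\<in>I_0 x. y $ i) \<le> card (I_0 x)"
    using sum_mono[of "I_0 x" "\<lambda>i. y $ i" "\<lambda>_. 1"] y by simp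
  finally have "real CARD('n) - real \<kappa> \<le> card (I_0 x)"
    using assms by (auto simp: feas_R_def)
  then have "norm0 x \<le> \<kappa>" using card_I_0[of x] by linarith
  then show ?thesis using assms by (auto simp: feas_R_def feas_P_def)
qed

text \<open>The largest \<open>y\<close> for \<open>x\<close> is the indicator of its zero set; taking the indicator for a point \<open>z\<close> with larger
  support instead gives the \<open>y\<close> that certifies a direction leading from \<open>x\<close> towards \<open>z\<close>.\<close>

lemma feas_R_indicator:
  fixes x z :: "real^'n"
  assumes "x \<in> feas_P g m h p \<kappa>" "norm0 z \<le> \<kappa>" "I_0 z \<subseteq> I_0 x"
  shows "(x, \<chi> i. if z $ i = 0 then 1 else 0) \<in> feas_R g m h p \<kappa>"
proof -
  have "(\<Sum>i\<in>UNIV. if z $ i = 0 then 1 else (0::real)) = card (I_0 z)"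
    by (simp add: sum.If_cases I_0_def)
  then show ?thesis
    using assms card_I_0[of z] by (auto simp: feas_R_def feas_P_def I_0_def)
qed

lemma feas_R_subset_nlp_set:
  assumes "t \<ge> 0" "(x, y) \<in> feas_R g m h p \<kappa>"
  shows "(x, y) \<in> nlp_set g m h p \<kappa> t"
proof -
  have "\<bar>x $ i * y $ i\<bar> \<le> t" for i
  proof -
    have "x $ i * y $ i = 0" using assms(2) by (auto simp: feas_R_def)
    then show ?thesis using assms(1) by linarith
  qed
  then show ?thesis using assms(2) unfolding nlp_set_iff feas_R_def by auto
qed

lemma cont_diff_isCont: "cont_diff F \<Longrightarrow> isCont F x"
  unfolding cont_diff_def by (simp add: differentiable_imp_continuous_within)

lemma cont_diff_isCont_grad: "cont_diff F \<Longrightarrow> isCont (grad F) x"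
  unfolding cont_diff_def by (simp add: continuous_on_eq_continuous_at)

lemma tendsto_feas_R:
  fixes X Y :: "nat \<Rightarrow> real^'n"
  assumes C: "\<forall>i<m. cont_diff (g i)" "\<forall>i<p. cont_diff (h i)"
    and mem: "\<And>k. (X k, Y k) \<in> nlp_set g m h p \<kappa> (t k)" and t: "t \<longlonglongrightarrow> 0"
    and X: "X \<longlonglongrightarrow> x" and Y: "Y \<longlonglongrightarrow> y"
  shows "(x, y) \<in> feas_R g m h p \<kappa>"
proof -
  have Xi: "(\<lambda>k. X k $ i) \<longlonglongrightarrow> x $ i" and Yi: "(\<lambda>k. Y k $ i) \<longlonglongrightarrow> y $ i" for i
    using X Y by (auto intro: tendsto_vec_nth)
  have "g i x \<le> 0" if "i < m" for i
    using isCont_tendsto_compose[OF cont_diff_isCont X, of "g i"] C(1) that mem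
    by (intro LIMSEQ_le_const2[of "\<lambda>k. g i (X k)"]) (auto simp: nlp_set_iff)
  moreover have "h i x = 0" if "i < p" for i
  proof -
    have "(\<lambda>k. h i (X k)) \<longlonglongrightarrow> h i x"
      using isCont_tendsto_compose[OF cont_diff_isCont X, of "h i"] C(2) that by auto
    moreover have "h i (X k) = 0" for k using mem that by (simp add: nlp_set_iff)
    ultimately show ?thesis by (simp add: LIMSEQ_const_iff)
  qed
  moreover have "0 \<le> y $ i" "y $ i \<le> 1" for i
    using mem LIMSEQ_le_const[OF Yi, of 0 i] LIMSEQ_le_const2[OF Yi, of i 1]
    by (auto simp: nlp_set_iff)
  moreover have "(\<Sum>i\<in>UNIV. y $ i) \<ge> real CARD('n) - real \<kappa>"
    using mem tendsto_sum[of UNIV "\<lambda>i k. Y k $ i", OF Yi]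
    by (intro LIMSEQ_le_const[of "\<lambda>k. \<Sum>i\<in>UNIV. Y k $ i"]) (auto simp: nlp_set_iff)
  moreover have "x $ i * y $ i = 0" for i
  proof -
    have "(\<lambda>k. X k $ i * Y k $ i) \<longlonglongrightarrow> 0"
      by (rule Lim_null_comparison[OF _ t]) (use mem in \<open>auto simp: nlp_set_iff\<close>)
    with tendsto_mult[OF Xi Yi, of i i] show ?thesis by (rule LIMSEQ_unique[rotated, symmetric])
  qed
  ultimately show ?thesis by (simp add: feas_R_def)
qed

abbreviation constraint_comb ::
  "(nat \<Rightarrow> real^'n \<Rightarrow> real) \<Rightarrow> nat \<Rightarrow> (nat \<Rightarrow> real^'n \<Rightarrow> real) \<Rightarrow> nat \<Rightarrow>
    real^'n \<Rightarrow> (nat \<Rightarrow> real) \<Rightarrow> (nat \<Rightarrow> real) \<Rightarrow> real^'n \<Rightarrow> real^'n" where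
  "constraint_comb g m h p x lam \<mu> \<gamma> \<equiv>
     (\<Sum>i<m. lam i *\<^sub>R grad (g i) x) + (\<Sum>i<p. \<mu> i *\<^sub>R grad (h i) x) + \<gamma>"

abbreviation lagr_grad ::
  "(real^'n \<Rightarrow> real) \<Rightarrow> (nat \<Rightarrow> real^'n \<Rightarrow> real) \<Rightarrow> nat \<Rightarrow> (nat \<Rightarrow> real^'n \<Rightarrow> real) \<Rightarrow> nat \<Rightarrow>
    real^'n \<Rightarrow> (nat \<Rightarrow> real) \<Rightarrow> (nat \<Rightarrow> real) \<Rightarrow> real^'n \<Rightarrow> real^'n" where
  "lagr_grad f g m h p x lam \<mu> \<gamma> \<equiv>
     grad f x + (\<Sum>i<m. lam i *\<^sub>R grad (g i) x) + (\<Sum>i<p. \<mu> i *\<^sub>R grad (h i) x) + \<gamma>"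

abbreviation mult_size :: "nat \<Rightarrow> nat \<Rightarrow> (nat \<Rightarrow> real) \<Rightarrow> (nat \<Rightarrow> real) \<Rightarrow> real^'n \<Rightarrow> real" where
  "mult_size m p lam \<mu> \<gamma> \<equiv> (\<Sum>i<m. lam i) + (\<Sum>i<p. \<bar>\<mu> i\<bar>) + (\<Sum>i\<in>UNIV. \<bar>\<gamma> $ i\<bar>)"

text \<open>CC-MFCQ in quantitative form near \<open>xs\<close>. It controls \<open>\<gamma>\<^sub>i\<close> only on the zero set of \<open>xs\<close>; the other
  components appear as an error on the right. Complementarity at \<open>x\<close> leaves only constraints active at
  \<open>xs\<close>, since the others are inactive nearby.\<close>

lemma CC_MFCQ_estimate:
  fixes xs :: "real^'n"
  assumes C: "\<forall>i<m. cont_diff (g i)" "\<forall>i<p. cont_diff (h i)" and mfcq: "CC_MFCQ g m h p xs"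
  obtains c e where "c > 0" "e > 0"
    "\<And>x lam \<mu> \<gamma>. dist x xs < e \<Longrightarrow> (\<forall>i<m. lam i \<ge> 0 \<and> lam i * g i x = 0) \<Longrightarrow>
      c * ((\<Sum>i<m. lam i) + (\<Sum>i<p. \<bar>\<mu> i\<bar>) + (\<Sum>i\<in>I_0 xs. \<bar>\<gamma> $ i\<bar>))
        \<le> norm (constraint_comb g m h p x lam \<mu> \<gamma>)
          + (\<Sum>i\<in>- I_0 xs. \<bar>\<gamma> $ i\<bar>)"
proof -
  define b where "b q x = case_sum (\<lambda>i. grad (h i) x) (\<lambda>i. axis i 1) q" for q :: "nat + 'n" and x :: "real^'n"
  have finA: "finite (I_g g m xs)" by (simp add: I_g_def)
  have finB: "finite ({..<p} <+> I_0 xs)" by simp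
  have contA: "isCont (grad (g i)) xs" if "i \<in> I_g g m xs" for i
    using C(1) that by (auto simp: I_g_def intro: cont_diff_isCont_grad)
  have contB: "isCont (b q) xs" if "q \<in> {..<p} <+> I_0 xs" for q
  proof (cases q)
    case (Inl i)
    then show ?thesis
      using that C(2) cont_diff_isCont_grad[of "h i" xs] unfolding b_def by auto
  next
    case (Inr i)
    then show ?thesis unfolding b_def by simp
  qed
  have ind: "\<not> pos_lin_dependent (I_g g m xs) (\<lambda>i. grad (g i) xs) ({..<p} <+> I_0 xs) (\<lambda>q. b q xs)"
    using mfcq unfolding CC_MFCQ_def b_def by simp
  obtain c e1 where c: "c > 0" "e1 > 0" and est: "\<And>x lam \<mu>. dist x xs < e1 \<Longrightarrow>
      (\<And>i. i \<in> I_g g m xs \<Longrightarrow> lam i \<ge> 0) \<Longrightarrow>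
       c * ((\<Sum>i\<in>I_g g m xs. lam i) + (\<Sum>q\<in>{..<p} <+> I_0 xs. \<bar>\<mu> q\<bar>))
        \<le> norm ((\<Sum>i\<in>I_g g m xs. lam i *\<^sub>R grad (g i) x) + (\<Sum>q\<in>{..<p} <+> I_0 xs. \<mu> q *\<^sub>R b q x))"
    using pos_lin_independent_estimate[OF finA finB contA contB ind] by blast
  have "\<forall>\<^sub>F x in nhds xs. \<forall>i\<in>{i. i < m \<and> g i xs \<noteq> 0}. g i x \<noteq> 0"
  proof (rule eventually_ball_finite)
    show "\<forall>i\<in>{i. i < m \<and> g i xs \<noteq> 0}. \<forall>\<^sub>F x in nhds xs. g i x \<noteq> 0"
    proof
      fix i assume i: "i \<in> {i. i < m \<and> g i xs \<noteq> 0}"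
      then have "(g i \<longlongrightarrow> g i xs) (nhds xs)"
        using C(1) cont_diff_isCont[of "g i" xs] unfolding isCont_def tendsto_at_iff_tendsto_nhds by auto
      then show "\<forall>\<^sub>F x in nhds xs. g i x \<noteq> 0"
        using i by (intro tendsto_imp_eventually_ne) auto
    qed
  qed simp
  then obtain e2 where e2: "e2 > 0" "\<And>x i. dist x xs < e2 \<Longrightarrow> i < m \<Longrightarrow> g i xs \<noteq> 0 \<Longrightarrow> g i x \<noteq> 0"
    unfolding eventually_nhds_metric by blast
  show thesis
  proof (rule that[of c "min e1 e2"])
    fix x \<gamma> :: "real^'n" and lam \<mu> :: "nat \<Rightarrow> real"
    assume x: "dist x xs < min e1 e2" and lam: "\<forall>i<m. lam i \<ge> 0 \<and> lam i * g i x = 0"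
    have lam0: "lam i = 0" if "i < m" "i \<notin> I_g g m xs" for i
      using lam that e2(2)[of x i] x by (auto simp: I_g_def)
    have sub: "I_g g m xs \<subseteq> {..<m}" by (auto simp: I_g_def)
    have s1: "(\<Sum>i<m. lam i) = (\<Sum>i\<in>I_g g m xs. lam i)"
      by (rule sum.mono_neutral_right) (use sub lam0 in auto)
    have s2: "(\<Sum>i<m. lam i *\<^sub>R grad (g i) x) = (\<Sum>i\<in>I_g g m xs. lam i *\<^sub>R grad (g i) x)"
      by (rule sum.mono_neutral_right) (use sub lam0 in auto)
    define \<nu> where "\<nu> = case_sum \<mu> (\<lambda>i. \<gamma> $ i)"
    define \<gamma>0 \<gamma>1 :: "real^'n" where "\<gamma>0 = (\<Sum>i\<in>I_0 xs. \<gamma> $ i *\<^sub>R axis i 1)"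
      and "\<gamma>1 = (\<Sum>i\<in>- I_0 xs. \<gamma> $ i *\<^sub>R axis i 1)"
    have "\<gamma> = (\<Sum>i\<in>UNIV. \<gamma> $ i *\<^sub>R axis i 1)"
      by (simp add: sum_axis vec_eq_iff)
    also have "\<dots> = \<gamma>0 + \<gamma>1"
      unfolding \<gamma>0_def \<gamma>1_def by (subst sum.union_disjoint[symmetric]) auto
    finally have \<gamma>: "\<gamma> = \<gamma>0 + \<gamma>1" .
    have \<gamma>1: "norm \<gamma>1 \<le> (\<Sum>i\<in>- I_0 xs. \<bar>\<gamma> $ i\<bar>)"
      unfolding \<gamma>1_def by (rule order_trans[OF norm_sum]) simp
    have "c * ((\<Sum>i\<in>I_g g m xs. lam i) + (\<Sum>q\<in>{..<p} <+> I_0 xs. \<bar>\<nu> q\<bar>))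
        \<le> norm ((\<Sum>i\<in>I_g g m xs. lam i *\<^sub>R grad (g i) x) + (\<Sum>q\<in>{..<p} <+> I_0 xs. \<nu> q *\<^sub>R b q x))"
      using x lam sub by (intro est) auto
    also have "(\<Sum>q\<in>{..<p} <+> I_0 xs. \<bar>\<nu> q\<bar>) = (\<Sum>i<p. \<bar>\<mu> i\<bar>) + (\<Sum>i\<in>I_0 xs. \<bar>\<gamma> $ i\<bar>)"
      by (simp add: sum.Plus \<nu>_def)
    also have "(\<Sum>q\<in>{..<p} <+> I_0 xs. \<nu> q *\<^sub>R b q x) = (\<Sum>i<p. \<mu> i *\<^sub>R grad (h i) x) + \<gamma>0"
      by (simp add: sum.Plus \<nu>_def b_def \<gamma>0_def)
    finally have "c * ((\<Sum>i<m. lam i) + (\<Sum>i<p. \<bar>\<mu> i\<bar>) + (\<Sum>i\<in>I_0 xs. \<bar>\<gamma> $ i\<bar>))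
       \<le> norm (constraint_comb g m h p x lam \<mu> \<gamma>0)"
      by (simp add: s1 s2 add.assoc)
    also have "constraint_comb g m h p x lam \<mu> \<gamma>0
       = (constraint_comb g m h p x lam \<mu> \<gamma>) - \<gamma>1"
      by (simp add: \<gamma>)
    also have "norm \<dots> \<le> norm (constraint_comb g m h p x lam \<mu> \<gamma>)
       + norm \<gamma>1" by (rule norm_triangle_ineq4)
    finally show "c * ((\<Sum>i<m. lam i) + (\<Sum>i<p. \<bar>\<mu> i\<bar>) + (\<Sum>i\<in>I_0 xs. \<bar>\<gamma> $ i\<bar>))
        \<le> norm (constraint_comb g m h p x lam \<mu> \<gamma>)
          + (\<Sum>i\<in>- I_0 xs. \<bar>\<gamma> $ i\<bar>)"
      using \<gamma>1 by linarith
  qed (use c e2 in auto)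
qed

text \<open>A counting argument: if all \<open>y\<^sub>i\<close> on the zero set were \<open>1\<close>, they would already contribute
  \<open>n - norm0 z \<ge> n - \<kappa>\<close>, and the positive remaining components would push the sum beyond \<open>n - \<kappa>\<close>;
  without remaining components the sum would be \<open>n > n - \<kappa>\<close>.\<close>

lemma fractional_index_exists:
  fixes y z :: "real^'n"
  assumes "norm0 z \<le> \<kappa>" "0 < \<kappa>" and sum: "(\<Sum>i\<in>UNIV. y $ i) = real CARD('n) - real \<kappa>"
    and pos: "\<And>i. 0 < y $ i"
  obtains i where "i \<in> I_0 z" "y $ i < 1"
proof (rule ccontr)
  assume "\<not> thesis"
  with that have ge: "y $ i \<ge> 1" if "i \<in> I_0 z" for i using that not_le by blast
  have "real (card (I_0 z)) \<le> (\<Sum>i\<in>I_0 z. y $ i)"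
    using sum_mono[of "I_0 z" "\<lambda>_. 1" "\<lambda>i. y $ i"] ge by simp
  moreover have "(\<Sum>i\<in>UNIV. y $ i) = (\<Sum>i\<in>I_0 z. y $ i) + (\<Sum>i\<in>- I_0 z. y $ i)"
    by (rule sum_split_I_0)
  ultimately have le: "real (card (I_0 z)) + (\<Sum>i\<in>- I_0 z. y $ i) \<le> real CARD('n) - real \<kappa>"
    using sum by linarith
  show False
  proof (cases "- I_0 z = {}")
    case True
    then have "I_0 z = UNIV" by auto
    with le assms(2) show False by simp
  next
    case False
    then have "0 < (\<Sum>i\<in>- I_0 z. y $ i)" using pos by (intro sum_pos) auto
    with le card_I_0[of z] assms(1) show False by linarith
  qed
qed

text \<open>For feasible points of \<open>NLP(t)\<close> near \<open>xs\<close>, the components \<open>\<gamma>\<^sub>i\<close> off the zero set of \<open>xs\<close> are dominated by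
  one component \<open>\<gamma>\<^sub>j\<close> on it. Indeed \<open>\<bar>\<gamma>\<^sub>i\<bar> t \<le> \<sigma> y\<^sub>i\<^sup>2 \<le> \<sigma> t\<^sup>2 / x\<^sub>i\<^sup>2\<close>, where \<open>\<bar>x\<^sub>i\<bar>\<close> is bounded below, while for
  an index \<open>j\<close> on the zero set with \<open>y\<^sub>j < 1\<close> equality holds and \<open>\<bar>x\<^sub>j\<bar>\<close> is small. The radius and the constant
  do not depend on \<open>t\<close>.\<close>

lemma regularized_multiplier_estimate:
  fixes xs :: "real^'n"
  assumes C: "\<forall>i<m. cont_diff (g i)" "\<forall>i<p. cont_diff (h i)" and mfcq: "CC_MFCQ g m h p xs"
    and xs: "norm0 xs \<le> \<kappa>"
  obtains c e where "c > 0" "e > 0"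
    "\<And>t x y lam \<mu> \<sigma> \<gamma>. t > 0 \<Longrightarrow> (x, y) \<in> nlp_set g m h p \<kappa> t \<Longrightarrow> dist x xs < e \<Longrightarrow>
      (\<forall>i<m. lam i \<ge> 0 \<and> lam i * g i x = 0) \<Longrightarrow> y_stationary \<kappa> t x y \<sigma> \<gamma> \<Longrightarrow>
      c * mult_size m p lam \<mu> \<gamma>
        \<le> norm (constraint_comb g m h p x lam \<mu> \<gamma>)"
proof -
  obtain c e1 where c: "c > 0" "e1 > 0" and est: "\<And>x lam \<mu> \<gamma>. dist x xs < e1 \<Longrightarrow>
      (\<forall>i<m. lam i \<ge> 0 \<and> lam i * g i x = 0) \<Longrightarrow>
      c * ((\<Sum>i<m. lam i) + (\<Sum>i<p. \<bar>\<mu> i\<bar>) + (\<Sum>i\<in>I_0 xs. \<bar>\<gamma> $ i\<bar>))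
        \<le> norm (constraint_comb g m h p x lam \<mu> \<gamma>)
          + (\<Sum>i\<in>- I_0 xs. \<bar>\<gamma> $ i\<bar>)"
    using CC_MFCQ_estimate[OF C mfcq] by blast
  define a where "a = Min (insert 1 ((\<lambda>i. \<bar>xs $ i\<bar>) ` (- I_0 xs)))"
  have a: "a > 0" unfolding a_def by (subst Min_gr_iff) (auto simp: I_0_def)
  have a_le: "a \<le> \<bar>xs $ i\<bar>" if "i \<notin> I_0 xs" for i
    unfolding a_def using that by (intro Min_le) auto
  \<comment> \<open>Each \<open>\<gamma>\<^sub>i\<close> off the zero set will be at most \<open>q \<bar>\<gamma>\<^sub>j\<bar>\<close>; there are at most \<open>n\<close> of them, and their sum has
      to be absorbed by half of the constant \<open>c\<close>.\<close>
  define q where "q = min 1 (c / 2) / (real CARD('n))"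
  have q: "q > 0" using c by (simp add: q_def)
  define e where "e = min e1 (min (a / 2) (sqrt q * (a / 2)))"
  have e: "e > 0" "e \<le> e1" "e \<le> a / 2" "e \<le> sqrt q * (a / 2)"
    using c a q by (auto simp: e_def)
  have dom: "(\<Sum>i\<in>- I_0 xs. \<bar>\<gamma> $ i\<bar>) \<le> min 1 (c / 2) * (\<Sum>i\<in>I_0 xs. \<bar>\<gamma> $ i\<bar>)"
    if t: "t > 0" and mem: "(x, y) \<in> nlp_set g m h p \<kappa> t" and x: "dist x xs < e"
      and ys: "y_stationary \<kappa> t x y \<sigma> \<gamma>" for t x y \<sigma> \<gamma>
  proof (cases "(\<Sum>i\<in>- I_0 xs. \<bar>\<gamma> $ i\<bar>) = 0")
    case True
    then show ?thesis using c by (simp add: sum_nonneg)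
  next
    case False
    then obtain k where k: "k \<in> - I_0 xs" "\<gamma> $ k \<noteq> 0"
      by (metis abs_zero sum.neutral)
    have y: "0 \<le> y $ i" "y $ i \<le> 1" for i using mem by (auto simp: nlp_set_iff)
    have le: "\<bar>\<gamma> $ i\<bar> * t \<le> \<sigma> * (y $ i)\<^sup>2" for i using ys by (auto simp: y_stationary_def)
    have "\<sigma> \<noteq> 0" using le[of k] k(2) t by (auto simp: mult_le_0_iff)
    then have \<sigma>: "\<sigma> > 0" "\<And>i. 0 < y $ i" "(\<Sum>i\<in>UNIV. y $ i) = real CARD('n) - real \<kappa>"
      using ys by (auto simp: y_stationary_def)
    have "norm0 xs \<noteq> 0" using k(1) by (auto simp: norm0_def I_0_def)
    then have "0 < \<kappa>" using xs by simp
    then obtain j where j: "j \<in> I_0 xs" "y $ j < 1"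
      using fractional_index_exists[OF xs _ \<sigma>(3) \<sigma>(2)] by blast
    have gj: "\<bar>\<gamma> $ j\<bar> * t = \<sigma> * (y $ j)\<^sup>2" using ys j by (auto simp: y_stationary_def)
    then have "\<gamma> $ j \<noteq> 0" using \<sigma>(1) \<sigma>(2)[of j] by auto
    then have xj: "\<bar>x $ j\<bar> * y $ j = t" using ys by (auto simp: y_stationary_def)
    have comp: "\<bar>x $ i - xs $ i\<bar> < e" for i
      using component_le_norm_cart[of "x - xs" i] x by (simp add: dist_norm)
    have "\<bar>x $ j\<bar> \<le> e" using comp[of j] j by (simp add: I_0_def)
    then have tj: "t \<le> e * y $ j" using xj \<sigma>(2)[of j] mult_right_mono[of "\<bar>x $ j\<bar>" e "y $ j"] by simp
    have single: "\<bar>\<gamma> $ i\<bar> \<le> q * \<bar>\<gamma> $ j\<bar>" if i: "i \<in> - I_0 xs" for i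
    proof -
      have "a \<le> \<bar>xs $ i\<bar>" using a_le[of i] i by simp
      then have "a / 2 \<le> \<bar>x $ i\<bar>" using comp[of i] e(3) by linarith
      then have "a / 2 * y $ i \<le> \<bar>x $ i\<bar> * y $ i" using y by (intro mult_right_mono)
      also have "\<dots> = \<bar>x $ i * y $ i\<bar>" using y by (simp add: abs_mult)
      also have "\<dots> \<le> t" using mem by (auto simp: nlp_set_iff)
      also have "\<dots> \<le> sqrt q * (a / 2) * y $ j"
        using tj e(4) y mult_right_mono[of e "sqrt q * (a / 2)" "y $ j"] by simp
      finally have "a / 2 * y $ i \<le> a / 2 * (sqrt q * y $ j)" by (simp add: mult_ac)
      then have "y $ i \<le> sqrt q * y $ j" using a by simp
      then have "(y $ i)\<^sup>2 \<le> (sqrt q * y $ j)\<^sup>2" using y by (intro power_mono)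
      then have "(y $ i)\<^sup>2 \<le> q * (y $ j)\<^sup>2" using q by (simp add: power_mult_distrib)
      then have "\<sigma> * (y $ i)\<^sup>2 \<le> \<sigma> * (q * (y $ j)\<^sup>2)" using \<sigma>(1) by simp
      then have "\<bar>\<gamma> $ i\<bar> * t \<le> q * (\<bar>\<gamma> $ j\<bar> * t)" using le[of i] gj by (simp add: mult_ac)
      then show ?thesis using t by (simp add: mult.assoc[symmetric])
    qed
    have "(\<Sum>i\<in>- I_0 xs. \<bar>\<gamma> $ i\<bar>) \<le> real (card (- I_0 xs)) * (q * \<bar>\<gamma> $ j\<bar>)"
      using sum_bounded_above[of "- I_0 xs" "\<lambda>i. \<bar>\<gamma> $ i\<bar>" "q * \<bar>\<gamma> $ j\<bar>"] single by simp
    also have "\<dots> \<le> real CARD('n) * (q * \<bar>\<gamma> $ j\<bar>)"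
      using q card_mono[of UNIV "- I_0 xs"] by (intro mult_right_mono) auto
    also have "\<dots> = min 1 (c / 2) * \<bar>\<gamma> $ j\<bar>" by (simp add: q_def)
    also have "\<dots> \<le> min 1 (c / 2) * (\<Sum>i\<in>I_0 xs. \<bar>\<gamma> $ i\<bar>)"
      using member_le_sum[of j "I_0 xs" "\<lambda>i. \<bar>\<gamma> $ i\<bar>"] j c by (intro mult_left_mono) auto
    finally show ?thesis .
  qed
  show thesis
  proof (rule that[of "c / 4" e])
    fix t \<sigma> :: real and x y \<gamma> :: "real^'n" and lam \<mu> :: "nat \<Rightarrow> real"
    assume A: "t > 0" "(x, y) \<in> nlp_set g m h p \<kappa> t" "dist x xs < e"
      "\<forall>i<m. lam i \<ge> 0 \<and> lam i * g i x = 0" "y_stationary \<kappa> t x y \<sigma> \<gamma>"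
    define G0 G1 L M V where "G0 = (\<Sum>i\<in>I_0 xs. \<bar>\<gamma> $ i\<bar>)" and "G1 = (\<Sum>i\<in>- I_0 xs. \<bar>\<gamma> $ i\<bar>)"
      and "L = (\<Sum>i<m. lam i)" and "M = (\<Sum>i<p. \<bar>\<mu> i\<bar>)"
      and "V = norm (constraint_comb g m h p x lam \<mu> \<gamma>)"
    have nn: "G0 \<ge> 0" "L \<ge> 0" "M \<ge> 0"
      using A(4) by (auto simp: G0_def L_def M_def intro!: sum_nonneg)
    have "c * (L + M + G0) \<le> V + G1"
      using est[of x lam \<mu> \<gamma>] A e(2) by (simp add: G0_def G1_def L_def M_def V_def)
    moreover have d: "G1 \<le> min 1 (c / 2) * G0"
      using dom[OF A(1,2,3,5)] by (simp add: G0_def G1_def)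
    moreover have "min 1 (c / 2) * G0 \<le> 1 * G0" "min 1 (c / 2) * G0 \<le> c / 2 * G0"
      using nn by (intro mult_right_mono; simp)+
    moreover have "0 \<le> c * L" "0 \<le> c * M" "0 \<le> c * G0" using nn c by auto
    moreover have "c * G1 \<le> c * G0" using d nn calculation(3) c by (intro mult_left_mono) linarith+
    ultimately have "c / 4 * (L + M + (G0 + G1)) \<le> V"
      unfolding distrib_left by linarith
    then show "c / 4 * mult_size m p lam \<mu> \<gamma>
        \<le> norm (constraint_comb g m h p x lam \<mu> \<gamma>)"
      unfolding sum_split_I_0[of _ xs] by (simp add: G0_def G1_def L_def M_def V_def)
  qed (use c e in auto)
qed

section \<open>Limits of KKT points\<close>

lemma NLP_KKT_iff:
  fixes x y :: "real^'n"
  assumes C: "cont_diff f" "\<forall>i<m. cont_diff (g i)" "\<forall>i<p. cont_diff (h i)"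
  shows "NLP_KKT f g m h p \<kappa> t (x, y) \<longleftrightarrow> (x, y) \<in> nlp_set g m h p \<kappa> t \<and>
    (\<exists>\<Lambda> \<mu>. (grad f x, 0) + (\<Sum>c\<in>nlp_I m. \<Lambda> c *\<^sub>R nlp_G_grad g c (x, y)) + (\<Sum>j<p. \<mu> j *\<^sub>R (grad (h j) x, 0)) = 0 \<and>
      (\<forall>c\<in>nlp_I m. \<Lambda> c \<ge> 0 \<and> \<Lambda> c * nlp_G g \<kappa> t c (x, y) = 0))"
proof -
  have F: "grad (\<lambda>w. f (fst w)) (x, y) = (grad f x, 0)"
    using grad_eqI[OF GDERIV_fst[OF C(1), of "(x, y)"]] by simp
  have G: "grad (nlp_G g \<kappa> t c) (x, y) = nlp_G_grad g c (x, y)" if "c \<in> nlp_I m" for c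
    by (rule grad_eqI[OF GDERIV_nlp_G[OF C(2) that]])
  have H: "grad (\<lambda>w. h j (fst w)) (x, y) = (grad (h j) x, 0)" if "j < p" for j
    using grad_eqI[OF GDERIV_fst[of "h j" "(x, y)"]] C(3) that by simp
  have SG: "(\<Sum>c\<in>nlp_I m. \<Lambda> c *\<^sub>R grad (nlp_G g \<kappa> t c) (x, y)) = (\<Sum>c\<in>nlp_I m. \<Lambda> c *\<^sub>R nlp_G_grad g c (x, y))" for \<Lambda>
    by (rule sum.cong) (simp_all add: G)
  have SH: "(\<Sum>j<p. \<mu> j *\<^sub>R grad (\<lambda>w. h j (fst w)) (x, y)) = (\<Sum>j<p. \<mu> j *\<^sub>R (grad (h j) x, 0))" for \<mu>
    by (rule sum.cong) (simp_all add: H)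
  show ?thesis
    unfolding NLP_KKT_def kkt_point_def F SG SH ..
qed

lemma sum_scaleR_Pair_zero: "(\<Sum>j\<in>A. \<mu> j *\<^sub>R (v j, 0 :: 'b::real_vector)) = ((\<Sum>j\<in>A. \<mu> j *\<^sub>R v j), 0)"
  by (simp add: prod_eq_iff fst_sum snd_sum)

lemma NLP_KKT_multipliers:
  fixes x y :: "real^'n"
  assumes C: "cont_diff f" "\<forall>i<m. cont_diff (g i)" "\<forall>i<p. cont_diff (h i)"
    and t: "t > 0" and KKT: "NLP_KKT f g m h p \<kappa> t (x, y)"
  shows "\<exists>lam \<mu> \<sigma> \<gamma>. lagr_grad f g m h p x lam \<mu> \<gamma> = 0 \<and>
    (\<forall>i<m. lam i \<ge> 0 \<and> lam i * g i x = 0) \<and> y_stationary \<kappa> t x y \<sigma> \<gamma>"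
proof -
  obtain \<Lambda> \<mu> where mem: "(x, y) \<in> nlp_set g m h p \<kappa> t"
    and eq: "(grad f x, 0) + (\<Sum>c\<in>nlp_I m. \<Lambda> c *\<^sub>R nlp_G_grad g c (x, y)) + (\<Sum>j<p. \<mu> j *\<^sub>R (grad (h j) x, 0)) = 0"
    and compl: "\<forall>c\<in>nlp_I m. \<Lambda> c \<ge> 0 \<and> \<Lambda> c * nlp_G g \<kappa> t c (x, y) = 0"
    using KKT unfolding NLP_KKT_iff[OF C] by blast
  define \<gamma> where "\<gamma> = (\<chi> i. (\<Lambda> (CProdUp i) - \<Lambda> (CProdLow i)) * y $ i)"
  have eqx: "grad f x + ((\<Sum>i<m. \<Lambda> (CG i) *\<^sub>R grad (g i) x) + \<gamma>) + (\<Sum>j<p. \<mu> j *\<^sub>R grad (h j) x) = 0"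
    and eqy: "(\<chi> i. - \<Lambda> CSum - \<Lambda> (CLow i) + \<Lambda> (CUp i) + (\<Lambda> (CProdUp i) - \<Lambda> (CProdLow i)) * x $ i) = 0"
    using eq unfolding sum_nlp_G_grad sum_scaleR_Pair_zero \<gamma>_def by (simp_all add: zero_prod_def)
  have "y_stationary \<kappa> t x y (\<Lambda> CSum) \<gamma>"
    unfolding \<gamma>_def using eqy by (intro y_stationaryI[OF t mem compl]) (simp add: vec_eq_iff)
  moreover have "\<Lambda> (CG i) \<ge> 0 \<and> \<Lambda> (CG i) * g i x = 0" if "i < m" for i
    using bspec[OF compl, of "CG i"] that by (simp add: nlp_I_def)
  ultimately show ?thesis
    using eqx by (intro exI[of _ "\<lambda>i. \<Lambda> (CG i)"] exI[of _ \<mu>] exI[of _ "\<Lambda> CSum"] exI[of _ \<gamma>])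
      (simp add: add_ac)
qed

lemma multipliers_convergent_subseq:
  fixes lam \<mu> :: "nat \<Rightarrow> nat \<Rightarrow> real" and \<gamma> :: "nat \<Rightarrow> real^'n"
  assumes nonneg: "\<And>k i. i < m \<Longrightarrow> lam k i \<ge> 0"
    and bound: "\<And>k. mult_size m p (lam k) (\<mu> k) (\<gamma> k) \<le> M"
  obtains s l u w where "strict_mono (s :: nat \<Rightarrow> nat)" "\<And>i. i < m \<Longrightarrow> (\<lambda>k. lam (s k) i) \<longlonglongrightarrow> l i"
    "\<And>i. i < p \<Longrightarrow> (\<lambda>k. \<mu> (s k) i) \<longlonglongrightarrow> u i" "(\<lambda>k. \<gamma> (s k)) \<longlonglongrightarrow> w"
proof -
  define A where "A = {..<m} <+> ({..<p} <+> (UNIV :: 'n set))"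
  define v where "v k = case_sum (lam k) (case_sum (\<mu> k) (\<lambda>i. \<gamma> k $ i))" for k
  have finA: "finite A" by (simp add: A_def)
  have "(\<Sum>q\<in>A. \<bar>v k q\<bar>) = mult_size m p (lam k) (\<mu> k) (\<gamma> k)" for k
    unfolding A_def by (simp add: sum.Plus v_def nonneg)
  then have "(\<Sum>q\<in>A. \<bar>v k q\<bar>) \<le> M" for k using bound by simp
  then have "\<bar>v k q\<bar> \<le> M" if "q \<in> A" for k q
    using member_le_sum[of q A "\<lambda>q. \<bar>v k q\<bar>"] that finA by (meson abs_ge_zero order_trans DiffD1)
  then obtain L s where s: "strict_mono (s :: nat \<Rightarrow> nat)" and L: "\<forall>q\<in>A. (\<lambda>k. v (s k) q) \<longlonglongrightarrow> L q"
    using finite_family_convergent_subseq[OF finA, of v M] by blast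
  show thesis
  proof (rule that[of s "\<lambda>i. L (Inl i)" "\<lambda>i. L (Inr (Inl i))" "\<chi> i. L (Inr (Inr i))"])
    show "strict_mono s" by (rule s)
    show "(\<lambda>k. lam (s k) i) \<longlonglongrightarrow> L (Inl i)" if "i < m" for i
      using L[rule_format, of "Inl i"] that by (simp add: A_def v_def Plus_def image_iff)
    show "(\<lambda>k. \<mu> (s k) i) \<longlonglongrightarrow> L (Inr (Inl i))" if "i < p" for i
      using L[rule_format, of "Inr (Inl i)"] that by (simp add: A_def v_def Plus_def image_iff)
    have "(\<lambda>k. \<gamma> (s k) $ i) \<longlonglongrightarrow> L (Inr (Inr i))" for i
      using L[rule_format, of "Inr (Inr i)"] by (simp add: A_def v_def Plus_def image_iff)
    then show "(\<lambda>k. \<gamma> (s k)) \<longlonglongrightarrow> (\<chi> i. L (Inr (Inr i)))"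
      by (intro vec_tendstoI) simp
  qed
qed

text \<open>The inequality \<open>\<bar>\<gamma>\<^sub>i\<bar> y\<^sub>j\<^sup>2 \<le> \<bar>\<gamma>\<^sub>j\<bar> y\<^sub>i\<^sup>2\<close> holds whenever \<open>y\<^sub>j < 1\<close>. If \<open>\<gamma>\<^sub>i\<close> had a nonzero limit although \<open>y\<^sub>i\<close> tends
  to \<open>0\<close>, it would fail for large \<open>k\<close> for every \<open>j\<close> such that \<open>y\<^sub>j\<close> has a positive limit, so all these \<open>y\<^sub>j\<close>
  would equal \<open>1\<close> eventually. Then the remaining
  components of \<open>y\<close> have a constant sum, because \<open>\<sigma> > 0\<close> makes the sum constraint active; this sum tends
  to \<open>0\<close>, so it is \<open>0\<close>, contradicting \<open>y\<^sub>i > 0\<close>.\<close>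

lemma y_stationary_limit_zero:
  fixes X Y \<gamma> :: "nat \<Rightarrow> real^'n"
  assumes t: "\<And>k. t k > 0" and ys: "\<And>k. y_stationary \<kappa> (t k) (X k) (Y k) (\<sigma> k) (\<gamma> k)"
    and Y01: "\<And>k i. 0 \<le> Y k $ i \<and> Y k $ i \<le> 1"
    and Y: "Y \<longlonglongrightarrow> y" and \<gamma>: "\<gamma> \<longlonglongrightarrow> w" and yi: "y $ i = 0"
  shows "w $ i = 0"
proof (rule ccontr)
  assume wi: "w $ i \<noteq> 0"
  have Yl: "(\<lambda>k. Y k $ j) \<longlonglongrightarrow> y $ j" and \<gamma>l: "(\<lambda>k. \<gamma> k $ j) \<longlonglongrightarrow> w $ j" for j
    using Y \<gamma> by (auto intro: tendsto_vec_nth)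
  have ev1: "\<forall>\<^sub>F k in sequentially. \<gamma> k $ i \<noteq> 0"
    using \<gamma>l wi by (rule tendsto_imp_eventually_ne)
  have le: "\<bar>\<gamma> k $ j\<bar> * t k \<le> \<sigma> k * (Y k $ j)\<^sup>2" and eq: "Y k $ j < 1 \<Longrightarrow> \<bar>\<gamma> k $ j\<bar> * t k = \<sigma> k * (Y k $ j)\<^sup>2"
    for j k using ys[of k] by (auto simp: y_stationary_def)
  have \<sigma>: "(\<Sum>j\<in>UNIV. Y k $ j) = real CARD('n) - real \<kappa> \<and> 0 < Y k $ i" if "\<gamma> k $ i \<noteq> 0" for k
  proof -
    have "\<sigma> k \<noteq> 0" using le[of k i] that t[of k] by (auto simp: mult_le_0_iff)
    then show ?thesis using ys[of k] by (auto simp: y_stationary_def)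
  qed
  define P where "P = {j. y $ j \<noteq> 0}"
  have ev2: "\<forall>\<^sub>F k in sequentially. \<forall>j\<in>P. Y k $ j = 1"
  proof (rule eventually_ball_finite)
    show "\<forall>j\<in>P. \<forall>\<^sub>F k in sequentially. Y k $ j = 1"
    proof
      fix j assume "j \<in> P"
      then have "\<bar>w $ j\<bar> * (y $ i)\<^sup>2 < \<bar>w $ i\<bar> * (y $ j)\<^sup>2" using yi wi by (simp add: P_def)
      moreover have "(\<lambda>k. \<bar>\<gamma> k $ i\<bar> * (Y k $ j)\<^sup>2 - \<bar>\<gamma> k $ j\<bar> * (Y k $ i)\<^sup>2)
        \<longlonglongrightarrow> \<bar>w $ i\<bar> * (y $ j)\<^sup>2 - \<bar>w $ j\<bar> * (y $ i)\<^sup>2"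
        by (intro tendsto_intros Yl \<gamma>l)
      ultimately have "\<forall>\<^sub>F k in sequentially. 0 < \<bar>\<gamma> k $ i\<bar> * (Y k $ j)\<^sup>2 - \<bar>\<gamma> k $ j\<bar> * (Y k $ i)\<^sup>2"
        by (intro order_tendstoD(1)) auto
      then show "\<forall>\<^sub>F k in sequentially. Y k $ j = 1"
      proof eventually_elim
        case (elim k)
        show ?case
        proof (rule ccontr)
          assume "Y k $ j \<noteq> 1"
          then have "Y k $ j < 1" using Y01[of k j] by simp
          then have *: "\<bar>\<gamma> k $ j\<bar> * t k = \<sigma> k * (Y k $ j)\<^sup>2" by (rule eq)
          have "\<bar>\<gamma> k $ i\<bar> * t k * (Y k $ j)\<^sup>2 \<le> \<sigma> k * (Y k $ i)\<^sup>2 * (Y k $ j)\<^sup>2"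
            by (rule mult_right_mono[OF le]) simp
          also have "\<dots> = (\<bar>\<gamma> k $ j\<bar> * t k) * (Y k $ i)\<^sup>2" unfolding * by simp
          finally have "t k * (\<bar>\<gamma> k $ i\<bar> * (Y k $ j)\<^sup>2) \<le> t k * (\<bar>\<gamma> k $ j\<bar> * (Y k $ i)\<^sup>2)"
            by (simp add: mult_ac)
          then show False using elim t[of k] by simp
        qed
      qed
    qed
  qed simp
  define r where "r = real CARD('n) - real \<kappa> - real (card P)"
  have ev3: "\<forall>\<^sub>F k in sequentially. (\<Sum>j\<in>- P. Y k $ j) = r \<and> 0 < Y k $ i"
    using ev1 ev2
  proof eventually_elim
    case (elim k)
    have "(\<Sum>j\<in>UNIV. Y k $ j) = (\<Sum>j\<in>P. Y k $ j) + (\<Sum>j\<in>- P. Y k $ j)"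
      by (subst sum.union_disjoint[symmetric]) auto
    moreover have "(\<Sum>j\<in>P. Y k $ j) = card P" using elim by simp
    ultimately show ?case using \<sigma>[OF elim(1)] by (simp add: r_def)
  qed
  have "(\<lambda>k. \<Sum>j\<in>- P. Y k $ j) \<longlonglongrightarrow> (\<Sum>j\<in>- P. y $ j)"
    by (intro tendsto_sum Yl)
  moreover have "(\<Sum>j\<in>- P. y $ j) = 0" by (simp add: P_def)
  moreover have "(\<lambda>k. \<Sum>j\<in>- P. Y k $ j) \<longlonglongrightarrow> r"
    by (rule tendsto_eventually) (use ev3 in \<open>auto elim: eventually_mono\<close>)
  ultimately have "r = 0" using LIMSEQ_unique by metis
  with ev3 obtain k where k: "(\<Sum>j\<in>- P. Y k $ j) = 0" "0 < Y k $ i"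
    using eventually_happens by fastforce
  have "i \<in> - P" using yi by (simp add: P_def)
  then have "Y k $ i \<le> (\<Sum>j\<in>- P. Y k $ j)" using Y01 by (intro member_le_sum) auto
  then show False using k by simp
qed

text \<open>Once the multipliers \<open>(\<lambda>, \<mu>, \<gamma>)\<close> are bounded, a convergent subsequence of them supplies multipliers at
  the limit point; the preceding lemma removes \<open>\<gamma>\<^sub>i\<close> exactly where S-stationarity demands it.\<close>

lemma S_stationary_limit:
  fixes X Y :: "nat \<Rightarrow> real^'n"
  assumes C: "cont_diff f" "\<forall>i<m. cont_diff (g i)" "\<forall>i<p. cont_diff (h i)"
    and c: "c > 0" and est: "\<And>t x y lam \<mu> \<sigma> \<gamma>. t > 0 \<Longrightarrow> (x, y) \<in> nlp_set g m h p \<kappa> t \<Longrightarrow> dist x xs < e \<Longrightarrow>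
      (\<forall>i<m. lam i \<ge> 0 \<and> lam i * g i x = 0) \<Longrightarrow> y_stationary \<kappa> t x y \<sigma> \<gamma> \<Longrightarrow>
      c * mult_size m p lam \<mu> \<gamma>
        \<le> norm (constraint_comb g m h p x lam \<mu> \<gamma>)"
    and t: "\<And>k. t k > 0" "t \<longlonglongrightarrow> 0" and KKT: "\<And>k. NLP_KKT f g m h p \<kappa> (t k) (X k, Y k)"
    and near: "\<And>k. dist (X k) xs < e" and lim: "X \<longlonglongrightarrow> x" "Y \<longlonglongrightarrow> y"
  shows "S_stationary f g m h p \<kappa> x y"
proof -
  have mem: "(X k, Y k) \<in> nlp_set g m h p \<kappa> (t k)" for k
    using KKT[of k] unfolding NLP_KKT_iff[OF C] by blast
  have feas: "(x, y) \<in> feas_R g m h p \<kappa>"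
    by (rule tendsto_feas_R[OF C(2,3) mem t(2) lim])
  define kkt where "kkt k lam \<mu> \<sigma> \<gamma> \<longleftrightarrow>
      lagr_grad f g m h p (X k) lam \<mu> \<gamma> = 0 \<and>
      (\<forall>i<m. lam i \<ge> 0 \<and> lam i * g i (X k) = 0) \<and> y_stationary \<kappa> (t k) (X k) (Y k) \<sigma> \<gamma>" for k lam \<mu> \<sigma> \<gamma>
  have "\<forall>k. \<exists>lam \<mu> \<sigma> \<gamma>. kkt k lam \<mu> \<sigma> \<gamma>"
    unfolding kkt_def using NLP_KKT_multipliers[OF C t(1) KKT] by blast
  then obtain lam \<mu> \<sigma> \<gamma> where kkt: "\<And>k. kkt k (lam k) (\<mu> k) (\<sigma> k) (\<gamma> k)"
    by metis
  have stat: "lagr_grad f g m h p (X k) (lam k) (\<mu> k) (\<gamma> k) = 0"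
    and lam: "\<forall>i<m. lam k i \<ge> 0 \<and> lam k i * g i (X k) = 0"
    and ys: "y_stationary \<kappa> (t k) (X k) (Y k) (\<sigma> k) (\<gamma> k)" for k
    using kkt[of k] unfolding kkt_def by blast+
  have gf: "(\<lambda>k. grad f (X k)) \<longlonglongrightarrow> grad f x"
    by (rule isCont_tendsto_compose[OF cont_diff_isCont_grad[OF C(1)] lim(1)])
  then obtain M where M: "\<And>k. norm (grad f (X k)) \<le> M"
    using convergent_imp_Bseq[of "\<lambda>k. grad f (X k)"] unfolding convergent_def Bseq_def by blast
  have bound: "mult_size m p (lam k) (\<mu> k) (\<gamma> k) \<le> M / c" for k
  proof -
    have "constraint_comb g m h p (X k) (lam k) (\<mu> k) (\<gamma> k) = - grad f (X k)"
      using stat[of k] by (simp add: add_eq_0_iff add.assoc)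
    then have "c * mult_size m p (lam k) (\<mu> k) (\<gamma> k) \<le> M"
      using est[OF t(1) mem near lam ys, of k "\<mu> k"] M[of k] by simp
    then show ?thesis using c by (simp add: field_simps)
  qed
  obtain s l u w where s: "strict_mono (s :: nat \<Rightarrow> nat)" and l: "\<And>i. i < m \<Longrightarrow> (\<lambda>k. lam (s k) i) \<longlonglongrightarrow> l i"
    and u: "\<And>i. i < p \<Longrightarrow> (\<lambda>k. \<mu> (s k) i) \<longlonglongrightarrow> u i" and w: "(\<lambda>k. \<gamma> (s k)) \<longlonglongrightarrow> w"
    using multipliers_convergent_subseq[of m lam \<mu> p \<gamma>, OF _ bound] lam by blast
  have Xs: "(\<lambda>k. X (s k)) \<longlonglongrightarrow> x" and Ys: "(\<lambda>k. Y (s k)) \<longlonglongrightarrow> y"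
    and gfs: "(\<lambda>k. grad f (X (s k))) \<longlonglongrightarrow> grad f x"
    using LIMSEQ_subseq_LIMSEQ[OF lim(1) s] LIMSEQ_subseq_LIMSEQ[OF lim(2) s] LIMSEQ_subseq_LIMSEQ[OF gf s]
    by (simp_all add: o_def)
  have "(\<lambda>k. lagr_grad f g m h p (X (s k)) (lam (s k)) (\<mu> (s k)) (\<gamma> (s k)))
    \<longlonglongrightarrow> lagr_grad f g m h p x l u w"
    using C by (intro tendsto_add gfs w tendsto_sum tendsto_scaleR l u
        isCont_tendsto_compose[OF cont_diff_isCont_grad Xs]) auto
  then have "lagr_grad f g m h p x l u w = 0"
    by (simp add: stat LIMSEQ_const_iff)
  moreover have "l i \<ge> 0 \<and> l i * g i x = 0" if i: "i < m" for i
  proof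
    show "l i \<ge> 0" using l[OF i] by (rule LIMSEQ_le_const) (use lam i in auto)
    have "(\<lambda>k. lam (s k) i * g i (X (s k))) \<longlonglongrightarrow> l i * g i x"
      using C(2) i by (intro tendsto_mult l isCont_tendsto_compose[OF cont_diff_isCont Xs]) auto
    then show "l i * g i x = 0" using lam i by (simp add: LIMSEQ_const_iff)
  qed
  moreover have "w $ i = 0" if "y $ i = 0" for i
    using y_stationary_limit_zero[of "\<lambda>k. t (s k)" \<kappa> "\<lambda>k. X (s k)" "\<lambda>k. Y (s k)" "\<lambda>k. \<sigma> (s k)" "\<lambda>k. \<gamma> (s k)" y w i]
      t(1) ys Ys w that mem by (auto simp: nlp_set_iff)
  moreover have "(\<Sum>i\<in>UNIV. w $ i *\<^sub>R axis i 1) = w" by (simp add: sum_axis vec_eq_iff)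
  ultimately have "S_multiplier f g m h p x y l u w"
    unfolding S_multiplier_def M_multiplier_def by (simp add: I_pm0_def I_00_def)
  with feas show ?thesis unfolding S_stationary_def by blast
qed

section \<open>Local minima of the regularized program\<close>

lemma closed_nlp_feas:
  fixes G :: "'i \<Rightarrow> 'a::topological_space \<Rightarrow> real"
  assumes "\<And>i. i \<in> I \<Longrightarrow> continuous_on UNIV (G i)" "\<And>j. j \<in> J \<Longrightarrow> continuous_on UNIV (H j)"
  shows "closed (nlp_feas I G J H)"
proof -
  have "nlp_feas I G J H = (\<Inter>i\<in>I. {z. G i z \<le> 0}) \<inter> (\<Inter>j\<in>J. {z. H j z = 0})"
    by (auto simp: nlp_feas_def)
  moreover have "closed {z. G i z \<le> 0}" if "i \<in> I" for i
    using closed_Collect_le[OF assms(1)[OF that] continuous_on_const] .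
  moreover have "closed {z. H j z = 0}" if "j \<in> J" for j
    using closed_Collect_eq[OF assms(2)[OF that] continuous_on_const] .
  ultimately show ?thesis by (auto intro!: closed_Int closed_INT)
qed

lemma continuous_on_fst_cont_diff:
  assumes "cont_diff F"
  shows "continuous_on A (\<lambda>w. F (fst w))"
proof -
  have "continuous_on UNIV F"
    using cont_diff_isCont[OF assms] by (simp add: continuous_on_eq_continuous_at)
  then show ?thesis
    by (rule continuous_on_compose2) (auto intro: continuous_intros)
qed

lemma closed_nlp_set:
  assumes C: "\<forall>i<m. cont_diff (g i)" "\<forall>i<p. cont_diff (h i)"
  shows "closed (nlp_set g m h p \<kappa> t)"
proof (rule closed_nlp_feas)
  fix c assume "c \<in> (nlp_I m :: 'a nlp_idx set)"
  then show "continuous_on UNIV (nlp_G g \<kappa> t c)"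
    using GDERIV_nlp_G[OF C(1)] unfolding gderiv_def
    by (intro continuous_at_imp_continuous_on ballI has_derivative_continuous)
next
  fix j assume "j \<in> {..<p}"
  then show "continuous_on UNIV (\<lambda>w. h j (fst w))"
    using C(2) by (auto intro: continuous_on_fst_cont_diff)
qed

text \<open>A minimizer over the compact localized feasible set could stay on the boundary of the ball for
  arbitrarily small \<open>t\<close> only if a limit of such minimizers were a competitor of \<open>xs\<close> at distance
  \<open>\<epsilon>\<close> with no larger value.\<close>

lemma regularized_minimizer:
  fixes xs :: "real^'n"
  assumes C: "cont_diff f" "\<forall>i<m. cont_diff (g i)" "\<forall>i<p. cont_diff (h i)"
    and xs: "xs \<in> feas_P g m h p \<kappa>"
    and strict: "\<And>x. x \<in> feas_P g m h p \<kappa> \<Longrightarrow> x \<noteq> xs \<Longrightarrow> dist x xs < \<rho> \<Longrightarrow> f xs < f x"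
    and \<epsilon>: "0 < \<epsilon>" "\<epsilon> < \<rho>"
  shows "\<exists>T>0. \<forall>t. 0 < t \<and> t \<le> T \<longrightarrow> (\<exists>x y. (x, y) \<in> nlp_set g m h p \<kappa> t \<and> dist x xs < \<epsilon> \<and>
    (\<forall>x' y'. (x', y') \<in> nlp_set g m h p \<kappa> t \<longrightarrow> dist x' xs \<le> \<epsilon> \<longrightarrow> f x \<le> f x'))"
proof (rule ccontr)
  define good where "good t x y \<longleftrightarrow> (x, y) \<in> nlp_set g m h p \<kappa> t \<and>
    (\<forall>x' y'. (x', y') \<in> nlp_set g m h p \<kappa> t \<longrightarrow> dist x' xs \<le> \<epsilon> \<longrightarrow> f x \<le> f x')" for t x y
  assume neg: "\<not> ?thesis"
  have "\<exists>t. 0 < t \<and> t \<le> inverse (real (Suc k)) \<and> \<not> (\<exists>x y. dist x xs < \<epsilon> \<and> good t x y)" for k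
  proof -
    have "inverse (real (Suc k)) > 0" by simp
    with neg show ?thesis unfolding good_def by (metis (no_types, lifting))
  qed
  then obtain t where t: "\<And>k. 0 < t k" "\<And>k. t k \<le> inverse (real (Suc k))"
    and bad: "\<And>k x y. dist x xs < \<epsilon> \<Longrightarrow> \<not> good (t k) x y"
    by metis
  define K where "K = cball xs \<epsilon> \<times> cbox 0 (1 :: real^'n)"
  have K: "compact K" unfolding K_def by (intro compact_Times compact_cball compact_cbox)
  obtain ys where ys: "(xs, ys) \<in> feas_R g m h p \<kappa>"
    using feas_R_indicator[OF xs, of xs] xs unfolding feas_P_def by blast
  have memK: "(x, y) \<in> K \<longleftrightarrow> dist x xs \<le> \<epsilon>" if "(x, y) \<in> nlp_set g m h p \<kappa> s" for x y s
    using that by (auto simp: K_def nlp_set_iff mem_box_cart dist_commute)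
  have ysK: "(xs, ys) \<in> K \<inter> nlp_set g m h p \<kappa> (t k)" for k
    using feas_R_subset_nlp_set[OF less_imp_le[OF t(1)] ys] memK \<epsilon> by fastforce
  have contf: "continuous_on A (\<lambda>w. f (fst w))" for A :: "((real^'n) \<times> (real^'n)) set"
    by (rule continuous_on_fst_cont_diff[OF C(1)])
  have "\<exists>z. z \<in> K \<and> z \<in> nlp_set g m h p \<kappa> (t k) \<and> f (fst z) \<le> f xs \<and> good (t k) (fst z) (snd z)" for k
  proof -
    have "compact (K \<inter> nlp_set g m h p \<kappa> (t k))"
      by (rule compact_Int_closed[OF K closed_nlp_set[OF C(2,3)]])
    then obtain z where z: "z \<in> K \<inter> nlp_set g m h p \<kappa> (t k)"
      "\<forall>w \<in> K \<inter> nlp_set g m h p \<kappa> (t k). f (fst z) \<le> f (fst w)"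
      using continuous_attains_inf[OF _ _ contf] ysK[of k] by blast
    have "f (fst z) \<le> f x'" if "(x', y') \<in> nlp_set g m h p \<kappa> (t k)" "dist x' xs \<le> \<epsilon>" for x' y'
      using bspec[OF z(2), of "(x', y')"] that memK[OF that(1)] by simp
    then have "good (t k) (fst z) (snd z)" using z(1) unfolding good_def by auto
    moreover have "f (fst z) \<le> f xs" using bspec[OF z(2) ysK[of k]] by simp
    ultimately show ?thesis using z(1) by blast
  qed
  then obtain Z where Z: "\<And>k. Z k \<in> K" "\<And>k. Z k \<in> nlp_set g m h p \<kappa> (t k)" "\<And>k. f (fst (Z k)) \<le> f xs"
    "\<And>k. good (t k) (fst (Z k)) (snd (Z k))" by metis
  have far: "\<epsilon> \<le> dist (fst (Z k)) xs" for k
    using bad Z(4) not_less by blast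
  obtain z s where s: "strict_mono (s :: nat \<Rightarrow> nat)" and lim: "(Z \<circ> s) \<longlonglongrightarrow> z" and zK: "z \<in> K"
    using K Z(1) unfolding compact_def by meson
  have t0: "t \<longlonglongrightarrow> 0"
    by (rule tendsto_sandwich[OF _ _ tendsto_const LIMSEQ_inverse_real_of_nat])
      (use t in \<open>auto intro!: always_eventually less_imp_le simp del: of_nat_Suc\<close>)
  have X: "(\<lambda>k. fst (Z (s k))) \<longlonglongrightarrow> fst z" and Y: "(\<lambda>k. snd (Z (s k))) \<longlonglongrightarrow> snd z"
    using tendsto_fst[OF lim] tendsto_snd[OF lim] by (simp_all add: o_def)
  have "(fst z, snd z) \<in> feas_R g m h p \<kappa>"
    using Z(2) LIMSEQ_subseq_LIMSEQ[OF t0 s]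
    by (intro tendsto_feas_R[OF C(2,3) _ _ X Y, where t = "\<lambda>k. t (s k)"]) (auto simp: o_def)
  then have feas: "fst z \<in> feas_P g m h p \<kappa>" by (rule feas_R_imp_feas_P)
  have "f (fst z) \<le> f xs"
    using isCont_tendsto_compose[OF cont_diff_isCont[OF C(1)] X] by (rule LIMSEQ_le_const2) (use Z in auto)
  moreover have "\<epsilon> \<le> dist (fst z) xs"
    using tendsto_dist[OF X tendsto_const[of xs]] by (rule LIMSEQ_le_const) (use far in auto)
  moreover have "dist (fst z) xs \<le> \<epsilon>" using zK by (auto simp: K_def dist_commute)
  ultimately show False using strict[OF feas] \<epsilon> by fastforce
qed

text \<open>For \<open>\<kappa> > 0\<close> the multiplier estimate is MFCQ for \<open>NLP(t)\<close> in disguise. A vanishing positive combination of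
  active gradients has \<open>\<lambda>\<close>, \<open>\<mu>\<close>, \<open>\<gamma>\<close> equal to \<open>0\<close> by the estimate; a positive \<open>\<sigma>\<close> would make some \<open>\<gamma>\<^sub>i\<close>
  nonzero, and then the remaining multipliers vanish by complementarity.\<close>

lemma regularized_local_min_KKT_pos:
  fixes x y xs :: "real^'n"
  assumes C: "cont_diff f" "\<forall>i<m. cont_diff (g i)" "\<forall>i<p. cont_diff (h i)"
    and \<kappa>: "0 < \<kappa>" "norm0 xs \<le> \<kappa>" and t: "t > 0" and c: "c > 0"
    and est: "\<And>lam \<mu> \<sigma> \<gamma>.
      (\<forall>i<m. lam i \<ge> 0 \<and> lam i * g i x = 0) \<Longrightarrow> y_stationary \<kappa> t x y \<sigma> \<gamma> \<Longrightarrow>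
      c * mult_size m p lam \<mu> \<gamma>
        \<le> norm (constraint_comb g m h p x lam \<mu> \<gamma>)"
    and mem: "(x, y) \<in> nlp_set g m h p \<kappa> t" and \<delta>: "\<delta> > 0"
    and min: "\<And>x' y'. (x', y') \<in> nlp_set g m h p \<kappa> t \<Longrightarrow> dist x' x < \<delta> \<Longrightarrow> f x \<le> f x'"
  shows "NLP_KKT f g m h p \<kappa> t (x, y)"
proof -
  let ?A = "{c \<in> nlp_I m. nlp_G g \<kappa> t c (x, y) = 0}"
  have indep: "\<not> pos_lin_dependent ?A (\<lambda>c. nlp_G_grad g c (x, y)) {..<p} (\<lambda>j. (grad (h j) (fst (x, y)), 0))"
  proof
    assume "pos_lin_dependent ?A (\<lambda>c. nlp_G_grad g c (x, y)) {..<p} (\<lambda>j. (grad (h j) (fst (x, y)), 0))"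
    then obtain lam \<mu> where lam: "\<forall>c\<in>?A. lam c \<ge> 0"
      and nz: "(\<exists>c\<in>?A. lam c \<noteq> 0) \<or> (\<exists>j\<in>{..<p}. \<mu> j \<noteq> 0)"
      and eq: "(\<Sum>c\<in>?A. lam c *\<^sub>R nlp_G_grad g c (x, y)) + (\<Sum>j<p. \<mu> j *\<^sub>R (grad (h j) x, 0 :: real^'n)) = 0"
      unfolding pos_lin_dependent_def by auto
    define \<Lambda> where "\<Lambda> c = (if c \<in> ?A then lam c else 0)" for c
    have compl: "\<forall>c\<in>nlp_I m. \<Lambda> c \<ge> 0 \<and> \<Lambda> c * nlp_G g \<kappa> t c (x, y) = 0"
      using lam by (auto simp: \<Lambda>_def)
    have "(\<Sum>c\<in>?A. lam c *\<^sub>R nlp_G_grad g c (x, y)) = (\<Sum>c\<in>nlp_I m. \<Lambda> c *\<^sub>R nlp_G_grad g c (x, y))"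
      by (rule sum.mono_neutral_cong_left) (auto simp: \<Lambda>_def finite_nlp_I)
    with eq have eq2: "(\<Sum>c\<in>nlp_I m. \<Lambda> c *\<^sub>R nlp_G_grad g c (x, y)) + (\<Sum>j<p. \<mu> j *\<^sub>R (grad (h j) x, 0 :: real^'n)) = 0"
      by simp
    define \<gamma> where "\<gamma> = (\<chi> i. (\<Lambda> (CProdUp i) - \<Lambda> (CProdLow i)) * y $ i)"
    have eqx: "(\<Sum>i<m. \<Lambda> (CG i) *\<^sub>R grad (g i) x) + \<gamma> + (\<Sum>j<p. \<mu> j *\<^sub>R grad (h j) x) = 0"
      and "(\<chi> i. - \<Lambda> CSum - \<Lambda> (CLow i) + \<Lambda> (CUp i) + (\<Lambda> (CProdUp i) - \<Lambda> (CProdLow i)) * x $ i) = 0"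
      using eq2 unfolding sum_nlp_G_grad sum_scaleR_Pair_zero \<gamma>_def by (simp_all add: zero_prod_def)
    then have eqy: "- \<Lambda> CSum - \<Lambda> (CLow i) + \<Lambda> (CUp i) + (\<Lambda> (CProdUp i) - \<Lambda> (CProdLow i)) * x $ i = 0" for i
      by (simp add: vec_eq_iff)
    have ys: "y_stationary \<kappa> t x y (\<Lambda> CSum) \<gamma>"
      unfolding \<gamma>_def by (rule y_stationaryI[OF t mem compl eqy])
    have CG: "\<forall>i<m. \<Lambda> (CG i) \<ge> 0 \<and> \<Lambda> (CG i) * g i x = 0"
    proof (intro allI impI)
      fix i assume "i < m"
      then show "\<Lambda> (CG i) \<ge> 0 \<and> \<Lambda> (CG i) * g i x = 0"
        using bspec[OF compl, of "CG i"] by (simp add: nlp_I_def)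
    qed
    define L M Gs where "L = (\<Sum>i<m. \<Lambda> (CG i))" and "M = (\<Sum>i<p. \<bar>\<mu> i\<bar>)" and "Gs = (\<Sum>i\<in>UNIV. \<bar>\<gamma> $ i\<bar>)"
    have "(\<Sum>i<m. \<Lambda> (CG i) *\<^sub>R grad (g i) x) + (\<Sum>i<p. \<mu> i *\<^sub>R grad (h i) x) + \<gamma> = 0"
      using eqx by (simp add: add_ac)
    then have "c * (L + M + Gs) \<le> 0"
      using est[OF CG ys, of \<mu>] by (simp add: L_def M_def Gs_def)
    moreover have nn: "L \<ge> 0" "M \<ge> 0" "Gs \<ge> 0"
      using CG by (auto simp: L_def M_def Gs_def intro!: sum_nonneg)
    ultimately have "L + M + Gs \<le> 0" using c by (simp add: mult_le_0_iff)
    then have "L = 0" "M = 0" "Gs = 0" using nn by linarith+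
    then have L0: "\<And>i. i < m \<Longrightarrow> \<Lambda> (CG i) = 0" and M0: "\<And>i. i < p \<Longrightarrow> \<mu> i = 0" and \<gamma>0: "\<And>i. \<gamma> $ i = 0"
      using CG unfolding L_def M_def Gs_def by (subst (asm) sum_nonneg_eq_0_iff; auto)+
    have y: "0 \<le> y $ i" "y $ i \<le> 1" for i using mem by (auto simp: nlp_set_iff)
    have \<sigma>0: "\<Lambda> CSum = 0"
    proof (rule ccontr)
      assume "\<Lambda> CSum \<noteq> 0"
      then have \<sigma>: "\<Lambda> CSum > 0" using compl by (auto simp: nlp_I_def order_less_le)
      then have pos: "\<And>i. 0 < y $ i" and sum: "(\<Sum>i\<in>UNIV. y $ i) = real CARD('n) - real \<kappa>"
        using ys by (auto simp: y_stationary_def)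
      obtain i where "y $ i < 1"
        using fractional_index_exists[OF \<kappa>(2,1) sum pos] by blast
      then have "\<bar>\<gamma> $ i\<bar> * t = \<Lambda> CSum * (y $ i)\<^sup>2" using ys by (auto simp: y_stationary_def)
      with \<gamma>0 \<sigma> pos[of i] show False by simp
    qed
    have rest: "\<Lambda> (CLow i) = 0 \<and> \<Lambda> (CUp i) = 0 \<and> \<Lambda> (CProdUp i) = 0 \<and> \<Lambda> (CProdLow i) = 0" for i
    proof -
      have cs: "\<Lambda> (CLow i) * y $ i = 0" "\<Lambda> (CUp i) * (y $ i - 1) = 0"
        "\<Lambda> (CProdUp i) * (x $ i * y $ i - t) = 0" "\<Lambda> (CProdLow i) * (- t - x $ i * y $ i) = 0"
        using bspec[OF compl, of "CLow i"] bspec[OF compl, of "CUp i"] bspec[OF compl, of "CProdUp i"]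
          bspec[OF compl, of "CProdLow i"] by (auto simp: nlp_I_def)
      have "(\<Lambda> (CProdUp i) - \<Lambda> (CProdLow i)) * y $ i = 0" using \<gamma>0[of i] by (simp add: \<gamma>_def)
      then have uv: "\<Lambda> (CProdUp i) = 0 \<and> \<Lambda> (CProdLow i) = 0" using cs(3,4) t by auto
      then have "\<Lambda> (CLow i) = \<Lambda> (CUp i)" using eqy[of i] \<sigma>0 by simp
      with cs(1,2) uv show ?thesis by auto
    qed
    have "\<Lambda> c = 0" if "c \<in> nlp_I m" for c
      using that L0 \<sigma>0 rest by (cases c) (auto simp: nlp_I_def)
    then have "lam c = 0" if "c \<in> ?A" for c using that by (force simp: \<Lambda>_def)
    with nz M0 show False by auto
  qed
  have "\<exists>lam \<mu>. (grad f (fst (x, y)), 0) + (\<Sum>c\<in>nlp_I m. lam c *\<^sub>R nlp_G_grad g c (x, y))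
     + (\<Sum>j<p. \<mu> j *\<^sub>R (grad (h j) (fst (x, y)), 0)) = 0 \<and>
      (\<forall>c\<in>nlp_I m. lam c \<ge> 0 \<and> lam c * nlp_G g \<kappa> t c (x, y) = 0)"
  proof (rule KKT_of_local_min[where F = "\<lambda>w. f (fst w)" and H = "\<lambda>j w. h j (fst w)" and \<rho> = \<delta>
        and DF = "\<lambda>w. (grad f (fst w), 0)" and DH = "\<lambda>j w. (grad (h j) (fst w), 0)" and DG = "nlp_G_grad g"])
    show "f (fst (x, y)) \<le> f (fst z)" if "z \<in> nlp_set g m h p \<kappa> t" "dist z (x, y) < \<delta>" for z
      using min[of "fst z" "snd z"] that dist_fst_le[of z "(x, y)"] by simp
    have comp: "continuous_on UNIV (\<lambda>w :: (real^'n) \<times> (real^'n). (grad F (fst w), 0 :: real^'n))"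
      if "cont_diff F" for F
    proof -
      have "continuous_on UNIV (grad F)" using that by (simp add: cont_diff_def)
      then have "continuous_on UNIV (\<lambda>w :: (real^'n) \<times> (real^'n). grad F (fst w))"
        by (rule continuous_on_compose2) (auto intro: continuous_intros)
      then show ?thesis by (intro continuous_intros)
    qed
    show "continuous_on UNIV (\<lambda>w :: (real^'n) \<times> (real^'n). (grad f (fst w), 0 :: real^'n))" by (rule comp[OF C(1)])
    show "continuous_on UNIV (\<lambda>w :: (real^'n) \<times> (real^'n). (grad (h j) (fst w), 0 :: real^'n))" if "j \<in> {..<p}" for j
      using C(3) that by (intro comp) auto
    show "GDERIV (\<lambda>w. h j (fst w)) z :> (grad (h j) (fst z), 0)" if "j \<in> {..<p}" for j and z :: "(real^'n) \<times> (real^'n)"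
      using C(3) that by (intro GDERIV_fst) auto
  qed (use finite_nlp_I GDERIV_fst GDERIV_nlp_G continuous_nlp_G_grad C mem indep \<delta> in auto)
  then show ?thesis unfolding NLP_KKT_iff[OF C] using mem by simp
qed


lemma GDERIV_compose_Pair:
  assumes "GDERIV G (x, y) :> D"
  shows "GDERIV (\<lambda>x. G (x, y)) x :> fst D"
proof -
  have "((\<lambda>x. (x, y)) has_derivative (\<lambda>h. (h, 0))) (at x)"
    by (rule has_derivative_Pair[OF has_derivative_ident has_derivative_const])
  moreover have "(G has_derivative (\<lambda>h. h \<bullet> D)) (at (x, y))"
    using assms by (simp add: gderiv_def)
  ultimately have "((\<lambda>x. G (x, y)) has_derivative (\<lambda>h. (h, 0) \<bullet> D)) (at x)"
    by (rule has_derivative_compose)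
  then show ?thesis by (simp add: gderiv_def inner_prod_def)
qed

text \<open>For \<open>\<kappa> = 0\<close> the constraints \<open>y \<le> e\<close> and \<open>e\<^sup>Ty \<ge> n\<close> leave only \<open>y = e\<close>, so no qualification of
  Mangasarian-Fromovitz type can hold in \<open>(x, y)\<close>. The KKT theorem is therefore applied to the program
  in \<open>x\<close> obtained by fixing \<open>y = e\<close>, and the multipliers of the \<open>y\<close>-constraints are constructed
  afterwards.\<close>

lemma regularized_local_min_KKT_zero:
  fixes x y :: "real^'n"
  assumes C: "cont_diff f" "\<forall>i<m. cont_diff (g i)" "\<forall>i<p. cont_diff (h i)"
    and t: "t > 0" and c: "c > 0"
    and est: "\<And>lam \<mu> \<gamma>.
      (\<forall>i<m. lam i \<ge> 0 \<and> lam i * g i x = 0) \<Longrightarrow>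
      c * mult_size m p lam \<mu> \<gamma>
        \<le> norm (constraint_comb g m h p x lam \<mu> \<gamma>)"
    and mem: "(x, y) \<in> nlp_set g m h p 0 t" and \<delta>: "\<delta> > 0"
    and min: "\<And>x' y'. (x', y') \<in> nlp_set g m h p 0 t \<Longrightarrow> dist x' x < \<delta> \<Longrightarrow> f x \<le> f x'"
  shows "NLP_KKT f g m h p 0 t (x, y)"
proof -
  have "y $ i = 1" for i
  proof (rule ccontr)
    assume "y $ i \<noteq> 1"
    then have lt: "y $ i < 1" using mem by (auto simp: nlp_set_iff order_less_le)
    have "(\<Sum>j\<in>UNIV. y $ j) < (\<Sum>j\<in>(UNIV :: 'n set). 1)"
      by (rule sum_strict_mono_ex1) (use lt mem in \<open>auto simp: nlp_set_iff\<close>)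
    then show False using mem by (simp add: nlp_set_iff)
  qed
  then have y: "y = 1" by (simp add: vec_eq_iff)
  define I :: "'n nlp_idx set" where "I = CG ` {..<m} \<union> range CProdUp \<union> range CProdLow"
  have I: "I \<subseteq> nlp_I m" "finite I" by (auto simp: I_def nlp_I_def)
  have memI: "CProdUp i \<in> I" "CProdLow i \<in> I" "CSum \<notin> I" "CLow i \<notin> I" "CUp i \<notin> I" "CG j \<in> I \<longleftrightarrow> j < m" for i j
    by (auto simp: I_def)
  define G where "G c x = nlp_G g 0 t c (x, 1)" for c and x :: "real^'n"
  define DG where "DG c x = fst (nlp_G_grad g c (x, 1))" for c and x :: "real^'n"
  have feasI: "z \<in> nlp_feas I G {..<p} h \<longleftrightarrow> (z, 1) \<in> nlp_set g m h p 0 t" for z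
  proof -
    have "z \<in> nlp_feas I G {..<p} h \<longleftrightarrow> (\<forall>i<m. g i z \<le> 0) \<and> (\<forall>i<p. h i z = 0) \<and> (\<forall>i. z $ i \<le> t) \<and> (\<forall>i. - t - z $ i \<le> 0)"
      unfolding nlp_feas_def I_def G_def by (auto simp: ball_Un)
    moreover have "\<bar>z $ i\<bar> \<le> t \<longleftrightarrow> z $ i \<le> t \<and> - t - z $ i \<le> 0" for i by auto
    ultimately show ?thesis by (auto simp: nlp_set_iff)
  qed
  have extend: "(\<Sum>c\<in>A. lam c *\<^sub>R DG c x) = (\<Sum>i<m. \<Lambda> (CG i) *\<^sub>R grad (g i) x) + (\<chi> i. \<Lambda> (CProdUp i) - \<Lambda> (CProdLow i))"
    if "A \<subseteq> I" "\<Lambda> = (\<lambda>c. if c \<in> A then lam c else 0)" for A lam \<Lambda>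
  proof -
    have "(\<Sum>c\<in>A. lam c *\<^sub>R DG c x) = (\<Sum>c\<in>nlp_I m. \<Lambda> c *\<^sub>R DG c x)"
      by (rule sum.mono_neutral_cong_left) (use that I in \<open>auto simp: finite_nlp_I\<close>)
    also have "\<dots> = fst (\<Sum>c\<in>nlp_I m. \<Lambda> c *\<^sub>R nlp_G_grad g c (x, 1))"
      by (simp add: fst_sum DG_def)
    finally show ?thesis unfolding sum_nlp_G_grad by simp
  qed
  have "\<exists>lam \<mu>. grad f x + (\<Sum>c\<in>I. lam c *\<^sub>R DG c x) + (\<Sum>j<p. \<mu> j *\<^sub>R grad (h j) x) = 0 \<and>
      (\<forall>c\<in>I. lam c \<ge> 0 \<and> lam c * G c x = 0)"
  proof (rule KKT_of_local_min[where F = f and H = h and DF = "grad f" and DH = "\<lambda>j. grad (h j)" and \<rho> = \<delta>])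
    show "GDERIV f z :> grad f z" for z
      using C(1) by (auto simp: cont_diff_def intro: GDERIV_grad)
    show "continuous_on UNIV (grad f)" using C(1) by (simp add: cont_diff_def)
    show "GDERIV (h j) z :> grad (h j) z" "continuous_on UNIV (grad (h j))" if "j \<in> {..<p}" for j z
      using C(3) that by (auto simp: cont_diff_def intro: GDERIV_grad)
    show "GDERIV (G c) z :> DG c z" if "c \<in> I" for c z
      unfolding G_def DG_def using that I GDERIV_nlp_G[OF C(2)] by (intro GDERIV_compose_Pair) auto
    show "continuous_on UNIV (DG c)" if "c \<in> I" for c
    proof -
      have "continuous_on UNIV (nlp_G_grad g c)" using continuous_nlp_G_grad[OF C(2)] that I by auto
      then have "continuous_on UNIV (\<lambda>z. nlp_G_grad g c (z, 1))"
        by (rule continuous_on_compose2) (auto intro: continuous_intros)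
      then show ?thesis unfolding DG_def by (rule continuous_on_fst)
    qed
    show "x \<in> nlp_feas I G {..<p} h" using feasI mem y by simp
    show "f x \<le> f z" if "z \<in> nlp_feas I G {..<p} h" "dist z x < \<delta>" for z
      using min[of z 1] that feasI by simp
    show "\<not> pos_lin_dependent {c \<in> I. G c x = 0} (\<lambda>c. DG c x) {..<p} (\<lambda>j. grad (h j) x)"
    proof
      assume "pos_lin_dependent {c \<in> I. G c x = 0} (\<lambda>c. DG c x) {..<p} (\<lambda>j. grad (h j) x)"
      then obtain lam \<mu> where lam: "\<forall>c\<in>{c \<in> I. G c x = 0}. lam c \<ge> 0"
        and nz: "(\<exists>c\<in>{c \<in> I. G c x = 0}. lam c \<noteq> 0) \<or> (\<exists>j\<in>{..<p}. \<mu> j \<noteq> 0)"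
        and eq: "(\<Sum>c\<in>{c \<in> I. G c x = 0}. lam c *\<^sub>R DG c x) + (\<Sum>j<p. \<mu> j *\<^sub>R grad (h j) x) = 0"
        unfolding pos_lin_dependent_def by auto
      define \<Lambda> where "\<Lambda> = (\<lambda>c. if c \<in> {c \<in> I. G c x = 0} then lam c else 0)"
      define \<gamma> :: "real^'n" where "\<gamma> = (\<chi> i. \<Lambda> (CProdUp i) - \<Lambda> (CProdLow i))"
      have zero: "(\<Sum>i<m. \<Lambda> (CG i) *\<^sub>R grad (g i) x) + (\<Sum>j<p. \<mu> j *\<^sub>R grad (h j) x) + \<gamma> = 0"
        using eq unfolding extend[OF _ \<Lambda>_def, simplified] \<gamma>_def by (simp add: add_ac)
      have CG: "\<forall>i<m. \<Lambda> (CG i) \<ge> 0 \<and> \<Lambda> (CG i) * g i x = 0"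
        using lam by (auto simp: \<Lambda>_def G_def)
      define L M Gs where "L = (\<Sum>i<m. \<Lambda> (CG i))" and "M = (\<Sum>i<p. \<bar>\<mu> i\<bar>)" and "Gs = (\<Sum>i\<in>UNIV. \<bar>\<gamma> $ i\<bar>)"
      have "c * (L + M + Gs) \<le> 0"
        using est[OF CG, of \<mu> \<gamma>] zero by (simp add: L_def M_def Gs_def)
      moreover have nn: "L \<ge> 0" "M \<ge> 0" "Gs \<ge> 0"
        using CG by (auto simp: L_def M_def Gs_def intro!: sum_nonneg)
      ultimately have "L + M + Gs \<le> 0" using c by (simp add: mult_le_0_iff)
      then have "L = 0" "M = 0" "Gs = 0" using nn by linarith+
      then have L0: "\<And>i. i < m \<Longrightarrow> \<Lambda> (CG i) = 0" and M0: "\<And>i. i < p \<Longrightarrow> \<mu> i = 0" and \<gamma>0: "\<And>i. \<gamma> $ i = 0"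
        using CG unfolding L_def M_def Gs_def by (subst (asm) sum_nonneg_eq_0_iff; auto)+
      have uv: "\<Lambda> (CProdUp i) = 0 \<and> \<Lambda> (CProdLow i) = 0" for i
      proof -
        have "\<Lambda> (CProdUp i) = 0 \<or> x $ i = t" "\<Lambda> (CProdLow i) = 0 \<or> x $ i = - t"
          by (auto simp: \<Lambda>_def G_def)
        then show ?thesis using \<gamma>0[of i] t by (auto simp: \<gamma>_def)
      qed
      have "\<Lambda> c = 0" if "c \<in> I" for c using that L0 uv by (auto simp: I_def)
      then have "lam c = 0" if "c \<in> {c \<in> I. G c x = 0}" for c using that by (force simp: \<Lambda>_def)
      with nz M0 show False by auto
    qed
  qed (use I \<delta> in auto)
  then obtain lam \<mu> where eq: "grad f x + (\<Sum>c\<in>I. lam c *\<^sub>R DG c x) + (\<Sum>j<p. \<mu> j *\<^sub>R grad (h j) x) = 0"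
    and lam: "\<And>c. c \<in> I \<Longrightarrow> lam c \<ge> 0 \<and> lam c * G c x = 0" by blast
  define \<Lambda>0 where "\<Lambda>0 = (\<lambda>c. if c \<in> I then lam c else 0)"
  have eq0: "grad f x + ((\<Sum>i<m. \<Lambda>0 (CG i) *\<^sub>R grad (g i) x) + (\<chi> i. \<Lambda>0 (CProdUp i) - \<Lambda>0 (CProdLow i)))
     + (\<Sum>j<p. \<mu> j *\<^sub>R grad (h j) x) = 0"
    using eq unfolding extend[OF subset_refl \<Lambda>0_def] .
  \<comment> \<open>The \<open>y\<close>-part reads \<open>- \<sigma> + \<beta>\<^sub>i + v i = 0\<close>. All \<open>v i\<close> are nonnegative, so their sum is large enough as \<open>\<sigma>\<close>
      to make every \<open>\<beta>\<^sub>i = \<sigma> - v i\<close> nonnegative.\<close>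
  define v where "v i = (\<Lambda>0 (CProdUp i) - \<Lambda>0 (CProdLow i)) * x $ i" for i
  have v: "v i \<ge> 0" for i
  proof -
    have "\<Lambda>0 (CProdUp i) \<ge> 0 \<and> \<Lambda>0 (CProdUp i) * (x $ i - t) = 0"
      "\<Lambda>0 (CProdLow i) \<ge> 0 \<and> \<Lambda>0 (CProdLow i) * (- t - x $ i) = 0"
      using lam[OF memI(1)[of i]] lam[OF memI(2)[of i]] by (auto simp: \<Lambda>0_def G_def memI)
    then have "v i = (\<Lambda>0 (CProdUp i) + \<Lambda>0 (CProdLow i)) * t" "\<Lambda>0 (CProdUp i) + \<Lambda>0 (CProdLow i) \<ge> 0"
      unfolding v_def by (auto simp: algebra_simps)
    then show ?thesis using t by simp
  qed
  define \<Lambda> where "\<Lambda> c = (case c of CSum \<Rightarrow> (\<Sum>i\<in>UNIV. v i) | CLow i \<Rightarrow> 0 | CUp i \<Rightarrow> (\<Sum>i\<in>UNIV. v i) - v i | _ \<Rightarrow> \<Lambda>0 c)" for c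
  have "(grad f x, 0) + (\<Sum>c\<in>nlp_I m. \<Lambda> c *\<^sub>R nlp_G_grad g c (x, y)) + (\<Sum>j<p. \<mu> j *\<^sub>R (grad (h j) x, 0)) = 0"
    unfolding sum_nlp_G_grad sum_scaleR_Pair_zero y using eq0
    by (simp add: \<Lambda>_def zero_prod_def v_def vec_eq_iff)
  moreover have "\<Lambda> c \<ge> 0 \<and> \<Lambda> c * nlp_G g 0 t c (x, y) = 0" if c: "c \<in> nlp_I m" for c
  proof (cases c)
    case (CG i)
    then have "c \<in> I" using c by (auto simp: nlp_I_def memI)
    then show ?thesis using lam[of c] CG by (simp add: \<Lambda>_def \<Lambda>0_def G_def)
  next
    case (CProdUp i)
    then show ?thesis using lam[of c] by (simp add: \<Lambda>_def \<Lambda>0_def G_def y memI)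
  next
    case (CProdLow i)
    then show ?thesis using lam[of c] by (simp add: \<Lambda>_def \<Lambda>0_def G_def y memI)
  next
    case (CUp i)
    then show ?thesis using member_le_sum[of i UNIV v] v by (simp add: \<Lambda>_def y)
  qed (use v in \<open>auto simp: \<Lambda>_def y sum_nonneg\<close>)
  ultimately show ?thesis unfolding NLP_KKT_iff[OF C] using mem by blast
qed

section \<open>Second-order sufficiency and isolated stationary points\<close>

lemma support_stable:
  fixes xs :: "real^'n"
  obtains e where "e > 0" "\<And>x. dist x xs < e \<Longrightarrow> I_0 x \<subseteq> I_0 xs"
proof -
  define a where "a = Min (insert 1 ((\<lambda>i. \<bar>xs $ i\<bar>) ` (- I_0 xs)))"
  have a: "a > 0" unfolding a_def by (subst Min_gr_iff) (auto simp: I_0_def)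
  have "i \<in> I_0 xs" if "dist x xs < a" "i \<in> I_0 x" for x i
  proof (rule ccontr)
    assume "i \<notin> I_0 xs"
    then have "a \<le> \<bar>xs $ i\<bar>" unfolding a_def by (intro Min_le) auto
    moreover have "\<bar>x $ i - xs $ i\<bar> < a"
      using component_le_norm_cart[of "x - xs" i] that(1) by (simp add: dist_norm)
    ultimately show False using that(2) by (simp add: I_0_def)
  qed
  then show thesis using that[OF a] by blast
qed

lemma has_derivative_directional_limit:
  fixes F :: "'a::real_normed_vector \<Rightarrow> 'b::real_normed_vector"
  assumes D: "(F has_derivative D) (at a)" and x: "x \<longlonglongrightarrow> a" "\<And>k. x k \<noteq> a"
    and d: "(\<lambda>k. (x k - a) /\<^sub>R norm (x k - a)) \<longlonglongrightarrow> d"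
  shows "(\<lambda>k. (F (x k) - F a) /\<^sub>R norm (x k - a)) \<longlonglongrightarrow> D d"
proof -
  have bl: "bounded_linear D" and rem: "((\<lambda>y. norm (F y - F a - D (y - a)) / norm (y - a)) \<longlongrightarrow> 0) (at a)"
    using D unfolding has_derivative_iff_norm by auto
  have "filterlim x (at a) sequentially"
    using x by (auto simp: filterlim_at)
  from filterlim_compose[OF rem this]
  have "(\<lambda>k. norm (F (x k) - F a - D (x k - a)) / norm (x k - a)) \<longlonglongrightarrow> 0" .
  then have "(\<lambda>k. (F (x k) - F a - D (x k - a)) /\<^sub>R norm (x k - a)) \<longlonglongrightarrow> 0"
    by (subst tendsto_norm_zero_iff[symmetric]) (simp add: divide_inverse mult.commute)
  moreover have "(\<lambda>k. D ((x k - a) /\<^sub>R norm (x k - a))) \<longlonglongrightarrow> D d"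
    by (rule bounded_linear.tendsto[OF bl d])
  ultimately have "(\<lambda>k. (F (x k) - F a - D (x k - a)) /\<^sub>R norm (x k - a) + D ((x k - a) /\<^sub>R norm (x k - a))) \<longlonglongrightarrow> 0 + D d"
    by (rule tendsto_add)
  moreover have "(F (x k) - F a - D (x k - a)) /\<^sub>R norm (x k - a) + D ((x k - a) /\<^sub>R norm (x k - a))
      = (F (x k) - F a) /\<^sub>R norm (x k - a)" for k
    unfolding linear_cmul[OF bounded_linear.linear[OF bl]] scaleR_add_right[symmetric] by simp
  ultimately show ?thesis by simp
qed

lemma second_order_remainder:
  fixes F :: "real^'n \<Rightarrow> real"
  assumes "twice_cont_diff F"
  obtains B e where "e > 0"
    "\<And>x. dist x a < e \<Longrightarrow> \<bar>F x - F a - grad F a \<bullet> (x - a)\<bar> \<le> B * (norm (x - a))\<^sup>2"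
proof -
  have G: "GDERIV F z :> grad F z" for z
    using assms by (auto simp: twice_cont_diff_def cont_diff_def intro: GDERIV_grad)
  obtain D where D: "(grad F has_derivative D) (at a)"
    using assms unfolding twice_cont_diff_def differentiable_def by blast
  then have bl: "bounded_linear D" by (rule has_derivative_bounded_linear)
  obtain e where e: "e > 0" "\<And>y. norm (y - a) < e \<Longrightarrow> norm (grad F y - grad F a - D (y - a)) \<le> 1 * norm (y - a)"
    using D unfolding has_derivative_at_alt by (metis zero_less_one)
  obtain K where K: "K \<ge> 0" "\<And>v. norm (D v) \<le> norm v * K"
    using bounded_linear.nonneg_bounded[OF bl] by blast
  have lip: "norm (grad F y - grad F a) \<le> (K + 1) * norm (y - a)" if "norm (y - a) < e" for y
    using e(2)[OF that] K(2)[of "y - a"] norm_triangle_sub[of "grad F y - grad F a" "D (y - a)"]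
    by (simp add: algebra_simps)
  have "\<bar>F x - F a - grad F a \<bullet> (x - a)\<bar> \<le> (K + 1) * (norm (x - a))\<^sup>2" if x: "dist x a < e" for x
  proof -
    let ?S = "cball a (dist x a)"
    have "norm ((F x - grad F a \<bullet> x) - (F a - grad F a \<bullet> a)) \<le> ((K + 1) * dist x a) * norm (x - a)"
    proof (rule differentiable_bound[of ?S "\<lambda>z. F z - grad F a \<bullet> z" "\<lambda>z h. h \<bullet> (grad F z - grad F a)"])
      show "convex ?S" by (rule convex_cball)
      fix z assume z: "z \<in> ?S"
      have "((\<lambda>z. F z - grad F a \<bullet> z) has_derivative (\<lambda>h. h \<bullet> grad F z - grad F a \<bullet> h)) (at z)"
        using G[of z] unfolding gderiv_def
        by (intro has_derivative_diff has_derivative_inner_right has_derivative_ident)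
      then show "((\<lambda>z. F z - grad F a \<bullet> z) has_derivative (\<lambda>h. h \<bullet> (grad F z - grad F a))) (at z within ?S)"
        unfolding inner_diff_right inner_commute[of "grad F a"] by (rule has_derivative_at_withinI)
      have le: "norm (grad F z - grad F a) \<le> (K + 1) * dist x a"
      proof -
        have "norm (z - a) \<le> dist x a" using z by (simp add: dist_norm norm_minus_commute)
        then have "norm (z - a) < e" "(K + 1) * norm (z - a) \<le> (K + 1) * dist x a"
          using x K(1) by (auto intro: mult_left_mono)
        then show ?thesis using lip[of z] by linarith
      qed
      show "onorm (\<lambda>h. h \<bullet> (grad F z - grad F a)) \<le> (K + 1) * dist x a"
      proof (rule onorm_le)
        fix h
        have "norm (h \<bullet> (grad F z - grad F a)) \<le> norm h * norm (grad F z - grad F a)"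
          by (simp add: Cauchy_Schwarz_ineq2)
        also have "\<dots> \<le> norm h * ((K + 1) * dist x a)" using le by (intro mult_left_mono) auto
        finally show "norm (h \<bullet> (grad F z - grad F a)) \<le> (K + 1) * dist x a * norm h"
          by (simp add: mult_ac)
      qed
    qed (auto simp: dist_commute)
    then show ?thesis by (simp add: dist_norm power2_eq_square inner_diff_right algebra_simps)
  qed
  then show thesis using that[of e "K + 1"] e(1) by auto
qed

lemma sum_matrix_vector_mult: "(\<Sum>i\<in>A. M i) *v x = (\<Sum>i\<in>A. M i *v (x :: real^'n))"
  by (induction A rule: infinite_finite_induct) (auto simp: matrix_vector_mult_add_rdistrib)

lemma lagr_hessian_mult:
  "lagr_hessian f g m h p x lam \<mu> *v d =
     hessian f x *v d + (\<Sum>i<m. lam i *\<^sub>R (hessian (g i) x *v d)) + (\<Sum>i<p. \<mu> i *\<^sub>R (hessian (h i) x *v d))"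
  by (simp add: lagr_hessian_def matrix_vector_mult_add_rdistrib sum_matrix_vector_mult scaleR_matrix_vector_assoc)

lemma S_stationary_multipliers:
  assumes "S_stationary f g m h p \<kappa> x y"
  shows "x \<in> feas_P g m h p \<kappa>"
    and "\<exists>lam \<mu> \<gamma>. lagr_grad f g m h p x lam \<mu> \<gamma> = 0 \<and>
      (\<forall>i<m. lam i \<ge> 0 \<and> lam i * g i x = 0) \<and> (\<forall>i. x $ i \<noteq> 0 \<longrightarrow> \<gamma> $ i = 0)"
proof -
  have mem: "(x, y) \<in> feas_R g m h p \<kappa>" using assms by (simp add: S_stationary_def)
  then show "x \<in> feas_P g m h p \<kappa>" by (rule feas_R_imp_feas_P)
  obtain lam \<mu> \<gamma> where M: "M_multiplier f g m h p x y lam \<mu> \<gamma>"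
    using assms unfolding S_stationary_def S_multiplier_def by blast
  have "y $ i = 0" if "x $ i \<noteq> 0" for i using mem that by (auto simp: feas_R_def)
  then have "\<forall>i. x $ i \<noteq> 0 \<longrightarrow> \<gamma> $ i = 0" using M by (auto simp: M_multiplier_def I_pm0_def)
  moreover have "(\<Sum>i\<in>UNIV. \<gamma> $ i *\<^sub>R axis i 1) = \<gamma>" by (simp add: sum_axis vec_eq_iff)
  ultimately show "\<exists>lam \<mu> \<gamma>. lagr_grad f g m h p x lam \<mu> \<gamma> = 0 \<and>
      (\<forall>i<m. lam i \<ge> 0 \<and> lam i * g i x = 0) \<and> (\<forall>i. x $ i \<noteq> 0 \<longrightarrow> \<gamma> $ i = 0)"
    using M unfolding M_multiplier_def
    by (intro exI[of _ lam] exI[of _ \<mu>] exI[of _ \<gamma>]) simp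
qed

text \<open>The heart of the isolation argument. Critical: \<open>d\<close> inherits the linearized constraints. Those with
  nonzero limit multiplier are active along the sequence and therefore linearize to equations, so
  stationarity of \<open>xs\<close> gives \<open>\<nabla>f(xs) \<bullet> d = 0\<close>. Curvature: subtracting the stationarity conditions at \<open>x k\<close> and at \<open>xs\<close> expresses
  \<open>d\<^sup>T \<nabla>\<^sup>2L d\<close> as a limit of \<open>- (\<lambda>\<^sup>k - \<lambda>) \<bullet> \<nabla>g(xs) (x k - xs) / \<parallel>x k - xs\<parallel>\<^sup>2\<close> and similar terms. Up to a
  second-order remainder, which stays bounded after division and is multiplied by \<open>\<lambda>\<^sup>k - \<lambda>\<close>, the linear term is
  \<open>g(x k) - g(xs)\<close>, and \<open>(\<lambda>\<^sup>k - \<lambda>) \<bullet> (g(x k) - g(xs)) \<ge> 0\<close> by complementarity.\<close>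

lemma limit_critical_direction:
  fixes xs :: "real^'n" and x :: "nat \<Rightarrow> real^'n"
  assumes C2: "twice_cont_diff f" "\<forall>i<m. twice_cont_diff (g i)" "\<forall>i<p. twice_cont_diff (h i)"
    and xs: "xs \<in> feas_P g m h p \<kappa>"
    and x: "x \<longlonglongrightarrow> xs" "\<And>k. x k \<noteq> xs" "\<And>k. x k \<in> feas_P g m h p \<kappa>" "\<And>k. I_0 (x k) \<subseteq> I_0 xs"
    and d: "(\<lambda>k. (x k - xs) /\<^sub>R norm (x k - xs)) \<longlonglongrightarrow> d"
    and stat: "\<And>k. lagr_grad f g m h p (x k) (lam k) (\<mu> k) (\<gamma> k) = 0"
    and lam: "\<And>k i. i < m \<Longrightarrow> lam k i \<ge> 0 \<and> lam k i * g i (x k) = 0"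
    and \<gamma>: "\<And>k i. x k $ i \<noteq> 0 \<Longrightarrow> \<gamma> k $ i = 0"
    and l: "\<And>i. i < m \<Longrightarrow> (\<lambda>k. lam k i) \<longlonglongrightarrow> l i"
    and u: "\<And>i. i < p \<Longrightarrow> (\<lambda>k. \<mu> k i) \<longlonglongrightarrow> u i" and w: "\<gamma> \<longlonglongrightarrow> w"
  shows "M_multiplier_at f g m h p \<kappa> xs l u w" and "d \<in> crit_cone_X f g m h p \<kappa> xs"
    and "d \<bullet> (lagr_hessian f g m h p xs l u *v d) \<le> 0"
proof -
  define n where "n k = norm (x k - xs)" for k
  have n: "n k > 0" for k using x(2) by (simp add: n_def)
  have C: "cont_diff f" "\<forall>i<m. cont_diff (g i)" "\<forall>i<p. cont_diff (h i)"
    using C2 by (auto simp: twice_cont_diff_def)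
  have first: "(\<lambda>k. (F (x k) - F xs) / n k) \<longlonglongrightarrow> grad F xs \<bullet> d" if "cont_diff F" for F
  proof -
    have "(F has_derivative (\<lambda>v. v \<bullet> grad F xs)) (at xs)"
      using GDERIV_grad[of F xs] that by (simp add: cont_diff_def gderiv_def)
    from has_derivative_directional_limit[OF this x(1,2) d] show ?thesis
      by (simp add: n_def inner_commute divide_inverse mult.commute)
  qed
  have second: "(\<lambda>k. (grad F (x k) - grad F xs) /\<^sub>R n k) \<longlonglongrightarrow> hessian F xs *v d" if "twice_cont_diff F" for F
  proof -
    have "(grad F has_derivative (\<lambda>v. hessian F xs *v v)) (at xs)"
      using that unfolding twice_cont_diff_def hessian_def jacobian_works[symmetric] by blast
    from has_derivative_directional_limit[OF this x(1,2) d] show ?thesis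
      by (simp add: n_def)
  qed
  have gx: "g i (x k) \<le> 0" "g i xs \<le> 0" if "i < m" for i k using x(3)[of k] xs that by (auto simp: feas_P_def)
  have hx: "h i (x k) = 0" "h i xs = 0" if "i < p" for i k using x(3)[of k] xs that by (auto simp: feas_P_def)
  have stat0: "lagr_grad f g m h p xs l u w = 0"
  proof -
    have "(\<lambda>k. lagr_grad f g m h p (x k) (lam k) (\<mu> k) (\<gamma> k))
      \<longlonglongrightarrow> lagr_grad f g m h p xs l u w"
      using C by (intro tendsto_add w tendsto_sum tendsto_scaleR l u
        isCont_tendsto_compose[OF cont_diff_isCont_grad x(1)]) auto
    then show ?thesis by (simp add: stat LIMSEQ_const_iff)
  qed
  have lnn: "l i \<ge> 0" if i: "i < m" for i
    using l[OF i] by (rule LIMSEQ_le_const) (use lam[OF i] in auto)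
  have lg: "l i * g i xs = 0" if i: "i < m" for i
  proof -
    have "(\<lambda>k. lam k i * g i (x k)) \<longlonglongrightarrow> l i * g i xs"
      using C(2) i by (intro tendsto_mult l isCont_tendsto_compose[OF cont_diff_isCont x(1)]) auto
    then show ?thesis using lam[OF i] by (simp add: LIMSEQ_const_iff)
  qed
  have xc: "(\<lambda>k. x k $ i) \<longlonglongrightarrow> xs $ i" and wc: "(\<lambda>k. \<gamma> k $ i) \<longlonglongrightarrow> w $ i"
    and dc: "(\<lambda>k. (x k $ i - xs $ i) / n k) \<longlonglongrightarrow> d $ i" for i
    using tendsto_vec_nth[OF x(1)] tendsto_vec_nth[OF w] tendsto_vec_nth[OF d, of i]
    by (simp_all add: n_def divide_inverse mult.commute)
  have wx: "\<forall>\<^sub>F k in sequentially. w $ i \<noteq> 0 \<longrightarrow> x k $ i = 0 \<and> xs $ i = 0" for i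
  proof (cases "w $ i = 0")
    case False
    with wc have "\<forall>\<^sub>F k in sequentially. \<gamma> k $ i \<noteq> 0" by (rule tendsto_imp_eventually_ne)
    then show ?thesis
    proof eventually_elim
      case (elim k)
      then have "i \<in> I_0 (x k)" using \<gamma> by (auto simp: I_0_def)
      then show ?case using x(4)[of k] by (auto simp: I_0_def)
    qed
  qed simp
  have w0: "w $ i = 0" if "xs $ i \<noteq> 0" for i
    using eventually_happens[OF wx[of i]] that by auto
  have wd: "w $ i * d $ i = 0" for i
  proof (cases "w $ i = 0")
    case False
    with wx[of i] have "\<forall>\<^sub>F k in sequentially. (x k $ i - xs $ i) / n k = 0" by (auto elim: eventually_mono)
    then have "(\<lambda>k. (x k $ i - xs $ i) / n k) \<longlonglongrightarrow> 0" by (rule tendsto_eventually)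
    with dc have "d $ i = 0" using LIMSEQ_unique by blast
    then show ?thesis by simp
  qed simp
  have supp: "xs \<in> feas_P g m h p \<kappa>" "norm0 xs \<le> \<kappa>" using xs by (auto simp: feas_P_def)
  have "(xs, \<chi> i. if xs $ i = 0 then 1 else 0) \<in> feas_R g m h p \<kappa>"
    by (rule feas_R_indicator[OF supp]) simp
  moreover have "(\<Sum>i\<in>UNIV. w $ i *\<^sub>R axis i 1) = w" by (simp add: sum_axis vec_eq_iff)
  ultimately show "M_multiplier_at f g m h p \<kappa> xs l u w"
    unfolding M_multiplier_at_def M_multiplier_def using stat0 lnn lg w0
    by (intro exI[of _ "\<chi> i. if xs $ i = 0 then 1 else 0"]) (auto simp: I_pm0_def)
  have gd: "grad (g i) xs \<bullet> d \<le> 0" if "i < m" "g i xs = 0" for i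
    using first[of "g i"] C(2) that gx n
    by (intro LIMSEQ_le_const2[of "\<lambda>k. (g i (x k) - g i xs) / n k"]) (auto simp: divide_le_0_iff less_imp_le)
  have hd: "grad (h i) xs \<bullet> d = 0" if "i < p" for i
    using first[of "h i"] C(3) that by (simp add: hx LIMSEQ_const_iff)
  have lgd: "l i * (grad (g i) xs \<bullet> d) = 0" if i: "i < m" for i
  proof (cases "l i = 0")
    case False
    with l[OF i] have "\<forall>\<^sub>F k in sequentially. lam k i \<noteq> 0" by (rule tendsto_imp_eventually_ne)
    then have "\<forall>\<^sub>F k in sequentially. (g i (x k) - g i xs) / n k = 0"
      by eventually_elim (use lam[OF i] lg[OF i] False in auto)
    then have "(\<lambda>k. (g i (x k) - g i xs) / n k) \<longlonglongrightarrow> 0" by (rule tendsto_eventually)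
    with first[of "g i"] C(2) i have "grad (g i) xs \<bullet> d = 0" using LIMSEQ_unique by blast
    then show ?thesis by simp
  qed simp
  have fd: "grad f xs \<bullet> d = 0"
  proof -
    have "0 = (lagr_grad f g m h p xs l u w) \<bullet> d"
      using stat0 by simp
    also have "\<dots> = grad f xs \<bullet> d + (\<Sum>i<m. l i * (grad (g i) xs \<bullet> d)) + (\<Sum>i<p. u i * (grad (h i) xs \<bullet> d)) + w \<bullet> d"
      by (simp add: inner_add_left inner_sum_left)
    also have "w \<bullet> d = 0" unfolding inner_vec_def inner_real_def using wd by (intro sum.neutral) blast
    finally show ?thesis by (simp add: lgd hd)
  qed
  have "\<forall>\<^sub>F k in sequentially. \<forall>i\<in>{i. d $ i \<noteq> 0 \<and> xs $ i = 0}. x k $ i \<noteq> 0"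
  proof (rule eventually_ball_finite)
    show "\<forall>i\<in>{i. d $ i \<noteq> 0 \<and> xs $ i = 0}. \<forall>\<^sub>F k in sequentially. x k $ i \<noteq> 0"
    proof
      fix i assume i: "i \<in> {i. d $ i \<noteq> 0 \<and> xs $ i = 0}"
      then have "\<forall>\<^sub>F k in sequentially. (x k $ i - xs $ i) / n k \<noteq> 0"
        using i by (intro tendsto_imp_eventually_ne[OF dc]) auto
      then show "\<forall>\<^sub>F k in sequentially. x k $ i \<noteq> 0"
        by eventually_elim (use i in auto)
    qed
  qed simp
  then obtain k where k: "\<And>i. d $ i \<noteq> 0 \<Longrightarrow> xs $ i = 0 \<Longrightarrow> x k $ i \<noteq> 0"
    using eventually_happens by force
  \<comment> \<open>The support of \<open>x k\<close> contains those of \<open>xs\<close> and \<open>d\<close>, so the \<open>y\<close> belonging to \<open>x k\<close> certifies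
      that \<open>d\<close> lies in the linearization cone.\<close>
  define y :: "real^'n" where "y = (\<chi> i. if x k $ i = 0 then 1 else 0)"
  have "(xs, y) \<in> feas_R g m h p \<kappa>"
    unfolding y_def using x(3,4)[of k] by (intro feas_R_indicator[OF supp(1)]) (auto simp: feas_P_def)
  moreover have "(d, 0) \<in> lin_cone_CC g m h p \<kappa> xs y"
    unfolding lin_cone_CC_def using gd hd k
    by (auto simp: I_g_def I_01_def I_0p_def y_def split: if_splits)
  ultimately show "d \<in> crit_cone_X f g m h p \<kappa> xs"
    using fd unfolding crit_cone_X_def lin_cone_X_def by auto
  define A where "A k = (grad f (x k) - grad f xs) /\<^sub>R n k
      + (\<Sum>i<m. lam k i *\<^sub>R ((grad (g i) (x k) - grad (g i) xs) /\<^sub>R n k))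
      + (\<Sum>i<p. \<mu> k i *\<^sub>R ((grad (h i) (x k) - grad (h i) xs) /\<^sub>R n k))" for k
  have Alim: "A \<longlonglongrightarrow> lagr_hessian f g m h p xs l u *v d"
    unfolding A_def lagr_hessian_mult using C2
    by (intro tendsto_add tendsto_sum tendsto_scaleR l u second) auto
  have qlim: "(\<lambda>k. ((x k - xs) /\<^sub>R n k) \<bullet> A k) \<longlonglongrightarrow> d \<bullet> (lagr_hessian f g m h p xs l u *v d)"
    using d unfolding n_def[symmetric] by (intro tendsto_inner Alim)
  define rem where "rem F B \<longleftrightarrow> (\<forall>\<^sub>F k in sequentially. \<bar>F (x k) - F xs - grad F xs \<bullet> (x k - xs)\<bar> \<le> B * (n k)\<^sup>2)"
    for F B
  have rem: "\<exists>B. rem F B" if F: "twice_cont_diff F" for F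
  proof -
    obtain B e where B: "e > 0"
      "\<And>x. dist x xs < e \<Longrightarrow> \<bar>F x - F xs - grad F xs \<bullet> (x - xs)\<bar> \<le> B * (norm (x - xs))\<^sup>2"
      using second_order_remainder[OF F] by metis
    have "\<forall>\<^sub>F k in sequentially. dist (x k) xs < e" using x(1) B(1) unfolding tendsto_iff by blast
    then have "rem F B"
      unfolding rem_def by eventually_elim (simp add: B(2) n_def)
    then show ?thesis by blast
  qed
  have "\<forall>i. \<exists>B. i < m \<longrightarrow> rem (g i) B" "\<forall>i. \<exists>B. i < p \<longrightarrow> rem (h i) B"
    using rem C2 by blast+
  then obtain Bg Bh where Bg: "\<And>i. i < m \<Longrightarrow> rem (g i) (Bg i)" and Bh: "\<And>i. i < p \<Longrightarrow> rem (h i) (Bh i)"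
    by metis
  have evg: "\<forall>\<^sub>F k in sequentially. \<forall>i\<in>{..<m}. \<bar>g i (x k) - g i xs - grad (g i) xs \<bullet> (x k - xs)\<bar> \<le> Bg i * (n k)\<^sup>2"
    using Bg unfolding rem_def by (intro eventually_ball_finite) auto
  have evh: "\<forall>\<^sub>F k in sequentially. \<forall>i\<in>{..<p}. \<bar>h i (x k) - h i xs - grad (h i) xs \<bullet> (x k - xs)\<bar> \<le> Bh i * (n k)\<^sup>2"
    using Bh unfolding rem_def by (intro eventually_ball_finite) auto
  have evw: "\<forall>\<^sub>F k in sequentially. \<forall>i\<in>UNIV. w $ i \<noteq> 0 \<longrightarrow> x k $ i = 0 \<and> xs $ i = 0"
    using wx by (intro eventually_ball_finite) auto
  have "\<forall>\<^sub>F k in sequentially. ((x k - xs) /\<^sub>R n k) \<bullet> A k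
      \<le> (\<Sum>i<m. \<bar>lam k i - l i\<bar> * Bg i) + (\<Sum>i<p. \<bar>\<mu> k i - u i\<bar> * Bh i)"
    using evg evh evw
  proof eventually_elim
    case (elim k)
    let ?v = "x k - xs"
    have "A k = (grad f (x k) - grad f xs + (\<Sum>i<m. lam k i *\<^sub>R (grad (g i) (x k) - grad (g i) xs))
      + (\<Sum>i<p. \<mu> k i *\<^sub>R (grad (h i) (x k) - grad (h i) xs))) /\<^sub>R n k"
      unfolding A_def by (simp add: scaleR_add_right scaleR_sum_right mult.commute)
    then have "n k *\<^sub>R A k = grad f (x k) - grad f xs + (\<Sum>i<m. lam k i *\<^sub>R (grad (g i) (x k) - grad (g i) xs))
      + (\<Sum>i<p. \<mu> k i *\<^sub>R (grad (h i) (x k) - grad (h i) xs))"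
      using n[of k] by simp
    also have "\<dots> = - ((\<Sum>i<m. (lam k i - l i) *\<^sub>R grad (g i) xs) + (\<Sum>i<p. (\<mu> k i - u i) *\<^sub>R grad (h i) xs) + (\<gamma> k - w))"
    proof -
      have fx: "grad f (x k) = - (constraint_comb g m h p (x k) (lam k) (\<mu> k) (\<gamma> k))"
        and f0: "grad f xs = - (constraint_comb g m h p xs l u w)"
        unfolding eq_neg_iff_add_eq_0 using stat[of k] stat0 by (simp_all only: add.assoc)
      show ?thesis unfolding fx f0 by (simp add: scaleR_diff_right scaleR_diff_left sum_subtractf)
    qed
    finally have eqA: "n k *\<^sub>R A k = - ((\<Sum>i<m. (lam k i - l i) *\<^sub>R grad (g i) xs)
        + (\<Sum>i<p. (\<mu> k i - u i) *\<^sub>R grad (h i) xs) + (\<gamma> k - w))" .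
    have comm: "?v \<bullet> grad F xs = grad F xs \<bullet> ?v" for F by (rule inner_commute)
    have "?v \<bullet> (n k *\<^sub>R A k) = - ((\<Sum>i<m. (lam k i - l i) * (grad (g i) xs \<bullet> ?v))
        + (\<Sum>i<p. (\<mu> k i - u i) * (grad (h i) xs \<bullet> ?v)) + ?v \<bullet> (\<gamma> k - w))"
      unfolding eqA by (simp only: inner_minus_right inner_add_right inner_sum_right inner_scaleR_right comm)
    moreover have "?v \<bullet> (\<gamma> k - w) = 0"
    proof -
      have "?v $ i * (\<gamma> k - w) $ i = 0" for i
      proof (cases "x k $ i = 0")
        case True
        then have "xs $ i = 0" using x(4)[of k] by (auto simp: I_0_def)
        with True show ?thesis by simp
      next
        case False
        then have "\<gamma> k $ i = 0" "w $ i = 0" using \<gamma> elim(3) by auto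
        then show ?thesis by simp
      qed
      then show ?thesis unfolding inner_vec_def inner_real_def by (intro sum.neutral) blast
    qed
    moreover have "- (\<bar>lam k i - l i\<bar> * Bg i * (n k)\<^sup>2) \<le> (lam k i - l i) * (grad (g i) xs \<bullet> ?v)" if i: "i < m" for i
    proof -
      define R where "R = g i (x k) - g i xs - grad (g i) xs \<bullet> ?v"
      have R: "\<bar>R\<bar> \<le> Bg i * (n k)\<^sup>2" using elim(1) i by (simp add: R_def)
      have "(lam k i - l i) * (g i (x k) - g i xs) = - (lam k i * g i xs) - l i * g i (x k)"
        using conjunct2[OF lam[OF i, of k]] lg[OF i] unfolding left_diff_distrib right_diff_distrib by linarith
      moreover have "lam k i * g i xs \<le> 0" "l i * g i (x k) \<le> 0"
        using lam[OF i] lnn[OF i] gx[OF i] by (auto intro: mult_nonneg_nonpos)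
      ultimately have "0 \<le> (lam k i - l i) * (g i (x k) - g i xs)" by linarith
      moreover have "(lam k i - l i) * (grad (g i) xs \<bullet> ?v) = (lam k i - l i) * (g i (x k) - g i xs) - (lam k i - l i) * R"
        by (simp add: R_def algebra_simps)
      moreover have "(lam k i - l i) * R \<le> \<bar>lam k i - l i\<bar> * (Bg i * (n k)\<^sup>2)"
        using mult_left_mono[OF R, of "\<bar>lam k i - l i\<bar>"] abs_ge_self[of "(lam k i - l i) * R"]
        by (simp add: abs_mult)
      ultimately show ?thesis by (simp add: mult.assoc)
    qed
    then have "- (\<Sum>i<m. \<bar>lam k i - l i\<bar> * Bg i * (n k)\<^sup>2) \<le> (\<Sum>i<m. (lam k i - l i) * (grad (g i) xs \<bullet> ?v))"
      unfolding sum_negf[symmetric] by (intro sum_mono) auto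
    moreover have "- (\<bar>\<mu> k i - u i\<bar> * Bh i * (n k)\<^sup>2) \<le> (\<mu> k i - u i) * (grad (h i) xs \<bullet> ?v)" if i: "i < p" for i
    proof -
      have "\<bar>grad (h i) xs \<bullet> ?v\<bar> \<le> Bh i * (n k)\<^sup>2" using bspec[OF elim(2), of i] i hx[OF i] by simp
      then have "\<bar>(\<mu> k i - u i) * (grad (h i) xs \<bullet> ?v)\<bar> \<le> \<bar>\<mu> k i - u i\<bar> * (Bh i * (n k)\<^sup>2)"
        unfolding abs_mult by (intro mult_left_mono) auto
      then show ?thesis by (simp add: mult.assoc)
    qed
    then have "- (\<Sum>i<p. \<bar>\<mu> k i - u i\<bar> * Bh i * (n k)\<^sup>2) \<le> (\<Sum>i<p. (\<mu> k i - u i) * (grad (h i) xs \<bullet> ?v))"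
      unfolding sum_negf[symmetric] by (intro sum_mono) auto
    ultimately have "?v \<bullet> (n k *\<^sub>R A k) \<le> ((\<Sum>i<m. \<bar>lam k i - l i\<bar> * Bg i) + (\<Sum>i<p. \<bar>\<mu> k i - u i\<bar> * Bh i)) * (n k)\<^sup>2"
      unfolding distrib_right sum_distrib_right by linarith
    moreover have "?v \<bullet> (n k *\<^sub>R A k) = ((?v /\<^sub>R n k) \<bullet> A k) * (n k)\<^sup>2"
      using n[of k] by (simp add: power2_eq_square del: scaleR_diff_right)
    ultimately have "((?v /\<^sub>R n k) \<bullet> A k) * (n k)\<^sup>2
        \<le> ((\<Sum>i<m. \<bar>lam k i - l i\<bar> * Bg i) + (\<Sum>i<p. \<bar>\<mu> k i - u i\<bar> * Bh i)) * (n k)\<^sup>2"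
      by linarith
    then show ?case
      by (rule mult_right_le_imp_le) (use n[of k] in simp)
  qed
  moreover have "(\<lambda>k. (\<Sum>i<m. \<bar>lam k i - l i\<bar> * Bg i) + (\<Sum>i<p. \<bar>\<mu> k i - u i\<bar> * Bh i))
      \<longlonglongrightarrow> (\<Sum>i<m. \<bar>l i - l i\<bar> * Bg i) + (\<Sum>i<p. \<bar>u i - u i\<bar> * Bh i)"
    by (intro tendsto_add tendsto_sum tendsto_mult tendsto_rabs tendsto_diff l u tendsto_const) auto
  ultimately show "d \<bullet> (lagr_hessian f g m h p xs l u *v d) \<le> 0"
    using tendsto_le[OF sequentially_bot _ qlim] by simp
qed

text \<open>The radius around \<open>xs\<close> is chosen so that CC-MFCQ bounds the multipliers of nearby stationary points and
  their support contains that of \<open>xs\<close>, so that their \<open>\<gamma>\<close> vanishes off the zero set of \<open>xs\<close>.\<close>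

lemma M_stationary_isolated:
  fixes xs :: "real^'n"
  assumes C2: "twice_cont_diff f" "\<forall>i<m. twice_cont_diff (g i)" "\<forall>i<p. twice_cont_diff (h i)"
    and xs: "xs \<in> feas_P g m h p \<kappa>" and mfcq: "CC_MFCQ g m h p xs"
    and sosc: "\<forall>dx \<in> crit_cone_X f g m h p \<kappa> xs. dx \<noteq> 0 \<longrightarrow>
      (\<forall>lam \<mu> \<gamma>. M_multiplier_at f g m h p \<kappa> xs lam \<mu> \<gamma> \<longrightarrow>
         dx \<bullet> (lagr_hessian f g m h p xs lam \<mu> *v dx) > 0)"
  obtains e where "e > 0" "\<And>x y. dist x xs < e \<Longrightarrow> S_stationary f g m h p \<kappa> x y \<Longrightarrow> x = xs"
proof -
  have C: "cont_diff f" "\<forall>i<m. cont_diff (g i)" "\<forall>i<p. cont_diff (h i)"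
    using C2 by (auto simp: twice_cont_diff_def)
  obtain c e1 where c: "c > 0" "e1 > 0" and est: "\<And>x lam \<mu> \<gamma>. dist x xs < e1 \<Longrightarrow>
      (\<forall>i<m. lam i \<ge> 0 \<and> lam i * g i x = 0) \<Longrightarrow>
      c * ((\<Sum>i<m. lam i) + (\<Sum>i<p. \<bar>\<mu> i\<bar>) + (\<Sum>i\<in>I_0 xs. \<bar>\<gamma> $ i\<bar>))
        \<le> norm (constraint_comb g m h p x lam \<mu> \<gamma>)
          + (\<Sum>i\<in>- I_0 xs. \<bar>\<gamma> $ i\<bar>)"
    using CC_MFCQ_estimate[OF C(2,3) mfcq] by blast
  obtain e2 where e2: "e2 > 0" "\<And>x. dist x xs < e2 \<Longrightarrow> I_0 x \<subseteq> I_0 xs"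
    using support_stable by blast
  have "\<exists>e>0. \<forall>x y. dist x xs < e \<longrightarrow> S_stationary f g m h p \<kappa> x y \<longrightarrow> x = xs"
  proof (rule ccontr)
    assume neg: "\<not> ?thesis"
    define e where "e k = min (min e1 e2) (inverse (real (Suc k)))" for k
    have epos: "e k > 0" for k using c(2) e2(1) by (simp add: e_def)
    have "\<exists>x y. dist x xs < e k \<and> S_stationary f g m h p \<kappa> x y \<and> x \<noteq> xs" for k
      using neg epos[of k] by blast
    then obtain x y where near: "\<And>k. dist (x k) xs < e k" and S: "\<And>k. S_stationary f g m h p \<kappa> (x k) (y k)"
      and ne: "\<And>k. x k \<noteq> xs" by metis
    have near': "dist (x k) xs < e1" "dist (x k) xs < e2" "dist (x k) xs < inverse (real (Suc k))" for k
      using near[of k] by (auto simp: e_def)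
    have "(\<lambda>k. dist (x k) xs) \<longlonglongrightarrow> 0"
      by (rule tendsto_sandwich[OF _ _ tendsto_const LIMSEQ_inverse_real_of_nat])
         (use near'(3) in \<open>auto intro!: always_eventually less_imp_le simp del: of_nat_Suc\<close>)
    then have xl: "x \<longlonglongrightarrow> xs" using tendsto_dist_iff by blast
    have feas: "x k \<in> feas_P g m h p \<kappa>" for k by (rule S_stationary_multipliers(1)[OF S])
    have supp: "I_0 (x k) \<subseteq> I_0 xs" for k by (rule e2(2)[OF near'(2)])
    define mult where "mult k lam \<mu> \<gamma> \<longleftrightarrow>
      lagr_grad f g m h p (x k) lam \<mu> \<gamma> = 0 \<and>
      (\<forall>i<m. lam i \<ge> 0 \<and> lam i * g i (x k) = 0) \<and> (\<forall>i. x k $ i \<noteq> 0 \<longrightarrow> \<gamma> $ i = 0)" for k lam \<mu> \<gamma>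
    have "\<forall>k. \<exists>lam \<mu> \<gamma>. mult k lam \<mu> \<gamma>"
      unfolding mult_def using S_stationary_multipliers(2)[OF S] by blast
    then obtain lam \<mu> \<gamma> where mult: "\<And>k. mult k (lam k) (\<mu> k) (\<gamma> k)" by metis
    have stat: "lagr_grad f g m h p (x k) (lam k) (\<mu> k) (\<gamma> k) = 0"
      and lam: "\<forall>i<m. lam k i \<ge> 0 \<and> lam k i * g i (x k) = 0"
      and \<gamma>: "\<forall>i. x k $ i \<noteq> 0 \<longrightarrow> \<gamma> k $ i = 0" for k
      using mult[of k] unfolding mult_def by blast+
    have "(\<lambda>k. grad f (x k)) \<longlonglongrightarrow> grad f xs"
      by (rule isCont_tendsto_compose[OF cont_diff_isCont_grad[OF C(1)] xl])
    then obtain M where M: "\<And>k. norm (grad f (x k)) \<le> M"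
      using convergent_imp_Bseq[of "\<lambda>k. grad f (x k)"] unfolding convergent_def Bseq_def by blast
    have bound: "mult_size m p (lam k) (\<mu> k) (\<gamma> k) \<le> M / c" for k
    proof -
      have zero: "(\<Sum>i\<in>- I_0 xs. \<bar>\<gamma> k $ i\<bar>) = 0"
        using \<gamma>[of k] supp[of k] by (intro sum.neutral) (auto simp: I_0_def)
      have "constraint_comb g m h p (x k) (lam k) (\<mu> k) (\<gamma> k) = - grad f (x k)"
        using stat[of k] by (simp add: add_eq_0_iff add.assoc)
      then have "c * ((\<Sum>i<m. lam k i) + (\<Sum>i<p. \<bar>\<mu> k i\<bar>) + (\<Sum>i\<in>I_0 xs. \<bar>\<gamma> k $ i\<bar>)) \<le> M"
        using est[OF near'(1) lam, of k "\<mu> k" "\<gamma> k"] M[of k] zero by simp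
      then show ?thesis unfolding sum_split_I_0[of _ xs] zero using c by (simp add: field_simps)
    qed
    obtain s l u w where s: "strict_mono (s :: nat \<Rightarrow> nat)" and l: "\<And>i. i < m \<Longrightarrow> (\<lambda>k. lam (s k) i) \<longlonglongrightarrow> l i"
      and u: "\<And>i. i < p \<Longrightarrow> (\<lambda>k. \<mu> (s k) i) \<longlonglongrightarrow> u i" and w: "(\<lambda>k. \<gamma> (s k)) \<longlonglongrightarrow> w"
      using multipliers_convergent_subseq[of m lam \<mu> p \<gamma>, OF _ bound] lam by blast
    define v where "v k = (x (s k) - xs) /\<^sub>R norm (x (s k) - xs)" for k
    have nv: "norm (v k) = 1" for k using ne by (simp add: v_def)
    then have "\<forall>k. v k \<in> sphere 0 1" by simp
    then obtain d q where q: "strict_mono (q :: nat \<Rightarrow> nat)" and d: "(v \<circ> q) \<longlonglongrightarrow> d"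
      using compact_sphere[of 0 1] unfolding compact_def by meson
    have dv: "(\<lambda>k. (x (s (q k)) - xs) /\<^sub>R norm (x (s (q k)) - xs)) \<longlonglongrightarrow> d"
      using d by (simp add: o_def v_def)
    have "(\<lambda>k. norm (v (q k))) \<longlonglongrightarrow> norm d"
      using tendsto_norm[OF d] by (simp add: o_def)
    then have "norm d = 1" by (simp add: nv LIMSEQ_const_iff)
    then have d0: "d \<noteq> 0" by auto
    have xsq: "(\<lambda>k. x (s (q k))) \<longlonglongrightarrow> xs"
      using LIMSEQ_subseq_LIMSEQ[OF LIMSEQ_subseq_LIMSEQ[OF xl s] q] by (simp add: o_def)
    have lq: "(\<lambda>k. lam (s (q k)) i) \<longlonglongrightarrow> l i" if "i < m" for i
      using LIMSEQ_subseq_LIMSEQ[OF l[OF that] q] by (simp add: o_def)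
    have uq: "(\<lambda>k. \<mu> (s (q k)) i) \<longlonglongrightarrow> u i" if "i < p" for i
      using LIMSEQ_subseq_LIMSEQ[OF u[OF that] q] by (simp add: o_def)
    have wq: "(\<lambda>k. \<gamma> (s (q k))) \<longlonglongrightarrow> w"
      using LIMSEQ_subseq_LIMSEQ[OF w q] by (simp add: o_def)
    have lam': "\<And>k i. i < m \<Longrightarrow> lam (s (q k)) i \<ge> 0 \<and> lam (s (q k)) i * g i (x (s (q k))) = 0"
      and \<gamma>': "\<And>k i. x (s (q k)) $ i \<noteq> 0 \<Longrightarrow> \<gamma> (s (q k)) $ i = 0"
      using lam \<gamma> by blast+
    note crit = limit_critical_direction[OF C2 xs xsq ne feas supp dv stat lam' \<gamma>' lq uq wq]
    have "d \<bullet> (lagr_hessian f g m h p xs l u *v d) > 0" using sosc crit(1,2) d0 by blast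
    with crit(3) show False by simp
  qed
  then show thesis using that by blast
qed

section \<open>Existence and convergence of KKT points\<close>

lemma strict_local_min_P_ball:
  fixes N :: "real^'n \<Rightarrow> real"
  assumes "is_norm N" "strict_local_min_P N f g m h p \<kappa> xs"
  shows "\<exists>\<rho>>0. \<forall>x\<in>feas_P g m h p \<kappa>. x \<noteq> xs \<longrightarrow> dist x xs < \<rho> \<longrightarrow> f xs < f x"
proof -
  obtain r where r: "r > 0" "\<forall>x \<in> feas_P g m h p \<kappa> \<inter> (nball N xs r - {xs}). f x > f xs"
    using assms(2) unfolding strict_local_min_P_def by blast
  obtain e where "e > 0" "ball xs e \<subseteq> nball N xs r"
    using ball_sub_nball[OF assms(1) r(1)] by blast
  with r(2) show ?thesis by (intro exI[of _ e]) (auto simp: dist_commute subset_eq)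
qed

text \<open>Every \<open>y\<^sub>i\<close> is at most \<open>1\<close> and vanishes off the zero set, which has exactly \<open>n - \<kappa>\<close> elements here, so
  \<open>e\<^sup>Ty \<ge> n - \<kappa>\<close> leaves no freedom.\<close>

lemma feas_R_unique_y:
  fixes xs :: "real^'n"
  assumes "(xs, y) \<in> feas_R g m h p \<kappa>" "norm0 xs = \<kappa>"
  shows "y = (\<chi> i. if xs $ i = 0 then 1 else 0)"
proof -
  have y: "y $ i \<le> 1" "xs $ i * y $ i = 0" for i
    using assms by (auto simp: feas_R_def)
  have "(\<Sum>i\<in>UNIV. y $ i) = (\<Sum>i\<in>I_0 xs. y $ i) + (\<Sum>i\<in>- I_0 xs. y $ i)"
    by (rule sum_split_I_0)
  also have "(\<Sum>i\<in>- I_0 xs. y $ i) = 0"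
    using y(2) by (intro sum.neutral) (auto simp: I_0_def)
  finally have "real (card (I_0 xs)) \<le> (\<Sum>i\<in>I_0 xs. y $ i)"
    using assms card_I_0[of xs] by (simp add: feas_R_def)
  then have "(\<Sum>i\<in>I_0 xs. 1 - y $ i) \<le> 0" by (simp add: sum_subtractf)
  moreover have "(\<Sum>i\<in>I_0 xs. 1 - y $ i) \<ge> 0" using y(1) by (intro sum_nonneg) auto
  ultimately have "(\<Sum>i\<in>I_0 xs. 1 - y $ i) = 0" by linarith
  then have "\<forall>i\<in>I_0 xs. 1 - y $ i = 0" using y(1) by (subst (asm) sum_nonneg_eq_0_iff) auto
  then have "y $ i = (if xs $ i = 0 then 1 else 0)" for i using y(2)[of i] by (auto simp: I_0_def)
  then show ?thesis by (simp add: vec_eq_iff)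
qed

text \<open>If \<open>norm0 xs = \<kappa>\<close>, feasible points near \<open>xs\<close> have the same support as \<open>xs\<close>, because they cannot have a smaller
  one and may not have a larger one. Hence they remain feasible together with the same \<open>ys\<close>.\<close>

lemma strict_local_min_R_ball:
  fixes N2 :: "(real^'n) \<times> (real^'n) \<Rightarrow> real"
  assumes "is_norm N2" "strict_local_min_R N2 f g m h p \<kappa> xs ys" "norm0 xs = \<kappa>"
  shows "\<exists>\<rho>>0. \<forall>x\<in>feas_P g m h p \<kappa>. x \<noteq> xs \<longrightarrow> dist x xs < \<rho> \<longrightarrow> f xs < f x"
proof -
  have mem: "(xs, ys) \<in> feas_R g m h p \<kappa>" using assms(2) by (simp add: strict_local_min_R_def)
  obtain r where r: "r > 0"
    "\<forall>(x, y) \<in> nball N2 (xs, ys) r \<inter> feas_R g m h p \<kappa>. x \<noteq> xs \<longrightarrow> f xs < f x"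
    using assms(2) unfolding strict_local_min_R_def by blast
  obtain e1 where e1: "e1 > 0" "ball (xs, ys) e1 \<subseteq> nball N2 (xs, ys) r"
    using ball_sub_nball[OF assms(1) r(1)] by blast
  obtain e2 where e2: "e2 > 0" "\<And>x. dist x xs < e2 \<Longrightarrow> I_0 x \<subseteq> I_0 xs"
    using support_stable by blast
  have "f xs < f x" if x: "x \<in> feas_P g m h p \<kappa>" "x \<noteq> xs" "dist x xs < min e1 e2" for x
  proof -
    have sub: "I_0 x \<subseteq> I_0 xs" using e2(2) x(3) by simp
    have "norm0 x \<le> \<kappa>" using x(1) by (simp add: feas_P_def)
    then have "card (I_0 xs) \<le> card (I_0 x)" using card_I_0[of x] card_I_0[of xs] assms(3) by linarith
    then have eq: "I_0 x = I_0 xs" using sub card_seteq[of "I_0 xs" "I_0 x"] by simp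
    have "x $ i * ys $ i = 0" for i
    proof (cases "i \<in> I_0 x")
      case False
      then have "xs $ i \<noteq> 0" using eq by (auto simp: I_0_def)
      moreover have "xs $ i * ys $ i = 0" using mem by (auto simp: feas_R_def)
      ultimately show ?thesis by simp
    qed (simp add: I_0_def)
    then have "(x, ys) \<in> feas_R g m h p \<kappa>" using mem x(1) by (auto simp: feas_R_def feas_P_def)
    moreover have "(x, ys) \<in> ball (xs, ys) e1" using x(3) by (simp add: dist_Pair_Pair dist_commute)
    ultimately show ?thesis using r(2) e1(2) x(2) by blast
  qed
  then show ?thesis using e1(1) e2(1) by (intro exI[of _ "min e1 e2"]) auto
qed

lemma regularized_KKT_local_min_exists:
  fixes xs :: "real^'n" and N2 :: "(real^'n) \<times> (real^'n) \<Rightarrow> real"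
  assumes norms: "is_norm N" "is_norm N2"
    and C: "cont_diff f" "\<forall>i<m. cont_diff (g i)" "\<forall>i<p. cont_diff (h i)"
    and xs: "xs \<in> feas_P g m h p \<kappa>" and mfcq: "CC_MFCQ g m h p xs"
    and strict: "\<exists>\<rho>>0. \<forall>x\<in>feas_P g m h p \<kappa>. x \<noteq> xs \<longrightarrow> dist x xs < \<rho> \<longrightarrow> f xs < f x"
    and r: "r > 0"
  shows "\<exists>T>0. \<forall>t. 0 < t \<and> t \<le> T \<longrightarrow>
     (\<exists>x y. NLP_local_min N2 f g m h p \<kappa> t (x, y) \<and> NLP_KKT f g m h p \<kappa> t (x, y) \<and> x \<in> nball N xs r)"
proof -
  have n0: "norm0 xs \<le> \<kappa>" using xs by (simp add: feas_P_def)
  obtain \<rho> where \<rho>: "\<rho> > 0" "\<And>x. x \<in> feas_P g m h p \<kappa> \<Longrightarrow> x \<noteq> xs \<Longrightarrow> dist x xs < \<rho> \<Longrightarrow> f xs < f x"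
    using strict by blast
  obtain e0 where e0: "e0 > 0" "ball xs e0 \<subseteq> nball N xs r" using ball_sub_nball[OF norms(1) r] by blast
  obtain c1 e1 where c1: "c1 > 0" "e1 > 0" and est1: "\<And>t x y lam \<mu> \<sigma> \<gamma>. t > 0 \<Longrightarrow> (x, y) \<in> nlp_set g m h p \<kappa> t \<Longrightarrow> dist x xs < e1 \<Longrightarrow>
      (\<forall>i<m. lam i \<ge> 0 \<and> lam i * g i x = 0) \<Longrightarrow> y_stationary \<kappa> t x y \<sigma> \<gamma> \<Longrightarrow>
      c1 * mult_size m p lam \<mu> \<gamma>
        \<le> norm (constraint_comb g m h p x lam \<mu> \<gamma>)"
    using regularized_multiplier_estimate[OF C(2,3) mfcq n0] by blast
  obtain c2 e2 where c2: "c2 > 0" "e2 > 0" and est2: "\<And>x lam \<mu> \<gamma>. dist x xs < e2 \<Longrightarrow>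
      (\<forall>i<m. lam i \<ge> 0 \<and> lam i * g i x = 0) \<Longrightarrow>
      c2 * ((\<Sum>i<m. lam i) + (\<Sum>i<p. \<bar>\<mu> i\<bar>) + (\<Sum>i\<in>I_0 xs. \<bar>\<gamma> $ i\<bar>))
        \<le> norm (constraint_comb g m h p x lam \<mu> \<gamma>)
          + (\<Sum>i\<in>- I_0 xs. \<bar>\<gamma> $ i\<bar>)"
    using CC_MFCQ_estimate[OF C(2,3) mfcq] by blast
  define e where "e = min (min e0 e1) (min e2 (\<rho> / 2))"
  have e: "0 < e" "e \<le> e0" "e \<le> e1" "e \<le> e2" "e < \<rho>" using e0 c1 c2 \<rho>(1) by (auto simp: e_def)
  obtain T where T: "T > 0" "\<And>t. 0 < t \<Longrightarrow> t \<le> T \<Longrightarrow> (\<exists>x y. (x, y) \<in> nlp_set g m h p \<kappa> t \<and> dist x xs < e \<and>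
    (\<forall>x' y'. (x', y') \<in> nlp_set g m h p \<kappa> t \<longrightarrow> dist x' xs \<le> e \<longrightarrow> f x \<le> f x'))"
    using regularized_minimizer[OF C xs \<rho>(2) e(1,5)] by blast
  have "\<exists>x y. NLP_local_min N2 f g m h p \<kappa> t (x, y) \<and> NLP_KKT f g m h p \<kappa> t (x, y) \<and> x \<in> nball N xs r"
    if t: "0 < t" "t \<le> T" for t
  proof -
    obtain x y where mem: "(x, y) \<in> nlp_set g m h p \<kappa> t" and near: "dist x xs < e"
      and min: "\<And>x' y'. (x', y') \<in> nlp_set g m h p \<kappa> t \<Longrightarrow> dist x' xs \<le> e \<Longrightarrow> f x \<le> f x'"
      using T(2)[OF t] by blast
    define \<delta> where "\<delta> = e - dist x xs"
    have \<delta>: "\<delta> > 0" using near by (simp add: \<delta>_def)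
    have lmin: "f x \<le> f x'" if "(x', y') \<in> nlp_set g m h p \<kappa> t" "dist x' x < \<delta>" for x' y'
      using min[OF that(1)] dist_triangle[of x' xs x] that(2) by (simp add: \<delta>_def)
    obtain \<rho>' where \<rho>': "\<rho>' > 0" "\<And>s. s \<le> \<rho>' \<Longrightarrow> nball N2 (x, y) s \<subseteq> ball (x, y) \<delta>"
      using nball_sub_ball[OF norms(2) \<delta>] by blast
    have "NLP_local_min N2 f g m h p \<kappa> t (x, y)"
      unfolding NLP_local_min_def local_min_on_def
    proof (intro conjI exI[of _ \<rho>'] ballI)
      fix z assume z: "z \<in> nlp_set g m h p \<kappa> t \<inter> nball N2 (x, y) \<rho>'"
      then have "dist z (x, y) < \<delta>" using \<rho>'(2)[of \<rho>'] by (auto simp: dist_commute)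
      then have "dist (fst z) x < \<delta>" using dist_fst_le[of z "(x, y)"] by simp
      then show "f (fst (x, y)) \<le> f (fst z)" using lmin[of "fst z" "snd z"] z by simp
    qed (use mem \<rho>' in auto)
    moreover have "NLP_KKT f g m h p \<kappa> t (x, y)"
    proof (cases "\<kappa> = 0")
      case False
      show ?thesis
        by (rule regularized_local_min_KKT_pos[OF C _ n0 t(1) c1(1) est1[OF t(1) mem] mem \<delta> lmin])
          (use False near e in auto)
    next
      case True
      then have univ: "I_0 xs = UNIV" using n0 by (auto simp: norm0_def I_0_def)
      have est2': "c2 * mult_size m p lam \<mu> \<gamma>
        \<le> norm (constraint_comb g m h p x lam \<mu> \<gamma>)"
        if "\<forall>i<m. lam i \<ge> 0 \<and> lam i * g i x = 0" for lam \<mu> \<gamma>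
        using est2[OF _ that, of \<mu> \<gamma>] near e(4) by (simp add: univ)
      show ?thesis
        unfolding True
      proof (rule regularized_local_min_KKT_zero[OF C t(1) c2(1) _ mem[unfolded True] \<delta>])
        fix lam \<mu> and \<gamma> :: "real^'n" assume "\<forall>i<m. lam i \<ge> 0 \<and> lam i * g i x = 0"
        then show "c2 * mult_size m p lam \<mu> \<gamma>
          \<le> norm (constraint_comb g m h p x lam \<mu> \<gamma>)"
          by (rule est2')
      next
        fix x' y' assume "(x', y') \<in> nlp_set g m h p 0 t" "dist x' x < \<delta>"
        then show "f x \<le> f x'" by (rule lmin[unfolded True])
      qed
    qed
    moreover have "x \<in> nball N xs r" using e0(2) near e(2) by (auto simp: dist_commute)
    ultimately show ?thesis by blast
  qed
  then show ?thesis using T(1) by blast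
qed

lemma KKT_sequence_limit:
  fixes xs :: "real^'n"
  assumes N: "is_norm N" and C: "cont_diff f" "\<forall>i<m. cont_diff (g i)" "\<forall>i<p. cont_diff (h i)"
    and n0: "norm0 xs \<le> \<kappa>" and mfcq: "CC_MFCQ g m h p xs"
  obtains r0 where "r0 > 0" "\<And>t X Y x y. (\<And>k. t k > 0) \<Longrightarrow> t \<longlonglongrightarrow> 0 \<Longrightarrow>
     (\<And>k. NLP_KKT f g m h p \<kappa> (t k) (X k, Y k)) \<Longrightarrow> (\<And>k. X k \<in> nball N xs r0) \<Longrightarrow>
     X \<longlonglongrightarrow> x \<Longrightarrow> Y \<longlonglongrightarrow> y \<Longrightarrow> S_stationary f g m h p \<kappa> x y"
proof -
  obtain c e where c: "c > 0" "e > 0" and est: "\<And>t x y lam \<mu> \<sigma> \<gamma>. t > 0 \<Longrightarrow> (x, y) \<in> nlp_set g m h p \<kappa> t \<Longrightarrow> dist x xs < e \<Longrightarrow>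
      (\<forall>i<m. lam i \<ge> 0 \<and> lam i * g i x = 0) \<Longrightarrow> y_stationary \<kappa> t x y \<sigma> \<gamma> \<Longrightarrow>
      c * mult_size m p lam \<mu> \<gamma>
        \<le> norm (constraint_comb g m h p x lam \<mu> \<gamma>)"
    using regularized_multiplier_estimate[OF C(2,3) mfcq n0] by blast
  obtain r0 where r0: "r0 > 0" "\<And>s. s \<le> r0 \<Longrightarrow> nball N xs s \<subseteq> ball xs e"
    using nball_sub_ball[OF N c(2)] by blast
  show thesis
  proof (rule that[OF r0(1)])
    fix t :: "nat \<Rightarrow> real" and X Y :: "nat \<Rightarrow> real^'n" and x y
    assume "\<And>k. X k \<in> nball N xs r0"
    then have near: "\<And>k. dist (X k) xs < e" using r0(2)[of r0] by (force simp: dist_commute)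
    assume "\<And>k. t k > 0" "t \<longlonglongrightarrow> 0" "\<And>k. NLP_KKT f g m h p \<kappa> (t k) (X k, Y k)"
      "X \<longlonglongrightarrow> x" "Y \<longlonglongrightarrow> y"
    then show "S_stationary f g m h p \<kappa> x y"
      using near by (intro S_stationary_limit[OF C c(1) est])
  qed
qed

lemma KKT_feasible: "NLP_KKT f g m h p \<kappa> t z \<Longrightarrow> z \<in> nlp_set g m h p \<kappa> t"
  by (simp add: NLP_KKT_def kkt_point_def)

lemma nlp_set_y_bounded:
  fixes x y :: "real^'n"
  assumes "(x, y) \<in> nlp_set g m h p \<kappa> t"
  shows "y \<in> cbox 0 1"
  using assms by (auto simp: nlp_set_iff mem_box_cart)

text \<open>Every subsequential limit \<open>x\<close> of the \<open>X k\<close> occurs in a limit \<open>(x, y)\<close> of KKT points, because the \<open>Y k\<close> lie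
  in the unit cube. It is therefore S-stationary and lies in the ball where \<open>xs\<close> is isolated.\<close>

lemma KKT_points_converge:
  fixes xs :: "real^'n"
  assumes norms: "is_norm N" "is_norm (N2 :: (real^'n) \<times> (real^'n) \<Rightarrow> real)"
    and C2: "twice_cont_diff f" "\<forall>i<m. twice_cont_diff (g i)" "\<forall>i<p. twice_cont_diff (h i)"
    and xs: "xs \<in> feas_P g m h p \<kappa>" and mfcq: "CC_MFCQ g m h p xs"
    and strict: "\<exists>\<rho>>0. \<forall>x\<in>feas_P g m h p \<kappa>. x \<noteq> xs \<longrightarrow> dist x xs < \<rho> \<longrightarrow> f xs < f x"
    and sosc: "\<forall>dx \<in> crit_cone_X f g m h p \<kappa> xs. dx \<noteq> 0 \<longrightarrow>
      (\<forall>lam \<mu> \<gamma>. M_multiplier_at f g m h p \<kappa> xs lam \<mu> \<gamma> \<longrightarrow>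
         dx \<bullet> (lagr_hessian f g m h p xs lam \<mu> *v dx) > 0)"
  shows "\<exists>r>0. \<forall>t. pos_decreasing_to_0 t \<longrightarrow>
          (\<forall>\<^sub>F k in sequentially. \<exists>x y. NLP_KKT f g m h p \<kappa> (t k) (x, y) \<and> x \<in> nball N xs r) \<and>
          (\<forall>X Y. (\<forall>\<^sub>F k in sequentially.
                    NLP_KKT f g m h p \<kappa> (t k) (X k, Y k) \<and> X k \<in> nball N xs r) \<longrightarrow> X \<longlonglongrightarrow> xs)"
proof -
  have C: "cont_diff f" "\<forall>i<m. cont_diff (g i)" "\<forall>i<p. cont_diff (h i)"
    using C2 by (auto simp: twice_cont_diff_def)
  have n0: "norm0 xs \<le> \<kappa>" using xs by (simp add: feas_P_def)
  obtain e where e: "e > 0" "\<And>x y. dist x xs < e \<Longrightarrow> S_stationary f g m h p \<kappa> x y \<Longrightarrow> x = xs"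
    using M_stationary_isolated[OF C2 xs mfcq sosc] by blast
  obtain r0 where r0: "r0 > 0" and limit: "\<And>t X Y x y. (\<And>k. t k > 0) \<Longrightarrow> t \<longlonglongrightarrow> 0 \<Longrightarrow>
     (\<And>k. NLP_KKT f g m h p \<kappa> (t k) (X k, Y k)) \<Longrightarrow> (\<And>k. X k \<in> nball N xs r0) \<Longrightarrow>
     X \<longlonglongrightarrow> x \<Longrightarrow> Y \<longlonglongrightarrow> y \<Longrightarrow> S_stationary f g m h p \<kappa> x y"
    using KKT_sequence_limit[OF norms(1) C n0 mfcq] by blast
  obtain r1 where r1: "r1 > 0" "\<And>s. s \<le> r1 \<Longrightarrow> nball N xs s \<subseteq> ball xs (e / 2)"
    using nball_sub_ball[OF norms(1), of "e / 2" xs] e(1) by auto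
  define r where "r = min r0 r1"
  have r: "r > 0" "nball N xs r \<subseteq> nball N xs r0" "nball N xs r \<subseteq> ball xs (e / 2)"
    using r0 r1 by (auto simp: r_def nball_def)
  obtain T where T: "T > 0" "\<And>t. 0 < t \<Longrightarrow> t \<le> T \<Longrightarrow>
     (\<exists>x y. NLP_local_min N2 f g m h p \<kappa> t (x, y) \<and> NLP_KKT f g m h p \<kappa> t (x, y) \<and> x \<in> nball N xs r)"
    using regularized_KKT_local_min_exists[OF norms C xs mfcq strict r(1)] by blast
  show ?thesis
  proof (rule exI[of _ r], intro conjI allI impI)
    fix t :: "nat \<Rightarrow> real" assume "pos_decreasing_to_0 t"
    then have tpos: "\<And>k. t k > 0" and t0: "t \<longlonglongrightarrow> 0" by (auto simp: pos_decreasing_to_0_def)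
    have "\<forall>\<^sub>F k in sequentially. t k < T" using t0 T(1) by (rule order_tendstoD)
    then show "\<forall>\<^sub>F k in sequentially. \<exists>x y. NLP_KKT f g m h p \<kappa> (t k) (x, y) \<and> x \<in> nball N xs r"
      by eventually_elim (use T(2) tpos less_imp_le in blast)
    fix X Y assume "\<forall>\<^sub>F k in sequentially. NLP_KKT f g m h p \<kappa> (t k) (X k, Y k) \<and> X k \<in> nball N xs r"
    then obtain K where K: "\<And>k. k \<ge> K \<Longrightarrow> NLP_KKT f g m h p \<kappa> (t k) (X k, Y k)"
      "\<And>k. k \<ge> K \<Longrightarrow> X k \<in> nball N xs r" unfolding eventually_sequentially by blast
    have near: "X k \<in> cball xs (e / 2)" if "k \<ge> K" for k
      using K(2)[OF that] r(3) by (auto simp: subset_eq less_imp_le)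
    show "X \<longlonglongrightarrow> xs"
    proof (rule compact_unique_subseq_limit_tendsto[OF compact_cball[of xs "e / 2"]])
      show "\<forall>\<^sub>F k in sequentially. X k \<in> cball xs (e / 2)"
        unfolding eventually_sequentially using near by blast
    next
      fix s x assume s: "strict_mono s" and x: "(X \<circ> s) \<longlonglongrightarrow> x"
      define s1 where "s1 k = s (k + K)" for k
      have s1: "strict_mono s1" "s1 k \<ge> K" for k
        using s seq_suble[OF s, of "k + K"] by (auto simp: s1_def strict_mono_def)
      have "\<forall>k. (Y \<circ> s1) k \<in> cbox 0 1"
        using nlp_set_y_bounded[OF KKT_feasible[OF K(1)[OF s1(2)]]] by simp
      then obtain y q where q: "strict_mono (q :: nat \<Rightarrow> nat)" and y: "((Y \<circ> s1) \<circ> q) \<longlonglongrightarrow> y"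
        using compact_cbox[of 0 "1 :: real^'n"] unfolding compact_def by meson
      have "(\<lambda>k. (X \<circ> s) (k + K)) \<longlonglongrightarrow> x" using x by (rule LIMSEQ_ignore_initial_segment)
      then have xq: "(\<lambda>k. X (s1 (q k))) \<longlonglongrightarrow> x"
        using LIMSEQ_subseq_LIMSEQ[OF _ q] by (fastforce simp: o_def s1_def)
      have "S_stationary f g m h p \<kappa> x y"
      proof (rule limit[of "\<lambda>k. t (s1 (q k))" "\<lambda>k. X (s1 (q k))" "\<lambda>k. Y (s1 (q k))"])
        show "(\<lambda>k. t (s1 (q k))) \<longlonglongrightarrow> 0"
          using LIMSEQ_subseq_LIMSEQ[OF LIMSEQ_subseq_LIMSEQ[OF t0 s1(1)] q] by (simp add: o_def)
        show "(\<lambda>k. Y (s1 (q k))) \<longlonglongrightarrow> y" using y by (simp add: o_def)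
        show "X (s1 (q k)) \<in> nball N xs r0" for k using K(2)[OF s1(2)] r(2) by blast
      qed (use tpos K(1) s1(2) xq in auto)
      moreover have "x \<in> cball xs (e / 2)"
        by (rule closed_sequentially[OF closed_cball _ xq]) (rule near[OF s1(2)])
      ultimately show "x = xs" using e by (auto simp: dist_commute)
    qed
  qed (rule r(1))
qed

theorem theorem4p5:
  fixes f :: "real^'n \<Rightarrow> real"
    and g h :: "nat \<Rightarrow> real^'n \<Rightarrow> real"
    and m p \<kappa> :: nat
    and N :: "real^'n \<Rightarrow> real"
    and N2 :: "(real^'n) \<times> (real^'n) \<Rightarrow> real"
  assumes norms: "is_norm N" "is_norm N2"
    and C1: "cont_diff f" "\<forall>i<m. cont_diff (g i)" "\<forall>i<p. cont_diff (h i)"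
    and kappa: "\<kappa> < CARD('n)"
    and nonempty: "feas_P g m h p \<kappa> \<noteq> {}"
  shows
    "(\<forall>xs :: real^'n.
        (strict_local_min_P N f g m h p \<kappa> xs \<or>
         (\<exists>ys. strict_local_min_R N2 f g m h p \<kappa> xs ys \<and> norm0 xs = \<kappa>)) \<and>
        CC_MFCQ g m h p xs \<longrightarrow>
        (\<exists>T>0. \<exists>r>0. \<forall>t. 0 < t \<and> t \<le> T \<longrightarrow>
          (\<exists>x y. NLP_local_min N2 f g m h p \<kappa> t (x, y) \<and> NLP_KKT f g m h p \<kappa> t (x, y) \<and>
                 x \<in> nball N xs r)))
     \<and>
     (\<forall>xs ys :: real^'n.
        (xs, ys) \<in> feas_R g m h p \<kappa> \<and> CC_MFCQ g m h p xs \<longrightarrow>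
        (\<exists>r0>0. \<forall>r. 0 < r \<and> r \<le> r0 \<longrightarrow>
          (\<forall>t X Y. pos_decreasing_to_0 t \<and>
             (\<forall>k. NLP_KKT f g m h p \<kappa> (t k) (X k, Y k) \<and> X k \<in> nball N xs r) \<longrightarrow>
             (\<exists>xb yb. accumulation_point (\<lambda>k. (X k, Y k)) (xb, yb)) \<and>
             (\<forall>xb yb. accumulation_point (\<lambda>k. (X k, Y k)) (xb, yb) \<longrightarrow>
                S_stationary f g m h p \<kappa> xb yb))))
     \<and>
     (\<forall>xs ys :: real^'n.
        twice_cont_diff f \<and> (\<forall>i<m. twice_cont_diff (g i)) \<and> (\<forall>i<p. twice_cont_diff (h i)) \<and>
        strict_local_min_R N2 f g m h p \<kappa> xs ys \<and> norm0 xs = \<kappa> \<and> CC_MFCQ g m h p xs \<and>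
        (\<forall>(dx, dy) \<in> crit_cone_CC f g m h p \<kappa> xs ys. dx \<noteq> 0 \<longrightarrow>
          (\<forall>lam \<mu> \<gamma>. S_multiplier f g m h p xs ys lam \<mu> \<gamma> \<longrightarrow>
             dx \<bullet> (lagr_hessian f g m h p xs lam \<mu> *v dx) > 0)) \<longrightarrow>
        (\<exists>r>0. \<forall>t. pos_decreasing_to_0 t \<longrightarrow>
          (\<forall>\<^sub>F k in sequentially. \<exists>x y. NLP_KKT f g m h p \<kappa> (t k) (x, y) \<and> x \<in> nball N xs r) \<and>
          (\<forall>X Y. (\<forall>\<^sub>F k in sequentially.
                    NLP_KKT f g m h p \<kappa> (t k) (X k, Y k) \<and> X k \<in> nball N xs r) \<longrightarrow>
                 (\<lambda>k. (X k, Y k)) \<longlonglongrightarrow> (xs, ys))))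
     \<and>
     (\<forall>xs :: real^'n.
        twice_cont_diff f \<and> (\<forall>i<m. twice_cont_diff (g i)) \<and> (\<forall>i<p. twice_cont_diff (h i)) \<and>
        strict_local_min_P N f g m h p \<kappa> xs \<and> CC_MFCQ g m h p xs \<and>
        (\<forall>dx \<in> crit_cone_X f g m h p \<kappa> xs. dx \<noteq> 0 \<longrightarrow>
          (\<forall>lam \<mu> \<gamma>. M_multiplier_at f g m h p \<kappa> xs lam \<mu> \<gamma> \<longrightarrow>
             dx \<bullet> (lagr_hessian f g m h p xs lam \<mu> *v dx) > 0)) \<longrightarrow>
        (\<exists>r>0. \<forall>t. pos_decreasing_to_0 t \<longrightarrow>
          (\<forall>\<^sub>F k in sequentially. \<exists>x y. NLP_KKT f g m h p \<kappa> (t k) (x, y) \<and> x \<in> nball N xs r) \<and>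
          (\<forall>X Y. (\<forall>\<^sub>F k in sequentially.
                    NLP_KKT f g m h p \<kappa> (t k) (X k, Y k) \<and> X k \<in> nball N xs r) \<longrightarrow>
                 X \<longlonglongrightarrow> xs)))"
proof (intro conjI allI impI, goal_cases)
  case (1 xs)
  have strict: "xs \<in> feas_P g m h p \<kappa> \<and>
      (\<exists>\<rho>>0. \<forall>x\<in>feas_P g m h p \<kappa>. x \<noteq> xs \<longrightarrow> dist x xs < \<rho> \<longrightarrow> f xs < f x)"
    using 1
  proof (elim conjE disjE exE)
    assume "strict_local_min_P N f g m h p \<kappa> xs"
    then show ?thesis using strict_local_min_P_ball[OF norms(1)] by (auto simp: strict_local_min_P_def)
  next
    fix ys assume "strict_local_min_R N2 f g m h p \<kappa> xs ys" "norm0 xs = \<kappa>"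
    then show ?thesis
      using strict_local_min_R_ball[OF norms(2)] feas_R_imp_feas_P[of xs ys]
      by (auto simp: strict_local_min_R_def)
  qed
  show ?case
    using regularized_KKT_local_min_exists[OF norms C1 conjunct1[OF strict] _ conjunct2[OF strict] zero_less_one]
      1 zero_less_one by blast
next
  case (2 xs ys)
  then have "norm0 xs \<le> \<kappa>" using feas_R_imp_feas_P[of xs ys] by (auto simp: feas_P_def)
  then obtain r0 where r0: "r0 > 0" and limit: "\<And>t X Y x y. (\<And>k. t k > 0) \<Longrightarrow> t \<longlonglongrightarrow> 0 \<Longrightarrow>
     (\<And>k. NLP_KKT f g m h p \<kappa> (t k) (X k, Y k)) \<Longrightarrow> (\<And>k. X k \<in> nball N xs r0) \<Longrightarrow>
     X \<longlonglongrightarrow> x \<Longrightarrow> Y \<longlonglongrightarrow> y \<Longrightarrow> S_stationary f g m h p \<kappa> x y"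
    using KKT_sequence_limit[OF norms(1) C1] 2 by blast
  show ?case
  proof (rule exI[of _ r0], intro conjI allI impI)
    fix r t X Y
    assume r: "0 < r \<and> r \<le> r0" and seq: "pos_decreasing_to_0 t \<and>
       (\<forall>k. NLP_KKT f g m h p \<kappa> (t k) (X k, Y k) \<and> X k \<in> nball N xs r)"
    then have tpos: "\<And>k. t k > 0" and t0: "t \<longlonglongrightarrow> 0" and KKT: "\<And>k. NLP_KKT f g m h p \<kappa> (t k) (X k, Y k)"
      and X: "\<And>k. X k \<in> nball N xs r" by (auto simp: pos_decreasing_to_0_def)
    have X0: "X k \<in> nball N xs r0" for k using X[of k] r by (simp add: nball_def)
    obtain a where a: "a > 0" "\<And>v. a * norm v \<le> N v" using is_norm_equiv[OF norms(1)] by metis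
    have inK: "(X k, Y k) \<in> cball xs (r / a) \<times> cbox 0 1" for k
    proof -
      have "a * norm (X k - xs) \<le> r" using X[of k] a(2)[of "X k - xs"] by (simp add: nball_def)
      then have "dist xs (X k) \<le> r / a" using a(1) by (simp add: dist_norm norm_minus_commute field_simps)
      then show ?thesis using nlp_set_y_bounded[OF KKT_feasible[OF KKT]] by simp
    qed
    have "compact (cball xs (r / a) \<times> cbox 0 (1 :: real^'n))"
      by (intro compact_Times compact_cball compact_cbox)
    then have "seq_compact (cball xs (r / a) \<times> cbox 0 (1 :: real^'n))"
      by (simp only: compact_eq_seq_compact_metric)
    moreover have "\<forall>k. (\<lambda>k. (X k, Y k)) k \<in> cball xs (r / a) \<times> cbox 0 1"
      using inK by blast
    ultimately obtain z s where "strict_mono (s :: nat \<Rightarrow> nat)" "((\<lambda>k. (X k, Y k)) \<circ> s) \<longlonglongrightarrow> z"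
      by (rule seq_compactE)
    then show "\<exists>xb yb. accumulation_point (\<lambda>k. (X k, Y k)) (xb, yb)"
      unfolding accumulation_point_def
      by (intro exI[of _ "fst z"] exI[of _ "snd z"] exI[of _ s]) simp
    fix xb yb assume "accumulation_point (\<lambda>k. (X k, Y k)) (xb, yb)"
    then obtain s where s: "strict_mono s" "((\<lambda>k. (X k, Y k)) \<circ> s) \<longlonglongrightarrow> (xb, yb)"
      unfolding accumulation_point_def by blast
    show "S_stationary f g m h p \<kappa> xb yb"
    proof (rule limit[of "\<lambda>k. t (s k)" "\<lambda>k. X (s k)" "\<lambda>k. Y (s k)"])
      show "(\<lambda>k. t (s k)) \<longlonglongrightarrow> 0" using LIMSEQ_subseq_LIMSEQ[OF t0 s(1)] by (simp add: o_def)
      show "(\<lambda>k. X (s k)) \<longlonglongrightarrow> xb" "(\<lambda>k. Y (s k)) \<longlonglongrightarrow> yb"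
        using tendsto_fst[OF s(2)] tendsto_snd[OF s(2)] by (simp_all add: o_def)
    qed (use tpos KKT X0 in auto)
  qed (rule r0)
next
  case (3 xs ys)
  then have C2: "twice_cont_diff f" "\<forall>i<m. twice_cont_diff (g i)" "\<forall>i<p. twice_cont_diff (h i)"
    and R: "strict_local_min_R N2 f g m h p \<kappa> xs ys" and n0: "norm0 xs = \<kappa>" and mfcq: "CC_MFCQ g m h p xs"
    and sosc: "\<And>dx dy lam \<mu> \<gamma>. (dx, dy) \<in> crit_cone_CC f g m h p \<kappa> xs ys \<Longrightarrow> dx \<noteq> 0 \<Longrightarrow>
       S_multiplier f g m h p xs ys lam \<mu> \<gamma> \<Longrightarrow> dx \<bullet> (lagr_hessian f g m h p xs lam \<mu> *v dx) > 0"
    by blast+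
  have mem: "(xs, ys) \<in> feas_R g m h p \<kappa>" using R by (simp add: strict_local_min_R_def)
  have uniq: "y = ys" if "(xs, y) \<in> feas_R g m h p \<kappa>" for y
    using feas_R_unique_y[OF that n0] feas_R_unique_y[OF mem n0] by simp
  have I00: "I_00 xs ys = {}"
    using feas_R_unique_y[OF mem n0] by (auto simp: I_00_def)
  \<comment> \<open>The feasible \<open>y\<close> is unique and has no zero component on the zero set of \<open>xs\<close>, so the critical directions
    and multipliers of \<open>xs\<close> alone are those of \<open>(xs, ys)\<close>.\<close>
  have sosc': "\<forall>dx \<in> crit_cone_X f g m h p \<kappa> xs. dx \<noteq> 0 \<longrightarrow>
      (\<forall>lam \<mu> \<gamma>. M_multiplier_at f g m h p \<kappa> xs lam \<mu> \<gamma> \<longrightarrow>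
         dx \<bullet> (lagr_hessian f g m h p xs lam \<mu> *v dx) > 0)"
  proof (intro ballI impI allI)
    fix dx lam \<mu> \<gamma>
    assume dx: "dx \<in> crit_cone_X f g m h p \<kappa> xs" "dx \<noteq> 0" "M_multiplier_at f g m h p \<kappa> xs lam \<mu> \<gamma>"
    obtain y dy where "(xs, y) \<in> feas_R g m h p \<kappa>" "(dx, dy) \<in> lin_cone_CC g m h p \<kappa> xs y" "grad f xs \<bullet> dx \<le> 0"
      using dx(1) unfolding crit_cone_X_def lin_cone_X_def by blast
    then have crit: "(dx, dy) \<in> crit_cone_CC f g m h p \<kappa> xs ys"
      using uniq unfolding crit_cone_CC_def by blast
    have "S_multiplier f g m h p xs ys lam \<mu> \<gamma>"
      using dx(3) uniq unfolding M_multiplier_at_def S_multiplier_def I00 by blast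
    from sosc[OF crit dx(2) this] show "dx \<bullet> (lagr_hessian f g m h p xs lam \<mu> *v dx) > 0" .
  qed
  obtain r where r: "r > 0" and conv: "\<And>t. pos_decreasing_to_0 t \<Longrightarrow>
          (\<forall>\<^sub>F k in sequentially. \<exists>x y. NLP_KKT f g m h p \<kappa> (t k) (x, y) \<and> x \<in> nball N xs r) \<and>
          (\<forall>X Y. (\<forall>\<^sub>F k in sequentially.
                    NLP_KKT f g m h p \<kappa> (t k) (X k, Y k) \<and> X k \<in> nball N xs r) \<longrightarrow> X \<longlonglongrightarrow> xs)"
    using KKT_points_converge[OF norms C2 feas_R_imp_feas_P[OF mem] mfcq
        strict_local_min_R_ball[OF norms(2) R n0] sosc'] by blast
  show ?case
  proof (rule exI[of _ r], intro conjI allI impI)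
    fix t :: "nat \<Rightarrow> real" assume t: "pos_decreasing_to_0 t"
    show "\<forall>\<^sub>F k in sequentially. \<exists>x y. NLP_KKT f g m h p \<kappa> (t k) (x, y) \<and> x \<in> nball N xs r"
      using conv[OF t] by blast
    fix X Y assume ev: "\<forall>\<^sub>F k in sequentially. NLP_KKT f g m h p \<kappa> (t k) (X k, Y k) \<and> X k \<in> nball N xs r"
    then have X: "X \<longlonglongrightarrow> xs" using conv[OF t] by blast
    have t0: "t \<longlonglongrightarrow> 0" using t by (simp add: pos_decreasing_to_0_def)
    obtain K where K: "\<And>k. k \<ge> K \<Longrightarrow> (X k, Y k) \<in> nlp_set g m h p \<kappa> (t k)"
      using ev KKT_feasible unfolding eventually_sequentially by blast
    have "Y \<longlonglongrightarrow> ys"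
    proof (rule compact_unique_subseq_limit_tendsto[OF compact_cbox[of 0 1]])
      show "\<forall>\<^sub>F k in sequentially. Y k \<in> cbox 0 1"
        unfolding eventually_sequentially using nlp_set_y_bounded[OF K] by blast
    next
      fix s y assume s: "strict_mono s" and y: "(Y \<circ> s) \<longlonglongrightarrow> y"
      have sK: "s (k + K) \<ge> K" for k using seq_suble[OF s, of "k + K"] by simp
      have lims: "(\<lambda>k. (Y \<circ> s) (k + K)) \<longlonglongrightarrow> y" "(\<lambda>k. (X \<circ> s) (k + K)) \<longlonglongrightarrow> xs" "(\<lambda>k. (t \<circ> s) (k + K)) \<longlonglongrightarrow> 0"
        by (rule LIMSEQ_ignore_initial_segment[OF y],
            rule LIMSEQ_ignore_initial_segment[OF LIMSEQ_subseq_LIMSEQ[OF X s]],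
            rule LIMSEQ_ignore_initial_segment[OF LIMSEQ_subseq_LIMSEQ[OF t0 s]])
      have "(xs, y) \<in> feas_R g m h p \<kappa>"
        using K[OF sK] by (intro tendsto_feas_R[OF C1(2,3) _ lims(3,2,1)]) simp
      then show "y = ys" by (rule uniq)
    qed
    with X show "(\<lambda>k. (X k, Y k)) \<longlonglongrightarrow> (xs, ys)" by (rule tendsto_Pair)
  qed (rule r)
next
  case (4 xs)
  then have C2: "twice_cont_diff f" "\<forall>i<m. twice_cont_diff (g i)" "\<forall>i<p. twice_cont_diff (h i)"
    and P: "strict_local_min_P N f g m h p \<kappa> xs" and mfcq: "CC_MFCQ g m h p xs"
    and sosc: "\<forall>dx \<in> crit_cone_X f g m h p \<kappa> xs. dx \<noteq> 0 \<longrightarrow>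
      (\<forall>lam \<mu> \<gamma>. M_multiplier_at f g m h p \<kappa> xs lam \<mu> \<gamma> \<longrightarrow>
         dx \<bullet> (lagr_hessian f g m h p xs lam \<mu> *v dx) > 0)"
    by blast+
  have "xs \<in> feas_P g m h p \<kappa>" using P by (simp add: strict_local_min_P_def)
  from KKT_points_converge[OF norms C2 this mfcq strict_local_min_P_ball[OF norms(1) P] sosc]
  show ?case
    by blast
qed

end
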